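(* Fix an integer $p\geq 2$ and a real number $s>0$. Let $G_N=T(N,p)$ be the Turán graph on $N$ vertices with $p$ parts, put $$H_s(N,p)=(-1)^N\chi_{G_N}(-s)=s\,T_{G_N}(1+s,0),$$ and set $L=\log(p/(p-1))$. Then, as $N\to\infty$, $$H_s(N,p)\sim \frac{N!\,N^{s-1}}{\Gamma(s)(p-1)^s(1-L)^{(p-1)/2}p^N L^{N+s}}.$$ Equivalently, $$T_{G_N}(1+s,0)\sim \frac{N!\,N^{s-1}}{\Gamma(s+1)(p-1)^s(1-L)^{(p-1)/2}p^N L^{N+s}}.$$
   Context: $\chi_G$ is the chromatic polynomial and $T_G(x,y)$ the Tutte polynomial of a graph $G$. The Turán graph $T(N,p)$ is the complete $p$-partite graph on $N$ vertices whose part sizes differ pairwise by at most $1$ (it is connected for $N\ge2$). $\log$ is the natural logarithm; $a_N\sim b_N$ means $a_N/b_N\to1$. *)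

theory Defs
  imports
    "HOL-Analysis.Analysis"
    "HOL-Computational_Algebra.Polynomial"
    "HOL-Library.Landau_Symbols"
begin

record 'a graph =
  verts :: "'a set"
  edges :: "'a set set"

definition proper_colourings :: "'a graph \<Rightarrow> nat \<Rightarrow> ('a \<Rightarrow> nat) set" where
  "proper_colourings G q =
     {f \<in> verts G \<rightarrow>\<^sub>E {..<q}. \<forall>u\<in>verts G. \<forall>v\<in>verts G. {u, v} \<in> edges G \<longrightarrow> f u \<noteq> f v}"

text \<open>Well-definedness for finite graphs is established below in \<open>poly_chromatic_poly\<close>.\<close>

definition chromatic_poly :: "'a graph \<Rightarrow> real poly" where
  "chromatic_poly G = (THE P. \<forall>q. poly P (real q) = real (card (proper_colourings G q)))"

definition num_components :: "'a set \<Rightarrow> 'a set set \<Rightarrow> nat" where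
  "num_components V A =
     card (V // {(u, v). u \<in> V \<and> v \<in> V \<and> (u, v) \<in> {(a, b). {a, b} \<in> A}\<^sup>*})"

definition graph_rank :: "'a graph \<Rightarrow> 'a set set \<Rightarrow> nat" where
  "graph_rank G A = card (verts G) - num_components (verts G) A"

text \<open>
  The corank--nullity expansion of the Tutte polynomial.  On a finite simple
  graph no subtraction of natural numbers is truncated, and \<open>0 ^ 0 = 1\<close> is the convention needed.
\<close>

definition tutte_poly :: "'a graph \<Rightarrow> real \<Rightarrow> real \<Rightarrow> real" where
  "tutte_poly G x y =
     (\<Sum>A\<in>Pow (edges G). (x - 1) ^ (graph_rank G (edges G) - graph_rank G A)
                        * (y - 1) ^ (card A - graph_rank G A))"

text \<open>
  The map \<open>c\<close> assigns to each vertex the index of its part; when \<open>N < p\<close> some parts are empty.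
\<close>

definition is_turan_graph :: "nat \<Rightarrow> nat \<Rightarrow> 'a graph \<Rightarrow> bool" where
  "is_turan_graph N p G \<longleftrightarrow>
     finite (verts G) \<and> card (verts G) = N \<and>
     (\<exists>c. c ` verts G \<subseteq> {..<p} \<and>
          edges G = {{u, v} | u v. u \<in> verts G \<and> v \<in> verts G \<and> c u \<noteq> c v} \<and>
          (\<forall>i<p. \<forall>j<p. card {v \<in> verts G. c v = i} \<le> card {v \<in> verts G. c v = j} + 1))"


lemma card_proper_colourings_range:
  assumes S: "finite S" "S \<subseteq> {..<q}"
  shows "card {f \<in> proper_colourings G q. f ` verts G = S} =
         card {f \<in> proper_colourings G (card S). f ` verts G = {..<card S}}"
proof -
  obtain h where h: "bij_betw h S {..<card S}"
    using S(1) by (metis ex_bij_betw_finite_nat atLeast0LessThan)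
  define h' where "h' = inv_into S h"
  have h': "bij_betw h' {..<card S} S"
    unfolding h'_def using h by (rule bij_betw_inv_into)
  have hh: "h' (h x) = x" if "x \<in> S" for x
    using that h unfolding h'_def by (simp add: bij_betw_inv_into_left)
  have hh': "h (h' x) = x" if "x < card S" for x
    using that h unfolding h'_def by (simp add: bij_betw_inv_into_right)
  let ?A = "{f \<in> proper_colourings G q. f ` verts G = S}"
  let ?B = "{f \<in> proper_colourings G (card S). f ` verts G = {..<card S}}"
  have "bij_betw (\<lambda>f. restrict (h \<circ> f) (verts G)) ?A ?B"
  proof (rule bij_betwI[where g = "\<lambda>f. restrict (h' \<circ> f) (verts G)"])
    show "(\<lambda>f. restrict (h \<circ> f) (verts G)) \<in> ?A \<rightarrow> ?B"
    proof
      fix f assume f: "f \<in> ?A"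
      have fS: "f u \<in> S" if "u \<in> verts G" for u using f that by auto
      have im: "(\<lambda>x. h (f x)) ` verts G = {..<card S}"
      proof -
        have "(\<lambda>x. h (f x)) ` verts G = h ` (f ` verts G)" by (simp add: image_image)
        then show ?thesis using f h by (simp add: bij_betw_def)
      qed
      have "h (f u) \<noteq> h (f v)" if "u \<in> verts G" "v \<in> verts G" "{u, v} \<in> edges G" for u v
      proof -
        have "f u \<noteq> f v" using f that by (auto simp: proper_colourings_def)
        then show ?thesis using fS that hh by metis
      qed
      with im show "restrict (h \<circ> f) (verts G) \<in> ?B"
        by (auto simp: proper_colourings_def)
    qed
    show "(\<lambda>f. restrict (h' \<circ> f) (verts G)) \<in> ?B \<rightarrow> ?A"
    proof
      fix f assume f: "f \<in> ?B"
      have fS: "f u < card S" if "u \<in> verts G" for u using f that by auto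
      have im: "(\<lambda>x. h' (f x)) ` verts G = S"
      proof -
        have "(\<lambda>x. h' (f x)) ` verts G = h' ` (f ` verts G)" by (simp add: image_image)
        then show ?thesis using f h' by (simp add: bij_betw_def)
      qed
      have "h' (f u) \<noteq> h' (f v)" if "u \<in> verts G" "v \<in> verts G" "{u, v} \<in> edges G" for u v
      proof -
        have "f u \<noteq> f v" using f that by (auto simp: proper_colourings_def)
        then show ?thesis using fS that hh' by metis
      qed
      moreover have "h' (f u) < q" if "u \<in> verts G" for u using im that S(2) by auto
      ultimately show "restrict (h' \<circ> f) (verts G) \<in> ?A"
        using im by (auto simp: proper_colourings_def)
    qed
    show "restrict (h' \<circ> restrict (h \<circ> f) (verts G)) (verts G) = f" if f: "f \<in> ?A" for f
    proof (rule extensionalityI[where A = "verts G"])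
      show "f \<in> extensional (verts G)" using f by (auto simp: proper_colourings_def PiE_def)
    qed (use f hh in auto)
    show "restrict (h \<circ> restrict (h' \<circ> f) (verts G)) (verts G) = f" if f: "f \<in> ?B" for f
    proof (rule extensionalityI[where A = "verts G"])
      show "f \<in> extensional (verts G)" using f by (auto simp: proper_colourings_def PiE_def)
    qed (use f hh' in auto)
  qed
  then show ?thesis by (rule bij_betw_same_card)
qed

lemma finite_proper_colourings: "finite (verts G) \<Longrightarrow> finite (proper_colourings G q)"
  unfolding proper_colourings_def
  by (rule finite_subset[of _ "verts G \<rightarrow>\<^sub>E {..<q}"]) (auto intro: finite_PiE)

lemma ex_chromatic_poly:
  fixes G :: "'a graph"
  assumes fin: "finite (verts G)"
  shows "\<exists>P :: real poly. \<forall>q. poly P (real q) = real (card (proper_colourings G q))"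
proof -
  define n where "n = card (verts G)"
  define a where "a k = card {f \<in> proper_colourings G k. f ` verts G = {..<k}}" for k
  have a0: "a k = 0" if "k > n" for k
  proof -
    have "f ` verts G \<noteq> {..<k}" for f :: "'a \<Rightarrow> nat"
    proof
      assume "f ` verts G = {..<k}"
      then show False using card_image_le[OF fin, of f] that by (simp add: n_def)
    qed
    then have "{f \<in> proper_colourings G k. f ` verts G = {..<k}} = {}" by blast
    then show ?thesis by (simp only: a_def card.empty)
  qed
  have count: "card (proper_colourings G q) = (\<Sum>k\<le>n. (q choose k) * a k)" for q
  proof -
    have "card (proper_colourings G q) =
          (\<Sum>S\<in>Pow {..<q}. card {f \<in> proper_colourings G q. f ` verts G = S})"
    proof -
      have "(\<lambda>f. f ` verts G) ` proper_colourings G q \<subseteq> Pow {..<q}"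
        by (auto simp: proper_colourings_def)
      from sum.group[OF finite_proper_colourings[OF fin] _ this, of "\<lambda>_. 1::nat"]
      show ?thesis by simp
    qed
    also have "\<dots> = (\<Sum>S\<in>Pow {..<q}. a (card S))"
      unfolding a_def by (intro sum.cong refl card_proper_colourings_range) (auto intro: finite_subset)
    also have "\<dots> = (\<Sum>k\<le>q. \<Sum>S\<in>{S \<in> Pow {..<q}. card S = k}. a (card S))"
      by (rule sum.group[symmetric]) (use card_mono[of "{..<q}"] in auto)
    also have "\<dots> = (\<Sum>k\<le>q. (q choose k) * a k)"
      using n_subsets[of "{..<q}"] by (intro sum.cong refl) simp
    also have "\<dots> = (\<Sum>k\<le>max q n. (q choose k) * a k)"
      by (rule sum.mono_neutral_left) auto
    also have "\<dots> = (\<Sum>k\<le>n. (q choose k) * a k)"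
      by (rule sum.mono_neutral_right) (auto simp: a0)
    finally show ?thesis .
  qed
  define P :: "real poly" where
    "P = (\<Sum>k\<le>n. smult (real (a k) / fact k) (\<Prod>i<k. [:- real i, 1:]))"
  have "poly P (real q) = real (card (proper_colourings G q))" for q
  proof -
    have "poly P (real q) = (\<Sum>k\<le>n. real (a k) / fact k * (\<Prod>i<k. real q - real i))"
      by (simp add: P_def poly_sum poly_prod)
    also have "\<dots> = (\<Sum>k\<le>n. real (q choose k) * real (a k))"
      by (intro sum.cong refl)
         (simp add: binomial_gbinomial gbinomial_prod_rev atLeast0LessThan)
    finally show ?thesis by (simp add: count)
  qed
  then show ?thesis by blast
qed

lemma poly_chromatic_poly:
  assumes "finite (verts G)"
  shows "poly (chromatic_poly G) (real q) = real (card (proper_colourings G q))"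
proof -
  let ?Q = "\<lambda>P :: real poly. \<forall>q. poly P (real q) = real (card (proper_colourings G q))"
  have "\<exists>!P. ?Q P"
  proof (rule ex_ex1I[OF ex_chromatic_poly[OF assms]])
    fix P P' assume "?Q P" "?Q P'"
    then have "range real \<subseteq> {x. poly (P - P') x = 0}" by auto
    moreover have "infinite (range real)"
      using finite_imageD[of real UNIV] by (auto simp: inj_on_def)
    ultimately have "infinite {x. poly (P - P') x = 0}"
      using finite_subset by blast
    then show "P = P'" using poly_roots_finite[of "P - P'"] by auto
  qed
  from theI'[OF this] show ?thesis unfolding chromatic_poly_def by blast
qed

lemma ex_turan_graph:
  assumes "p > 0"
  shows "\<exists>G :: nat graph. is_turan_graph N p G"
proof -
  define G :: "nat graph" where
    "G = \<lparr>verts = {..<N}, edges = {{u, v} | u v. u < N \<and> v < N \<and> u mod p \<noteq> v mod p}\<rparr>"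
  have bounds: "N div p \<le> card {v \<in> {..<N}. v mod p = i} \<and> card {v \<in> {..<N}. v mod p = i} \<le> N div p + 1"
    if "i < p" for i
  proof
    have inj: "inj_on (\<lambda>k. i + k * p) X" for X using assms by (auto simp: inj_on_def)
    have "(\<lambda>k. i + k * p) ` {..<N div p} \<subseteq> {v \<in> {..<N}. v mod p = i}"
    proof clarify
      fix k assume "k < N div p"
      then have "(k + 1) * p \<le> N div p * p" by (intro mult_right_mono) auto
      also have "\<dots> \<le> N" by simp
      finally show "i + k * p \<in> {..<N} \<and> (i + k * p) mod p = i" using that by simp
    qed
    from card_mono[OF _ this] show "N div p \<le> card {v \<in> {..<N}. v mod p = i}"
      by (simp add: card_image[OF inj])
    have "{v \<in> {..<N}. v mod p = i} \<subseteq> (\<lambda>k. i + k * p) ` {..N div p}"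
    proof
      fix v assume v: "v \<in> {v \<in> {..<N}. v mod p = i}"
      then have "v div p \<le> N div p" by (intro div_le_mono) auto
      moreover have "v = i + v div p * p" using v by auto
      ultimately show "v \<in> (\<lambda>k. i + k * p) ` {..N div p}" by blast
    qed
    from card_mono[OF _ this] show "card {v \<in> {..<N}. v mod p = i} \<le> N div p + 1"
      by (simp add: card_image[OF inj])
  qed
  have "is_turan_graph N p G"
    unfolding is_turan_graph_def
  proof (intro conjI exI[of _ "\<lambda>v. v mod p"] allI impI)
    show "(\<lambda>v. v mod p) ` verts G \<subseteq> {..<p}" using assms by auto
    fix i j assume "i < p" "j < p"
    show "card {v \<in> verts G. v mod p = i} \<le> card {v \<in> verts G. v mod p = j} + 1"
      using bounds[OF \<open>i < p\<close>] bounds[OF \<open>j < p\<close>] by (simp add: G_def)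
  qed (auto simp: G_def)
  then show ?thesis by blast
qed

end

theory Submission
  imports Defs "HOL-Probability.Probability" "HOL-Complex_Analysis.Complex_Analysis" "HOL-Real_Asymp.Real_Asymp"
begin

text \<open>
  Colouring the parts one after the other shows that the chromatic polynomial of the complete
  multipartite graph with parts \<open>n 0, \<dots>, n (p - 1)\<close> arises from the product \<open>A\<close> of the Touchard polynomials
  of the \<open>n i\<close> by replacing each power \<open>x ^ k\<close> by the falling factorial of length \<open>k\<close>.  At \<open>- s\<close> the
  falling factorials are, up to sign, moments of the Gamma distribution, so that \<open>\<Gamma>(s) H\<close> is, up to
  sign, the integral of \<open>x powr (s - 1) * exp (- x) * A (- x)\<close> over \<open>x > 0\<close>.  Since \<open>p * (1 - exp (- L)) = 1\<close>,
  the factor \<open>exp (- x)\<close> can be distributed evenly over the Touchard polynomials; up to constants, each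
  factor is then the \<open>n\<close>-th coefficient of \<open>exp (x * (\<psi> t - \<psi> L))\<close> with \<open>\<psi> t = 1 - exp (- t)\<close>, extracted on the
  circle of radius \<open>L\<close>.  These coefficients behave like the point masses of a (signed) family of
  distributions with cumulant generating function proportional to \<open>x\<close>: they obey a local limit theorem with Gaussian limit
  and, by shifting the contour, exponential tail bounds.  Dominated convergence turns the integral into that
  of the \<open>p\<close>-th power of a Gaussian density.  The same argument for \<open>\<psi> t = t\<close>, that is for Poisson
  weights, where the integral is elementary, gives the asymptotics of the multinomial coefficient
  and replaces Stirling's formula.
\<close>

section \<open>Chromatic polynomials of complete multipartite graphs\<close>

text \<open>Origin of the constants: per unit of x the masses have cumulant function \<kappa>(z) =
  \<psi>(L exp z) - \<psi>(L), hence mean \<mu> = L exp(-L) and variance v = \<mu> (1 - L). The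
  integral concentrates at x = N / (p \<mu>) = N / ((p - 1) L); this accounts for N^(s-1) and for
  ((p-1) L)^s. In the scaled variable the limiting Gaussian has variance v / \<mu> = 1 - L, the
  source of (1 - L)^((p-1)/2). For Poisson weights that variance is 1, and in the quotient of the
  two integrals the powers of sqrt(N / p) and the integral of the p-th power of the standard density
  cancel.

  The obstacle is the sign: the coefficients of exp(x \<psi>(t)) are not probabilities, so every
  estimate must come from the circle integral. This needs the real part of \<kappa> to fall off
  quadratically from the positive axis, and v > 0 already forces L < 1. As p >= 2 gives L <= ln 2,
  radii up to 3/4 are enough, which is where the numerical constants come from. What the analysis
  uses is collected in \<open>cumulant_family\<close>, so that both weights run through one
  proof.\<close>

definition umbral :: "(nat \<Rightarrow> real) \<Rightarrow> real poly \<Rightarrow> real" where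
  "umbral a P = (\<Sum>k\<le>degree P. coeff P k * a k)"

lemma umbral_eq_sum: "degree P \<le> n \<Longrightarrow> umbral a P = (\<Sum>k\<le>n. coeff P k * a k)"
  unfolding umbral_def by (rule sum.mono_neutral_left) (auto simp: coeff_eq_0)

lemma umbral_add: "umbral a (P + Q) = umbral a P + umbral a Q"
proof -
  have "umbral a (P + Q) = (\<Sum>k\<le>max (degree P) (degree Q). coeff (P + Q) k * a k)"
    by (rule umbral_eq_sum[OF degree_add_le_max])
  moreover have "umbral a P = (\<Sum>k\<le>max (degree P) (degree Q). coeff P k * a k)"
    "umbral a Q = (\<Sum>k\<le>max (degree P) (degree Q). coeff Q k * a k)"
    by (rule umbral_eq_sum, simp)+
  ultimately show ?thesis by (simp add: distrib_right sum.distrib)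
qed

lemma umbral_smult: "umbral a (smult r P) = r * umbral a P"
  by (simp add: umbral_eq_sum[OF degree_smult_le] sum_distrib_left umbral_def mult_ac)

lemma umbral_add_fun: "umbral (\<lambda>k. a k + b k) P = umbral a P + umbral b P"
  by (simp add: umbral_def distrib_left sum.distrib)

lemma umbral_0 [simp]: "umbral a 0 = 0" by (simp add: umbral_def)

lemma umbral_1 [simp]: "umbral a 1 = a 0" by (simp add: umbral_def)

lemma umbral_pCons: "umbral a (pCons c P) = c * a 0 + umbral (\<lambda>k. a (Suc k)) P"
proof -
  have "umbral a (pCons c P) = (\<Sum>k\<le>Suc (degree P). coeff (pCons c P) k * a k)"
    by (rule umbral_eq_sum[OF degree_pCons_le])
  also have "\<dots> = c * a 0 + (\<Sum>k\<le>degree P. coeff P k * a (Suc k))"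
    by (subst sum.atMost_Suc_shift) simp
  finally show ?thesis by (simp add: umbral_def)
qed

text \<open>The Euler operator multiplies the coefficient of \<open>x ^ k\<close> by
  \<open>k\<close>, and this factor can be moved onto the sequence.\<close>

lemma umbral_X_pderiv: "umbral a (pCons 0 (pderiv P)) = umbral (\<lambda>k. real k * a k) P"
proof -
  have "umbral a (pCons 0 (pderiv P)) = (\<Sum>k\<le>degree P. coeff (pCons 0 (pderiv P)) k * a k)"
  proof (cases "degree P = 0")
    case True
    then have "pderiv P = 0" by (simp add: pderiv_eq_0_iff)
    then show ?thesis by simp
  next
    case False
    then show ?thesis
      by (intro umbral_eq_sum order.trans[OF degree_pCons_le]) (simp add: degree_pderiv)
  qed
  also have "\<dots> = (\<Sum>k\<le>degree P. coeff P k * (real k * a k))"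
    by (intro sum.cong refl) (simp add: coeff_pCons coeff_pderiv split: nat.split)
  finally show ?thesis by (simp add: umbral_def)
qed

text \<open>Multiplication by the variable shifts the sequence, so the induction runs over all
  \<open>a\<close>. The nested form is what colouring one part after another produces: the outer
  index counts the colours already used.\<close>

lemma umbral_mult: "umbral a (P * Q) = umbral (\<lambda>k. umbral (\<lambda>j. a (k + j)) Q) P"
proof (induction P arbitrary: a)
  case 0
  then show ?case by simp
next
  case (pCons c P)
  then show ?case by (simp add: umbral_add umbral_smult umbral_pCons)
qed

text \<open>The \<open>k\<close>-th coefficient is the Stirling number of the second kind. The
  recurrence with a derivative is chosen because it arises both from adding a vertex to a part and
  from differentiating the generating function.\<close>

fun touchard :: "nat \<Rightarrow> real poly" where
  "touchard 0 = 1"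
| "touchard (Suc n) = pCons 0 (touchard n + pderiv (touchard n))"

lemma umbral_touchard_Suc:
  "umbral a (touchard (Suc n)) = umbral (\<lambda>k. a (Suc k) + real k * a k) (touchard n)"
proof -
  have "touchard (Suc n) = pCons 0 (touchard n) + pCons 0 (pderiv (touchard n))" by simp
  then show ?thesis by (simp only: umbral_add umbral_X_pderiv umbral_add_fun) (simp add: umbral_pCons)
qed

definition ffact :: "real \<Rightarrow> nat \<Rightarrow> real" where
  "ffact x k = (\<Prod>i<k. x - real i)"

lemma ffact_0 [simp]: "ffact x 0 = 1" by (simp add: ffact_def)

lemma ffact_Suc: "ffact x (Suc k) = ffact x k * (x - real k)" by (simp add: ffact_def)

lemma ffact_add: "ffact x (k + j) = ffact x k * ffact (x - real k) j"
  by (induction j) (simp_all add: ffact_Suc algebra_simps)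

text \<open>A new element \<open>w\<close> either repeats one of the \<open>k\<close> values already
  taken or takes one of the \<open>card C - k\<close> others. The hypothesis is applied to the
  weight changed accordingly, hence the induction over all \<open>h\<close>.\<close>

lemma sum_PiE_card_image:
  fixes h :: "nat \<Rightarrow> real" and C :: "'b set"
  assumes "finite W" "finite C"
  shows "(\<Sum>f\<in>W \<rightarrow>\<^sub>E C. h (card (f ` W))) = umbral (\<lambda>k. ffact (card C) k * h k) (touchard (card W))"
  using assms(1)
proof (induction W arbitrary: h rule: finite_induct)
  case empty
  then show ?case by simp
next
  case (insert w W)
  have "(\<Sum>f\<in>insert w W \<rightarrow>\<^sub>E C. h (card (f ` insert w W))) =
        (\<Sum>(y, f)\<in>C \<times> (W \<rightarrow>\<^sub>E C). h (card ((f(w := y)) ` insert w W)))"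
    unfolding PiE_insert_eq using insert.hyps
    by (subst sum.reindex[OF inj_combinator[of w W "\<lambda>_. C"]]) (auto intro!: sum.cong)
  also have "\<dots> = (\<Sum>y\<in>C. \<Sum>f\<in>W \<rightarrow>\<^sub>E C. h (card ((f(w := y)) ` insert w W)))"
    by (simp add: sum.cartesian_product)
  also have "\<dots> = (\<Sum>f\<in>W \<rightarrow>\<^sub>E C. \<Sum>y\<in>C. h (card ((f(w := y)) ` insert w W)))"
    by (rule sum.swap)
  also have "\<dots> = (\<Sum>f\<in>W \<rightarrow>\<^sub>E C. real (card (f ` W)) * h (card (f ` W)) +
        (real (card C) - real (card (f ` W))) * h (Suc (card (f ` W))))"
  proof (rule sum.cong[OF refl])
    fix f assume f: "f \<in> W \<rightarrow>\<^sub>E C"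
    have sub: "f ` W \<subseteq> C" using f by auto
    have fin: "finite (f ` W)" using insert.hyps by simp
    have "(\<Sum>y\<in>C. h (card ((f(w := y)) ` insert w W))) = (\<Sum>y\<in>C. h (card (insert y (f ` W))))"
    proof (rule sum.cong[OF refl])
      fix y
      have "(f(w := y)) ` insert w W = insert y (f ` W)" using insert.hyps by auto
      then show "h (card ((f(w := y)) ` insert w W)) = h (card (insert y (f ` W)))" by simp
    qed
    also have "\<dots> = (\<Sum>y\<in>f ` W. h (card (insert y (f ` W)))) + (\<Sum>y\<in>C - f ` W. h (card (insert y (f ` W))))"
      using sum.subset_diff[OF sub assms(2)] by (simp add: add.commute)
    also have "(\<Sum>y\<in>f ` W. h (card (insert y (f ` W)))) = (\<Sum>y\<in>f ` W. h (card (f ` W)))"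
      by (intro sum.cong refl) (simp add: insert_absorb)
    also have "(\<Sum>y\<in>C - f ` W. h (card (insert y (f ` W)))) = (\<Sum>y\<in>C - f ` W. h (Suc (card (f ` W))))"
      using fin by (intro sum.cong refl) simp
    finally show "(\<Sum>y\<in>C. h (card ((f(w := y)) ` insert w W))) =
        real (card (f ` W)) * h (card (f ` W)) + (real (card C) - real (card (f ` W))) * h (Suc (card (f ` W)))"
      using card_mono[OF assms(2) sub] by (simp add: card_Diff_subset[OF fin sub] of_nat_diff)
  qed
  also have "\<dots> = umbral (\<lambda>k. ffact (card C) k * (real k * h k + (real (card C) - real k) * h (Suc k))) (touchard (card W))"
    by (rule insert.IH)
  also have "\<dots> = umbral (\<lambda>k. ffact (card C) k * h k) (touchard (card (insert w W)))"
    using insert.hyps by (simp add: umbral_touchard_Suc ffact_Suc algebra_simps del: touchard.simps)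
  finally show ?case .
qed

text \<open>The colour set is arbitrary instead of an initial segment because, once a part is
  coloured, the other parts use what remains of it.\<close>

definition multipartite_colourings :: "('a \<Rightarrow> nat) \<Rightarrow> 'a set \<Rightarrow> 'b set \<Rightarrow> ('a \<Rightarrow> 'b) set" where
  "multipartite_colourings c V C = {f \<in> V \<rightarrow>\<^sub>E C. \<forall>u\<in>V. \<forall>v\<in>V. c u \<noteq> c v \<longrightarrow> f u \<noteq> f v}"

lemma finite_multipartite_colourings:
  "finite V \<Longrightarrow> finite C \<Longrightarrow> finite (multipartite_colourings c V C)"
  unfolding multipartite_colourings_def by (rule finite_subset[of _ "V \<rightarrow>\<^sub>E C"]) (auto intro: finite_PiE)

text \<open>Inside the part \<open>W\<close> there is no constraint, and every vertex of
  \<open>V\<close> is adjacent to all of \<open>W\<close>; so \<open>V\<close> depends on the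
  colouring of \<open>W\<close> only through the set of colours it uses.\<close>

lemma bij_betw_split_multipartite_colourings:
  assumes disj: "V \<inter> W = {}"
    and cW: "\<And>u v. u \<in> W \<Longrightarrow> v \<in> W \<Longrightarrow> c u = c v"
    and cVW: "\<And>u v. u \<in> V \<Longrightarrow> v \<in> W \<Longrightarrow> c u \<noteq> c v"
  shows "bij_betw (\<lambda>g. (restrict g W, restrict g V)) (multipartite_colourings c (V \<union> W) C)
           (SIGMA f:W \<rightarrow>\<^sub>E C. multipartite_colourings c V (C - f ` W))"
proof (rule bij_betwI[where g = "\<lambda>(f, g). \<lambda>x\<in>V \<union> W. if x \<in> W then f x else g x"])
  show "(\<lambda>g. (restrict g W, restrict g V)) \<in> multipartite_colourings c (V \<union> W) C \<rightarrow>
      (SIGMA f:W \<rightarrow>\<^sub>E C. multipartite_colourings c V (C - f ` W))"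
    using cVW by (fastforce simp: multipartite_colourings_def)
  show "(\<lambda>(f, g). \<lambda>x\<in>V \<union> W. if x \<in> W then f x else g x) \<in>
      (SIGMA f:W \<rightarrow>\<^sub>E C. multipartite_colourings c V (C - f ` W)) \<rightarrow> multipartite_colourings c (V \<union> W) C"
  proof clarify
    fix f g assume f: "f \<in> W \<rightarrow>\<^sub>E C" and g: "g \<in> multipartite_colourings c V (C - f ` W)"
    have gC: "g x \<in> C - f ` W" if "x \<in> V" for x
      using g that by (auto simp: multipartite_colourings_def)
    have gg: "g u \<noteq> g v" if "u \<in> V" "v \<in> V" "c u \<noteq> c v" for u v
      using g that by (auto simp: multipartite_colourings_def)
    have fC: "f x \<in> C" if "x \<in> W" for x using f that by auto
    have gf: "g u \<noteq> f v" if "u \<in> V" "v \<in> W" for u v using gC[OF that(1)] that(2) by auto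
    have "(if u \<in> W then f u else g u) \<noteq> (if v \<in> W then f v else g v)"
      if "u \<in> V \<union> W" "v \<in> V \<union> W" "c u \<noteq> c v" for u v
      using that cW[of u v] gg[of u v] gf[of u v] gf[of v u]
      by (cases "u \<in> W"; cases "v \<in> W") auto
    then show "(\<lambda>x\<in>V \<union> W. if x \<in> W then f x else g x) \<in> multipartite_colourings c (V \<union> W) C"
      using gC fC by (auto simp: multipartite_colourings_def)
  qed
  show "(case (restrict g W, restrict g V) of (f, g) \<Rightarrow> \<lambda>x\<in>V \<union> W. if x \<in> W then f x else g x) = g"
    if "g \<in> multipartite_colourings c (V \<union> W) C" for g
  proof -
    have "g x = undefined" if "x \<notin> V \<union> W" for x
      using \<open>g \<in> _\<close> that by (auto simp: multipartite_colourings_def)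
    then show ?thesis by (auto simp: fun_eq_iff)
  qed
  show "(restrict (case y of (f, g) \<Rightarrow> \<lambda>x\<in>V \<union> W. if x \<in> W then f x else g x) W,
         restrict (case y of (f, g) \<Rightarrow> \<lambda>x\<in>V \<union> W. if x \<in> W then f x else g x) V) = y"
    if "y \<in> (SIGMA f:W \<rightarrow>\<^sub>E C. multipartite_colourings c V (C - f ` W))" for y
  proof -
    obtain f g where y: "y = (f, g)" "f \<in> W \<rightarrow>\<^sub>E C" "g \<in> V \<rightarrow>\<^sub>E C - f ` W"
      using \<open>y \<in> _\<close> by (auto simp: multipartite_colourings_def)
    have "f x = undefined" if "x \<notin> W" for x using y(2) that by auto
    moreover have "g x = undefined" if "x \<notin> V" for x using y(3) that by auto
    ultimately show ?thesis using disj by (auto simp: y fun_eq_iff)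
  qed
qed

lemma card_multipartite_colourings:
  assumes "finite V" "finite C" "c ` V \<subseteq> {..<p}"
  shows "real (card (multipartite_colourings c V C)) =
         umbral (ffact (card C)) (\<Prod>i<p. touchard (card {v \<in> V. c v = i}))"
  using assms
proof (induction p arbitrary: V C)
  case 0
  then have "V = {}" by auto
  then show ?case by (simp add: multipartite_colourings_def)
next
  case (Suc p)
  define W where "W = {v \<in> V. c v = p}"
  define V' where "V' = {v \<in> V. c v < p}"
  have V: "V = V' \<union> W" "V' \<inter> W = {}" using Suc.prems(3) by (auto simp: V'_def W_def)
  have fin: "finite W" "finite V'" using Suc.prems by (auto simp: W_def V'_def)
  have parts: "{v \<in> V'. c v = i} = {v \<in> V. c v = i}" if "i < p" for i
    using that by (auto simp: V'_def)
  have "card (multipartite_colourings c V C) =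
        card (SIGMA f:W \<rightarrow>\<^sub>E C. multipartite_colourings c V' (C - f ` W))"
    unfolding V(1)
    by (rule bij_betw_same_card[OF bij_betw_split_multipartite_colourings]) (auto simp: V'_def W_def)
  also have "\<dots> = (\<Sum>f\<in>W \<rightarrow>\<^sub>E C. card (multipartite_colourings c V' (C - f ` W)))"
    using fin Suc.prems by (intro card_SigmaI finite_PiE ballI finite_multipartite_colourings) auto
  finally have "real (card (multipartite_colourings c V C)) =
        (\<Sum>f\<in>W \<rightarrow>\<^sub>E C. real (card (multipartite_colourings c V' (C - f ` W))))" by simp
  also have "\<dots> = (\<Sum>f\<in>W \<rightarrow>\<^sub>E C. umbral (ffact (real (card C) - real (card (f ` W))))
                     (\<Prod>i<p. touchard (card {v \<in> V. c v = i})))"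
  proof (rule sum.cong[OF refl])
    fix f assume f: "f \<in> W \<rightarrow>\<^sub>E C"
    then have sub: "f ` W \<subseteq> C" by auto
    have "real (card (multipartite_colourings c V' (C - f ` W))) =
      umbral (ffact (real (card (C - f ` W)))) (\<Prod>i<p. touchard (card {v \<in> V'. c v = i}))"
      using Suc.prems fin by (intro Suc.IH) (auto simp: V'_def)
    also have "real (card (C - f ` W)) = real (card C) - real (card (f ` W))"
      using card_mono[OF Suc.prems(2) sub] fin by (simp add: card_Diff_subset[OF _ sub] of_nat_diff)
    finally show "real (card (multipartite_colourings c V' (C - f ` W))) =
      umbral (ffact (real (card C) - real (card (f ` W)))) (\<Prod>i<p. touchard (card {v \<in> V. c v = i}))"
      by (simp add: parts)
  qed
  also have "\<dots> = umbral (\<lambda>k. ffact (card C) k * umbral (ffact (real (card C) - real k))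
                     (\<Prod>i<p. touchard (card {v \<in> V. c v = i}))) (touchard (card W))"
    using fin Suc.prems by (intro sum_PiE_card_image) auto
  \<comment> \<open>By \<open>ffact_add\<close>, choosing \<open>k\<close> colours for
    \<open>W\<close> and then \<open>j\<close> of the remaining ones is a single falling factorial
    of length \<open>k + j\<close>, which \<open>umbral_mult\<close> reads as a product of
    polynomials.\<close>
  also have "\<dots> = umbral (ffact (card C)) (touchard (card W) * (\<Prod>i<p. touchard (card {v \<in> V. c v = i})))"
    by (simp add: umbral_mult ffact_add) (simp add: umbral_def sum_distrib_left mult_ac)
  finally show ?case by (simp add: W_def mult.commute)
qed

lemma chromatic_poly_eqI:
  assumes "finite (verts G)" "\<And>q. poly Q (real q) = real (card (proper_colourings G q))"
  shows "chromatic_poly G = Q"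
proof -
  have "range real \<subseteq> {x. poly (chromatic_poly G - Q) x = 0}"
    using poly_chromatic_poly[OF assms(1)] assms(2) by auto
  moreover have "infinite (range real)"
    using finite_imageD[of real UNIV] by (auto simp: inj_on_def)
  ultimately have "infinite {x. poly (chromatic_poly G - Q) x = 0}"
    using finite_subset by blast
  then show ?thesis using poly_roots_finite[of "chromatic_poly G - Q"] by auto
qed

lemma poly_chromatic_poly_multipartite:
  fixes G :: "'a graph" and c :: "'a \<Rightarrow> nat"
  assumes fin: "finite (verts G)" and c: "c ` verts G \<subseteq> {..<p}"
    and E: "edges G = {{u, v} | u v. u \<in> verts G \<and> v \<in> verts G \<and> c u \<noteq> c v}"
  shows "poly (chromatic_poly G) x = umbral (ffact x) (\<Prod>i<p. touchard (card {v \<in> verts G. c v = i}))"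
proof -
  define A where "A = (\<Prod>i<p. touchard (card {v \<in> verts G. c v = i}))"
  \<comment> \<open>The count is known for natural numbers of colours only; writing the falling
    factorials as polynomials in that number makes it valid at every real \<open>x\<close>.\<close>
  define Q where "Q = (\<Sum>k\<le>degree A. smult (coeff A k) (\<Prod>i<k. [:- real i, 1:]))"
  have Q: "poly Q y = umbral (ffact y) A" for y
    by (simp add: Q_def umbral_def ffact_def poly_sum poly_prod)
  have edge: "{u, v} \<in> edges G \<longleftrightarrow> c u \<noteq> c v" if "u \<in> verts G" "v \<in> verts G" for u v
    using that unfolding E by (auto simp: doubleton_eq_iff)
  have "proper_colourings G q = multipartite_colourings c (verts G) {..<q}" for q
    using edge by (auto simp: proper_colourings_def multipartite_colourings_def)
  then have "real (card (proper_colourings G q)) = poly Q (real q)" for q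
    using card_multipartite_colourings[OF fin _ c, of "{..<q}"] by (simp add: Q A_def)
  then have "chromatic_poly G = Q" by (intro chromatic_poly_eqI[OF fin]) simp
  then show ?thesis by (simp add: Q A_def)
qed

section \<open>The Tutte polynomial on the line y = 0\<close>

definition component_rel :: "'a set \<Rightarrow> 'a set set \<Rightarrow> ('a \<times> 'a) set" where
  "component_rel V A = {(u, v). u \<in> V \<and> v \<in> V \<and> (u, v) \<in> {(a, b). {a, b} \<in> A}\<^sup>*}"

lemma num_components_eq: "num_components V A = card (V // component_rel V A)"
  by (simp add: num_components_def component_rel_def)

lemma equiv_component_rel: "equiv V (component_rel V A)"
proof (rule equivI)
  have "sym {(a, b). {a, b} \<in> A}" by (auto simp: sym_def insert_commute)
  then have "sym ({(a, b). {a, b} \<in> A}\<^sup>*)" by (rule sym_rtrancl)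
  then show "sym (component_rel V A)" by (auto simp: component_rel_def sym_def)
  show "trans (component_rel V A)" unfolding component_rel_def trans_def by (auto intro: rtrancl_trans)
qed (auto simp: component_rel_def refl_on_def)

text \<open>The value set is left open for two uses: \<open>{..<q}\<close> counts colourings in
  which all edges of \<open>A\<close> are monochromatic, and the booleans serve to bound the number
  of components.\<close>

definition locally_constant :: "'a set \<Rightarrow> 'a set set \<Rightarrow> 'b set \<Rightarrow> ('a \<Rightarrow> 'b) set" where
  "locally_constant V A D = {f \<in> V \<rightarrow>\<^sub>E D. \<forall>u\<in>V. \<forall>v\<in>V. {u, v} \<in> A \<longrightarrow> f u = f v}"

lemma locally_constant_component:
  assumes A: "A \<subseteq> Pow V" and f: "f \<in> locally_constant V A D" and uv: "(u, v) \<in> component_rel V A"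
  shows "f u = f v"
proof -
  have "(u, v) \<in> {(a, b). {a, b} \<in> A}\<^sup>*" using uv by (simp add: component_rel_def)
  then show ?thesis
  proof (induction rule: rtrancl_induct)
    case (step y z)
    then have "{y, z} \<in> A" by simp
    \<comment> \<open>A path along \<open>A\<close> cannot leave \<open>V\<close>, the only place
      where \<open>f\<close> is controlled.\<close>
    moreover from this have "y \<in> V" "z \<in> V" using A by auto
    ultimately show ?case using f step.IH by (simp add: locally_constant_def)
  qed simp
qed

text \<open>Such functions are those that factor through the set of components, with one free value
  for each component.\<close>

lemma card_locally_constant:
  assumes V: "finite V" and A: "A \<subseteq> Pow V"
  shows "card (locally_constant V A D) = card D ^ num_components V A"
proof -
  define R where "R = component_rel V A"
  have eqv: "equiv V R" unfolding R_def by (rule equiv_component_rel)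
  have "bij_betw (\<lambda>F. \<lambda>v\<in>V. F (R `` {v})) (V // R \<rightarrow>\<^sub>E D) (locally_constant V A D)"
  proof (rule bij_betwI[where g = "\<lambda>f. \<lambda>X\<in>V // R. f (SOME v. v \<in> X)"])
    show "(\<lambda>F. \<lambda>v\<in>V. F (R `` {v})) \<in> (V // R \<rightarrow>\<^sub>E D) \<rightarrow> locally_constant V A D"
    proof
      fix F assume F: "F \<in> V // R \<rightarrow>\<^sub>E D"
      have "R `` {u} = R `` {v}" if "u \<in> V" "v \<in> V" "{u, v} \<in> A" for u v
        using that by (intro equiv_class_eq[OF eqv]) (auto simp: R_def component_rel_def)
      moreover have "F (R `` {v}) \<in> D" if "v \<in> V" for v
        using F that by (auto intro: quotientI)
      ultimately show "(\<lambda>v\<in>V. F (R `` {v})) \<in> locally_constant V A D"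
        by (auto simp: locally_constant_def)
    qed
    have some: "(SOME v. v \<in> X) \<in> X" if "X \<in> V // R" for X
      using in_quotient_imp_non_empty[OF eqv that] by (simp add: some_in_eq)
    have some_V: "(SOME v. v \<in> X) \<in> V" if "X \<in> V // R" for X
      using some[OF that] in_quotient_imp_subset[OF eqv that] by auto
    show "(\<lambda>f. \<lambda>X\<in>V // R. f (SOME v. v \<in> X)) \<in> locally_constant V A D \<rightarrow> (V // R \<rightarrow>\<^sub>E D)"
    proof
      fix f assume "f \<in> locally_constant V A D"
      then have "f v \<in> D" if "v \<in> V" for v using that by (auto simp: locally_constant_def)
      then show "(\<lambda>X\<in>V // R. f (SOME v. v \<in> X)) \<in> V // R \<rightarrow>\<^sub>E D" using some_V by auto
    qed
    show "(\<lambda>X\<in>V // R. (\<lambda>v\<in>V. F (R `` {v})) (SOME v. v \<in> X)) = F" if F: "F \<in> V // R \<rightarrow>\<^sub>E D" for F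
    proof (rule extensionalityI[where A = "V // R"])
      show "F \<in> extensional (V // R)" using F by (auto simp: PiE_def)
      fix X assume X: "X \<in> V // R"
      have "R `` {SOME v. v \<in> X} = X"
      proof -
        obtain x where x: "X = R `` {x}" using X by (rule quotientE)
        then have "(x, SOME v. v \<in> X) \<in> R" using some[OF X] by simp
        then show ?thesis using equiv_class_eq[OF eqv] x by metis
      qed
      then show "(\<lambda>X\<in>V // R. (\<lambda>v\<in>V. F (R `` {v})) (SOME v. v \<in> X)) X = F X"
        using X some_V[OF X] by simp
    qed simp
    show "(\<lambda>v\<in>V. (\<lambda>X\<in>V // R. f (SOME v. v \<in> X)) (R `` {v})) = f" if f: "f \<in> locally_constant V A D" for f
    proof (rule extensionalityI[where A = V])
      show "f \<in> extensional V" using f by (auto simp: locally_constant_def PiE_def)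
      fix v assume v: "v \<in> V"
      then have X: "R `` {v} \<in> V // R" by (rule quotientI)
      have "(v, SOME w. w \<in> R `` {v}) \<in> R" using some[OF X] by simp
      then have "f v = f (SOME w. w \<in> R `` {v})"
        unfolding R_def by (rule locally_constant_component[OF A f])
      then show "(\<lambda>v\<in>V. (\<lambda>X\<in>V // R. f (SOME v. v \<in> X)) (R `` {v})) v = f v"
        using v X by simp
    qed simp
  qed
  then have "card (locally_constant V A D) = card (V // R \<rightarrow>\<^sub>E D)"
    by (simp add: bij_betw_same_card)
  also have "\<dots> = card D ^ card (V // R)"
    using finite_quotient[OF V, of R] eqv by (subst card_PiE) (auto simp: equiv_def)
  finally show ?thesis by (simp add: num_components_eq R_def)
qed

section \<open>Bounds on the number of components\<close>

lemma num_components_le: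
  assumes "finite V"
  shows "num_components V A \<le> card V"
proof -
  have "V // component_rel V A = (\<lambda>v. component_rel V A `` {v}) ` V"
    by (auto simp: quotient_def)
  then show ?thesis unfolding num_components_eq by (simp add: card_image_le[OF assms])
qed

lemma num_components_pos:
  assumes "finite V" "V \<noteq> {}"
  shows "num_components V A \<ge> 1"
proof -
  have eq: "V // component_rel V A = (\<lambda>v. component_rel V A `` {v}) ` V"
    by (auto simp: quotient_def)
  then have "card (V // component_rel V A) \<noteq> 0" using assms by simp
  then show ?thesis unfolding num_components_eq by simp
qed

text \<open>
  Two colours suffice to see this: among the functions constant along \<open>A\<close>, those that separate the
  ends of a new edge differ from a fixed such function by one that does not separate them.
\<close>

lemma card_verts_le_num_components_add:
  assumes V: "finite V" and A: "finite A" "\<And>e. e \<in> A \<Longrightarrow> \<exists>u\<in>V. \<exists>v\<in>V. e = {u, v}"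
  shows "card V \<le> num_components V A + card A"
proof -
  define L where "L = (\<lambda>A. locally_constant V A (UNIV :: bool set))"
  have finL: "finite (L A)" for A
    unfolding L_def locally_constant_def
    by (rule finite_subset[of _ "V \<rightarrow>\<^sub>E UNIV"]) (auto intro: finite_PiE V)
  have "2 ^ card V \<le> 2 ^ card A * card (L A)"
    using A
  proof (induction A rule: finite_induct)
    case empty
    then show ?case using V by (simp add: L_def locally_constant_def card_PiE)
  next
    case (insert e A)
    then obtain u v where e: "u \<in> V" "v \<in> V" "e = {u, v}" by blast
    define S where "S = {f \<in> L A. f u \<noteq> f v}"
    have insL: "L (insert e A) = {f \<in> L A. f u = f v}"
      using e by (auto simp: L_def locally_constant_def doubleton_eq_iff)
    have "card S \<le> card (L (insert e A))"
    proof (cases "S = {}")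
      case False
      then obtain h where h: "h \<in> S" by blast
      show ?thesis
      proof (rule card_inj_on_le[OF _ _ finL])
        show "inj_on (\<lambda>f. \<lambda>x\<in>V. f x \<noteq> h x) S"
        proof (rule inj_onI)
          fix f f' assume f: "f \<in> S" "f' \<in> S" "(\<lambda>x\<in>V. f x \<noteq> h x) = (\<lambda>x\<in>V. f' x \<noteq> h x)"
          show "f = f'"
          proof (rule extensionalityI[where A = V])
            fix x assume "x \<in> V"
            then show "f x = f' x" using fun_cong[OF f(3), of x] by auto
          qed (use f in \<open>auto simp: S_def L_def locally_constant_def PiE_def\<close>)
        qed
        show "(\<lambda>f. \<lambda>x\<in>V. f x \<noteq> h x) ` S \<subseteq> L (insert e A)"
          unfolding insL using h e by (auto simp: S_def L_def locally_constant_def)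
      qed
    qed simp
    moreover have "card (L A) = card (L (insert e A)) + card S"
    proof -
      have "L A = L (insert e A) \<union> S" by (auto simp: insL S_def)
      moreover have "L (insert e A) \<inter> S = {}" by (auto simp: insL S_def)
      moreover have "finite S" using finL[of A] by (simp add: S_def)
      ultimately show ?thesis using finL by (metis card_Un_disjoint)
    qed
    ultimately have "card (L A) \<le> 2 * card (L (insert e A))" by simp
    then have "2 ^ card A * card (L A) \<le> 2 ^ card A * (2 * card (L (insert e A)))" by (rule mult_left_mono) simp
    moreover have "2 ^ card V \<le> 2 ^ card A * card (L A)" using insert by simp
    ultimately have "2 ^ card V \<le> 2 ^ card A * (2 * card (L (insert e A)))" by (rule order.trans[rotated])
    then show ?case using insert.hyps by (simp add: mult_ac)
  qed
  moreover have "card (L A) = 2 ^ num_components V A"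
  proof -
    have "A \<subseteq> Pow V" using A(2) by blast
    from card_locally_constant[OF V this, of "UNIV :: bool set"] show ?thesis by (simp add: L_def)
  qed
  ultimately have "(2::nat) ^ card V \<le> 2 ^ (card A + num_components V A)" by (simp add: power_add)
  then show ?thesis by (simp add: power_le_imp_le_exp)
qed

text \<open>Inclusion-exclusion over the monochromatic edges: the indicator of a proper colouring is
  a product of factors \<open>1 - of_bool (m f e)\<close>, expanded over subsets \<open>A\<close>.
  The colourings constant along \<open>A\<close> number \<open>q ^ num_components V A\<close>, and
  agreement at all natural \<open>q\<close> carries over to \<open>x\<close>.\<close>

lemma poly_chromatic_poly_expansion:
  fixes G :: "'a graph"
  assumes fin: "finite (verts G)"
    and E: "\<And>e. e \<in> edges G \<Longrightarrow> \<exists>u\<in>verts G. \<exists>v\<in>verts G. e = {u, v}"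
  shows "poly (chromatic_poly G) x = (\<Sum>A\<in>Pow (edges G). (-1) ^ card A * x ^ num_components (verts G) A)"
proof -
  define V where "V = verts G"
  have EV: "edges G \<subseteq> Pow V" using E by (fastforce simp: V_def)
  have finE: "finite (edges G)" using EV fin by (metis V_def finite_Pow_iff finite_subset)
  define m where "m = (\<lambda>(f :: 'a \<Rightarrow> nat) e. \<forall>u\<in>V. \<forall>v\<in>V. e = {u, v} \<longrightarrow> f u = f v)"
  have count: "real (card (proper_colourings G q)) = (\<Sum>A\<in>Pow (edges G). (-1) ^ card A * real q ^ num_components V A)" for q
  proof -
    have finF: "finite (V \<rightarrow>\<^sub>E {..<q})" using fin by (auto simp: V_def intro: finite_PiE)
    have "proper_colourings G q = {f \<in> V \<rightarrow>\<^sub>E {..<q}. \<forall>e\<in>edges G. \<not> m f e}"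
    proof -
      have "(\<forall>u\<in>V. \<forall>v\<in>V. {u, v} \<in> edges G \<longrightarrow> f u \<noteq> f v) \<longleftrightarrow> (\<forall>e\<in>edges G. \<not> m f e)" for f
      proof
        assume *: "\<forall>u\<in>V. \<forall>v\<in>V. {u, v} \<in> edges G \<longrightarrow> f u \<noteq> f v"
        show "\<forall>e\<in>edges G. \<not> m f e"
        proof
          fix e assume e: "e \<in> edges G"
          then obtain u v where "u \<in> V" "v \<in> V" "e = {u, v}" using E[OF e] unfolding V_def by blast
          then show "\<not> m f e" using * e by (auto simp: m_def)
        qed
      next
        assume *: "\<forall>e\<in>edges G. \<not> m f e"
        show "\<forall>u\<in>V. \<forall>v\<in>V. {u, v} \<in> edges G \<longrightarrow> f u \<noteq> f v"
        proof (intro ballI impI notI)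
          fix u v assume "u \<in> V" "v \<in> V" "{u, v} \<in> edges G" "f u = f v"
          then have "m f {u, v}" by (auto simp: m_def doubleton_eq_iff)
          then show False using * \<open>{u, v} \<in> edges G\<close> by blast
        qed
      qed
      then show ?thesis by (simp add: proper_colourings_def V_def)
    qed
    then have "real (card (proper_colourings G q)) = (\<Sum>f\<in>V \<rightarrow>\<^sub>E {..<q}. of_bool (\<forall>e\<in>edges G. \<not> m f e))"
      using finF by (simp add: sum_of_bool_eq Collect_conj_eq Int_commute)
    also have "\<dots> = (\<Sum>f\<in>V \<rightarrow>\<^sub>E {..<q}. \<Sum>A\<in>Pow (edges G). (-1) ^ card A * of_bool (\<forall>e\<in>A. m f e))"
    proof (rule sum.cong[OF refl])
      fix f
      have *: "(\<Prod>e\<in>A. of_bool (P e)) = (of_bool (\<forall>e\<in>A. P e) :: real)" if "finite A" for P and A :: "'a set set"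
        using that by (induction A rule: finite_induct) auto
      have "of_bool (\<forall>e\<in>edges G. \<not> m f e) = (\<Prod>e\<in>edges G. of_bool (\<not> m f e) :: real)"
        using *[OF finE] by simp
      also have "\<dots> = (\<Prod>e\<in>edges G. - of_bool (m f e) + 1)"
        by (intro prod.cong refl) auto
      also have "\<dots> = (\<Sum>A\<in>Pow (edges G). (\<Prod>e\<in>A. - of_bool (m f e)) * (\<Prod>e\<in>edges G - A. 1))"
        by (rule prod_add[OF finE])
      also have "\<dots> = (\<Sum>A\<in>Pow (edges G). (-1) ^ card A * of_bool (\<forall>e\<in>A. m f e))"
        using finite_subset[OF _ finE] by (intro sum.cong refl) (simp add: prod_uminus *)
      finally show "of_bool (\<forall>e\<in>edges G. \<not> m f e) = (\<Sum>A\<in>Pow (edges G). (-1) ^ card A * of_bool (\<forall>e\<in>A. m f e) :: real)" .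
    qed
    also have "\<dots> = (\<Sum>A\<in>Pow (edges G). (-1) ^ card A * (\<Sum>f\<in>V \<rightarrow>\<^sub>E {..<q}. of_bool (\<forall>e\<in>A. m f e)))"
      by (subst sum.swap) (simp add: sum_distrib_left)
    also have "\<dots> = (\<Sum>A\<in>Pow (edges G). (-1) ^ card A * real q ^ num_components V A)"
    proof (intro sum.cong refl arg_cong2[where f = "(*)"])
      fix A assume A: "A \<in> Pow (edges G)"
      have "(\<forall>e\<in>A. m f e) \<longleftrightarrow> (\<forall>u\<in>V. \<forall>v\<in>V. {u, v} \<in> A \<longrightarrow> f u = f v)" for f
        by (auto simp: m_def)
      then have "{f \<in> V \<rightarrow>\<^sub>E {..<q}. \<forall>e\<in>A. m f e} = locally_constant V A {..<q}"
        by (simp add: locally_constant_def)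
      moreover have "card (locally_constant V A {..<q}) = q ^ num_components V A"
        using card_locally_constant[of V A "{..<q}"] A EV fin by (auto simp: V_def)
      ultimately show "(\<Sum>f\<in>V \<rightarrow>\<^sub>E {..<q}. of_bool (\<forall>e\<in>A. m f e)) = real q ^ num_components V A"
        using finF by (simp add: sum_of_bool_eq Collect_conj_eq Int_commute)
    qed
    finally show ?thesis .
  qed
  define Q where "Q = (\<Sum>A\<in>Pow (edges G). monom ((-1) ^ card A) (num_components V A) :: real poly)"
  have Q: "poly Q y = (\<Sum>A\<in>Pow (edges G). (-1) ^ card A * y ^ num_components V A)" for y
    by (simp add: Q_def poly_sum poly_monom)
  have "chromatic_poly G = Q"
    by (rule chromatic_poly_eqI[OF fin]) (simp add: Q count)
  then show ?thesis by (simp add: Q V_def)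
qed

text \<open>The subgraph expansions agree term by term. At \<open>y = 0\<close> the nullity
  contributes only a sign, and connectedness makes the exponent of \<open>s\<close> one less than
  the number of components of \<open>A\<close>, which leaves the factor \<open>s\<close>.\<close>

lemma chromatic_poly_eq_tutte_poly:
  fixes G :: "'a graph"
  assumes fin: "finite (verts G)" and ne: "verts G \<noteq> {}"
    and E: "\<And>e. e \<in> edges G \<Longrightarrow> \<exists>u\<in>verts G. \<exists>v\<in>verts G. e = {u, v}"
    and conn: "num_components (verts G) (edges G) = 1"
  shows "(-1) ^ card (verts G) * poly (chromatic_poly G) (- s) = s * tutte_poly G (1 + s) 0"
proof -
  define V where "V = verts G"
  define N where "N = card V"
  have finE: "finite (edges G)"
  proof (rule finite_subset)
    show "edges G \<subseteq> Pow (verts G)" using E by fastforce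
  qed (simp add: fin)
  have "(-1) ^ N * ((-1) ^ card A * (- s) ^ num_components V A) =
    s * ((1 + s - 1) ^ (graph_rank G (edges G) - graph_rank G A) * (0 - 1) ^ (card A - graph_rank G A))"
    if A: "A \<in> Pow (edges G)" for A
  proof -
    define k where "k = num_components V A"
    have k: "1 \<le> k" "k \<le> N" "N \<le> k + card A"
    proof -
      show "1 \<le> k" unfolding k_def V_def by (rule num_components_pos[OF fin ne])
      show "k \<le> N" unfolding k_def V_def N_def by (rule num_components_le[OF fin])
      show "N \<le> k + card A" unfolding k_def V_def N_def
        by (rule card_verts_le_num_components_add[OF fin])
           (use A finite_subset[OF _ finE] E in \<open>blast+\<close>)
    qed
    have r: "graph_rank G (edges G) - graph_rank G A = k - 1"
      using k conn by (simp add: graph_rank_def k_def N_def V_def)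
    define d where "d = card A - (N - k)"
    have d: "card A - graph_rank G A = d" by (simp add: graph_rank_def d_def k_def N_def V_def)
    \<comment> \<open>The bound \<open>N \<le> k + card A\<close> makes the natural subtraction in
      \<open>d\<close> exact; the parity of this identity settles all signs.\<close>
    have "card A + k = N + d" using k by (simp add: d_def)
    then have "(-1::real) ^ card A * (-1) ^ k = (-1) ^ N * (-1) ^ d"
      by (simp only: power_add[symmetric])
    then have "(-1::real) ^ N * ((-1) ^ card A * (-1) ^ k) = ((-1) ^ N * (-1) ^ N) * (-1) ^ d"
      by (simp only: mult.assoc)
    also have "(-1::real) ^ N * (-1) ^ N = 1" by (simp flip: power_mult_distrib)
    also have "1 * (-1::real) ^ d = (-1) ^ d" by simp
    finally have sgn: "(-1::real) ^ N * ((-1) ^ card A * (-1) ^ k) = (-1) ^ d" .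
    have "s ^ k = s * s ^ (k - 1)" using k by (simp flip: power_Suc)
    then show ?thesis
      unfolding r d k_def[symmetric] power_minus[of s] using sgn by (simp add: algebra_simps)
  qed
  moreover have "poly (chromatic_poly G) (- s) =
      (\<Sum>A\<in>Pow (edges G). (-1) ^ card A * (- s) ^ num_components (verts G) A)"
    by (rule poly_chromatic_poly_expansion[OF fin]) (fact E)
  ultimately show ?thesis
    unfolding tutte_poly_def
    by (simp only: sum_distrib_left V_def N_def cong: sum.cong)
qed

lemma turan_graph_num_components:
  assumes G: "is_turan_graph N p G" and "p \<ge> 2" "N \<ge> 1"
  shows "num_components (verts G) (edges G) = 1"
proof -
  obtain c where fin: "finite (verts G)" and N: "card (verts G) = N" and c: "c ` verts G \<subseteq> {..<p}"
    and E: "edges G = {{u, v} | u v. u \<in> verts G \<and> v \<in> verts G \<and> c u \<noteq> c v}"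
    and bal: "\<And>i j. i < p \<Longrightarrow> j < p \<Longrightarrow> card {v \<in> verts G. c v = i} \<le> card {v \<in> verts G. c v = j} + 1"
    using G unfolding is_turan_graph_def by auto
  define R where "R = {(a, b). {a, b} \<in> edges G}"
  have RI: "(u, v) \<in> R" if "u \<in> verts G" "v \<in> verts G" "c u \<noteq> c v" for u v
    using that by (auto simp: R_def E)
  have "(u, v) \<in> R\<^sup>*" if uv: "u \<in> verts G" "v \<in> verts G" for u v
  proof (cases "u = v \<or> c u \<noteq> c v")
    case True
    then show ?thesis using RI uv by auto
  next
    case False
    have cu: "c u < p" using c uv by auto
    define j where "j = (if c u = 0 then 1 else (0::nat))"
    have j: "j < p" "j \<noteq> c u" using \<open>p \<ge> 2\<close> by (auto simp: j_def)
    \<comment> \<open>Two vertices in one part force, by balance, every other part to be non-empty;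
      a vertex of part \<open>j\<close> then joins \<open>u\<close> to \<open>v\<close>.\<close>
    have "card {u, v} \<le> card {w \<in> verts G. c w = c u}"
      using uv False fin by (intro card_mono) auto
    also have "\<dots> \<le> card {w \<in> verts G. c w = j} + 1" using bal cu j by simp
    finally have "card {w \<in> verts G. c w = j} \<noteq> 0" using False by simp
    then have "{w \<in> verts G. c w = j} \<noteq> {}" by (metis card.empty)
    then obtain w where w: "w \<in> verts G" "c w = j" by blast
    have "(u, w) \<in> R" "(w, v) \<in> R" using RI w uv j False by auto
    then show ?thesis by (meson converse_rtrancl_into_rtrancl rtrancl.rtrancl_refl)
  qed
  then have "component_rel (verts G) (edges G) = verts G \<times> verts G"
    by (auto simp: component_rel_def R_def)
  moreover have "verts G \<noteq> {}" using N \<open>N \<ge> 1\<close> by auto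
  then have "verts G // (verts G \<times> verts G) = {verts G}" by (auto simp: quotient_def)
  ultimately show ?thesis by (simp add: num_components_eq)
qed

section \<open>Local limit theorem and Laplace asymptotics\<close>

lemma gaussian_eq_normal_density:
  fixes a x :: real
  assumes "a > 0"
  shows "exp (- a * x^2) = sqrt (pi / a) * normal_density 0 (1 / sqrt (2 * a)) x"
proof -
  have "sqrt (pi / a) \<noteq> 0" using assms by simp
  moreover have "2 * pi * (1 / sqrt (2 * a))^2 = pi / a"
    using assms by (simp add: power_divide)
  moreover have "- ((x - 0)\<^sup>2) / (2 * (1 / sqrt (2 * a))^2) = - a * x^2"
    using assms by (simp add: power_divide)
  ultimately show ?thesis unfolding normal_density_def by (simp only:) simp
qed

lemma integrable_gaussian:
  fixes a :: real
  assumes "a > 0"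
  shows "integrable lborel (\<lambda>x. exp (- a * x^2))"
  unfolding gaussian_eq_normal_density[OF assms] using assms by simp

lemma integral_gaussian:
  fixes a :: real
  assumes "a > 0"
  shows "(\<integral>x. exp (- a * x^2) \<partial>lborel) = sqrt (pi / a)"
  unfolding gaussian_eq_normal_density[OF assms] using assms by simp

lemma exp_ii_minus_of_real:
  "exp (\<i> * of_real (u * z / w) - of_real (u\<^sup>2 / 2)) = iexp (z / w * u) * complex_of_real (exp (- u\<^sup>2 / 2))"
proof -
  have "\<i> * of_real (u * z / w) - of_real (u\<^sup>2 / 2) = \<i> * of_real (z / w * u) + complex_of_real (- u\<^sup>2 / 2)"
    by (simp add: mult_ac)
  then show ?thesis by (simp only: exp_add exp_of_real)
qed

text \<open>After scaling by \<open>sqrt v\<close> this is the characteristic function of the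
  standard normal law.\<close>

lemma fourier_gaussian:
  fixes v z :: real
  assumes "v > 0"
  shows "(CLBINT u. exp (\<i> * of_real (u * z) - of_real (v * u^2 / 2))) =
           of_real (sqrt (2 * pi / v) * exp (- (z^2 / (2 * v))))"
proof -
  have "(CLBINT u. exp (\<i> * of_real (u * z) - of_real (v * u^2 / 2))) =
        (1 / sqrt v) *\<^sub>R (CLBINT u. exp (\<i> * of_real (u * z / sqrt v) - of_real (u^2 / 2)))"
    using assms
    by (subst lborel_integral_real_affine[where c = "1 / sqrt v" and t = 0])
       (auto simp: power_divide intro!: Bochner_Integration.integral_cong)
  also have "(CLBINT u. exp (\<i> * of_real (u * z / sqrt v) - of_real (u^2 / 2))) =
     (CLBINT u. of_real (sqrt (2 * pi)) * (std_normal_density u *\<^sub>R iexp (z / sqrt v * u)))"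
  proof (rule Bochner_Integration.integral_cong[OF refl])
    fix u :: real
    have "exp (\<i> * of_real (u * z / sqrt v) - of_real (u^2 / 2)) =
          iexp (z / sqrt v * u) * complex_of_real (exp (- u\<^sup>2 / 2))"
      by (simp only: exp_ii_minus_of_real of_real_mult)
    also have "exp (- u\<^sup>2 / 2) = sqrt (2 * pi) * std_normal_density u"
      by (simp add: normal_density_def)
    finally show "exp (\<i> * of_real (u * z / sqrt v) - of_real (u^2 / 2)) =
          of_real (sqrt (2 * pi)) * (std_normal_density u *\<^sub>R iexp (z / sqrt v * u))"
      by (simp add: scaleR_conv_of_real)
  qed
  also have "\<dots> = of_real (sqrt (2 * pi)) * char std_normal_distribution (z / sqrt v)"
    unfolding char_def by (subst integral_mult_right_zero, subst integral_density) auto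
  also have "\<dots> = of_real (sqrt (2 * pi) * exp (- ((z / sqrt v)\<^sup>2) / 2))"
    by (simp add: char_std_normal_distribution)
  finally show ?thesis using assms
    by (simp add: power_divide real_sqrt_divide scaleR_conv_of_real)
qed

text \<open>Non-negativity turns the gauge integral, in which the values of powers and of Gamma are
  known, into an absolutely convergent Lebesgue integral.\<close>

lemma set_integral_lborel_of_has_integral:
  fixes f :: "real \<Rightarrow> real"
  assumes "\<And>x. x \<in> S \<Longrightarrow> 0 \<le> f x" "(f has_integral I) S"
    and [measurable]: "S \<in> sets borel" "f \<in> borel_measurable borel"
  shows "set_integrable lborel S f" and "(LBINT x:S. f x) = I"
proof -
  have "has_bochner_integral lborel (\<lambda>x. indicat_real S x * f x) I"
  proof (rule has_bochner_integral_nn_integral)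
    show "I \<ge> 0" using assms(1,2) by (rule has_integral_nonneg[rotated])
    show "\<integral>\<^sup>+ x. ennreal (indicat_real S x * f x) \<partial>lborel = ennreal I"
      using assms(1,2) by (rule nn_integral_has_integral_lebesgue)
  qed (use assms(1) in \<open>auto simp: indicator_def\<close>)
  then show "set_integrable lborel S f" "(LBINT x:S. f x) = I"
    unfolding set_integrable_def set_lebesgue_integral_def
    by (auto simp: has_bochner_integral_iff)
qed

text \<open>Gives the integrable majorant for the rescaled integrand, whose power factor grows
  polynomially when \<open>s\<close> is large.\<close>

lemma powr_mult_exp_le_inverse_square:
  fixes a :: real
  assumes "a \<ge> 0"
  shows "\<exists>K. \<forall>y. (2 * (1 + \<bar>y\<bar>)) powr a * exp (- \<bar>y\<bar> / 2) \<le> K * inverse (1 + y^2)"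
proof -
  \<comment> \<open>The two additional powers pay for the factor \<open>1 + y^2\<close>, which is at
    most \<open>u^2\<close>.\<close>
  define b where "b = a + 2"
  have b: "b > 0" using assms by (simp add: b_def)
  have "(2 * (1 + \<bar>y\<bar>)) powr a * exp (- \<bar>y\<bar> / 2) \<le> exp (1 / 2 - b + b * ln (4 * b)) * inverse (1 + y^2)" for y
  proof -
    define u where "u = 2 * (1 + \<bar>y\<bar>)"
    have u: "u \<ge> 2" by (simp add: u_def)
    \<comment> \<open>The tangent to the logarithm at \<open>4 * b\<close> gives
      \<open>b * ln u\<close> slope \<open>1 / 4\<close> in \<open>u\<close>, that is
      \<open>1 / 2\<close> in \<bar>y\<bar>, exactly what \<open>exp (- \<bar>y\<bar> / 2)\<close>
      absorbs.\<close>
    have "ln (u / (4 * b)) \<le> u / (4 * b) - 1"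
      using u b by (intro ln_le_minus_one) auto
    then have "b * (ln u - ln (4 * b)) \<le> b * (u / (4 * b) - 1)"
      using u b by (intro mult_left_mono) (auto simp: ln_div)
    also have "\<dots> = u / 4 - b" using b by (simp add: field_simps)
    finally have "b * ln u \<le> u / 4 - b + b * ln (4 * b)" by (simp add: algebra_simps)
    then have "u powr b \<le> exp (u / 4 - b + b * ln (4 * b))"
      using u by (simp add: powr_def)
    then have "u powr b * exp (- \<bar>y\<bar> / 2) \<le> exp (u / 4 - b + b * ln (4 * b)) * exp (- \<bar>y\<bar> / 2)"
      by (rule mult_right_mono) simp
    also have "\<dots> = exp (1 / 2 - b + b * ln (4 * b))"
      by (simp add: u_def field_simps flip: exp_add)
    finally have 1: "u powr b * exp (- \<bar>y\<bar> / 2) \<le> exp (1 / 2 - b + b * ln (4 * b))" .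
    have "u^2 = 4 + 8 * \<bar>y\<bar> + 4 * y^2"
      by (simp add: u_def power_mult_distrib power2_sum)
    then have "1 + y^2 \<le> u^2" by simp
    then have "u powr a * exp (- \<bar>y\<bar> / 2) * (1 + y^2) \<le> u powr a * exp (- \<bar>y\<bar> / 2) * u^2"
      by (intro mult_left_mono) auto
    also have "\<dots> = u powr b * exp (- \<bar>y\<bar> / 2)"
      using u by (simp add: b_def powr_add mult_ac)
    also note 1
    finally have "u powr a * exp (- \<bar>y\<bar> / 2) * (1 + y^2) \<le> exp (1 / 2 - b + b * ln (4 * b))" .
    then show ?thesis
      by (simp add: u_def divide_inverse[symmetric] pos_le_divide_eq add_pos_nonneg)
  qed
  then show ?thesis by blast
qed

lemma integrable_inverse_1_plus_square_lborel: "integrable lborel (\<lambda>x::real. inverse (1 + x^2))"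
  using integrable_inverse_1_plus_square by (simp add: set_integrable_def)

text \<open>One bound for both signs of the exponent: \<open>s - 1\<close> may be negative, and then
  the lower bound \<open>1 / 2\<close> takes over.\<close>

lemma abs_powr_le:
  fixes x b q :: real
  assumes "1 / 2 \<le> x" "x \<le> b" "b \<ge> 1"
  shows "x powr q \<le> (2 * b) powr \<bar>q\<bar>"
proof (cases "q \<ge> 0")
  case True
  then show ?thesis using assms by (auto intro!: powr_mono2)
next
  case False
  then have "x powr q \<le> (1 / 2) powr q" using assms by (intro powr_mono2') auto
  also have "\<dots> = 2 powr \<bar>q\<bar>" using False by (simp add: powr_divide powr_minus_divide[symmetric])
  also have "\<dots> \<le> (2 * b) powr \<bar>q\<bar>" using assms by (intro powr_mono2) auto
  finally show ?thesis .
qed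

lemma tendsto_power_mult_exp_neg_sqrt:
  fixes M :: "nat \<Rightarrow> real"
  assumes M: "filterlim M at_top sequentially" and b: "b > 0"
  shows "(\<lambda>k. M k powr a * exp (- b * sqrt (M k))) \<longlonglongrightarrow> 0"
proof -
  have "((\<lambda>x::real. x powr a * exp (- b * sqrt x)) \<longlongrightarrow> 0) at_top"
    using b by real_asymp
  then show ?thesis by (rule filterlim_compose[OF _ M])
qed

text \<open>
  \<open>g n x\<close> plays the role of the point mass at \<open>n\<close> of an additive family with cumulant generating
  function \<open>x * \<kappa>\<close>, but it may be negative.
\<close>

locale cumulant_family =
  fixes g :: "nat \<Rightarrow> real \<Rightarrow> real" and \<kappa> :: "complex \<Rightarrow> complex" and \<mu> v c C \<delta> :: real
  assumes pos: "\<mu> > 0" "v > 0" "c > 0" "C \<ge> 0" "\<delta> > 0"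
    and cont: "continuous_on UNIV \<kappa>"
    and meas [measurable]: "\<And>n. g n \<in> borel_measurable borel"
    and inversion: "\<And>n x h. x > 0 \<Longrightarrow> \<bar>h\<bar> \<le> \<delta> \<Longrightarrow> complex_of_real (g n x) =
       (1 / (2 * pi)) *\<^sub>R (CLBINT \<theta>:{-pi..pi}.
          exp (of_real x * \<kappa> (of_real h + \<i> * of_real \<theta>) - of_nat n * (of_real h + \<i> * of_real \<theta>)))"
    and taylor: "\<And>z. norm z \<le> \<delta> \<Longrightarrow>
       norm (\<kappa> z - of_real \<mu> * z - of_real v * z^2 / 2) \<le> C * norm z ^ 3"
    and decay: "\<And>h \<theta>. \<bar>h\<bar> \<le> \<delta> \<Longrightarrow> \<bar>\<theta>\<bar> \<le> pi \<Longrightarrow>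
       Re (\<kappa> (of_real h + \<i> * of_real \<theta>)) \<le> Re (\<kappa> (of_real h)) - c * \<theta>^2"
begin

section \<open>Tilted bounds and the local limit theorem\<close>

lemma kappa_0: "\<kappa> 0 = 0"
  using taylor[of 0] pos by simp

lemma Re_kappa_real_le:
  assumes "\<bar>h\<bar> \<le> \<delta>"
  shows "Re (\<kappa> (of_real h)) \<le> \<mu> * h + (v / 2 + C * \<delta>) * h^2"
proof -
  have "Re (\<kappa> (of_real h) - of_real \<mu> * of_real h - of_real v * of_real h^2 / 2) \<le> C * \<bar>h\<bar> ^ 3"
    using taylor[of "of_real h"] assms
    by (intro order.trans[OF complex_Re_le_cmod]) simp
  moreover have "Re (\<kappa> (of_real h) - of_real \<mu> * of_real h - of_real v * of_real h^2 / 2) =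
      Re (\<kappa> (of_real h)) - \<mu> * h - v * h^2 / 2"
    by (simp flip: of_real_power of_real_mult)
  moreover have "C * \<bar>h\<bar> ^ 3 \<le> C * \<delta> * h^2"
  proof -
    have "\<bar>h\<bar> ^ 3 = \<bar>h\<bar> * h^2" by (simp add: power3_eq_cube power2_eq_square)
    also have "\<dots> \<le> \<delta> * h^2" using assms by (intro mult_right_mono) auto
    finally show ?thesis using pos by (simp add: mult_left_mono mult.assoc)
  qed
  ultimately show ?thesis by (simp add: algebra_simps)
qed

text \<open>Half the variance, with room for the cubic error, which on \<bar>h\<bar> \<le> \<delta>
  costs at most \<open>C * \<delta> * h^2\<close>.\<close>

definition quad_coeff where "quad_coeff = v / 2 + C * \<delta>"

lemma quad_coeff_nonneg: "quad_coeff \<ge> 0" unfolding quad_coeff_def using pos by auto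

text \<open>A Chernoff bound without positivity: \<open>inversion\<close> holds for every admissible
  shift \<open>h\<close>. Estimating the integrand by its maximum gives the first bound, which stays
  finite as \<open>x\<close> tends to 0; integrating the Gaussian factor supplied by
  \<open>decay\<close> gives the second, with the local scale \<open>1 / sqrt x\<close>.\<close>

lemma g_bound:
  assumes x: "x > 0" and h: "\<bar>h\<bar> \<le> \<delta>"
  shows "\<bar>g n x\<bar> \<le> exp (x * (\<mu> * h + quad_coeff * h^2) - n * h)"
    and "\<bar>g n x\<bar> \<le> exp (x * (\<mu> * h + quad_coeff * h^2) - n * h) / (sqrt (c * x))"
proof -
  define F where "F = (\<lambda>\<theta>. exp (of_real x * \<kappa> (of_real h + \<i> * of_real \<theta>) - of_nat n * (of_real h + \<i> * of_real \<theta>)))"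
  define A where "A = exp (x * (\<mu> * h + quad_coeff * h^2) - n * h)"
  have F_bd: "norm (F \<theta>) \<le> A * exp (- (c * x) * \<theta>^2)" if "\<theta> \<in> {-pi..pi}" for \<theta>
  proof -
    have "norm (F \<theta>) = exp (x * Re (\<kappa> (of_real h + \<i> * of_real \<theta>)) - n * h)"
      unfolding F_def by simp
    also have "\<dots> \<le> exp (x * (\<mu> * h + quad_coeff * h^2 - c * \<theta>^2) - n * h)"
    proof -
      have "\<bar>\<theta>\<bar> \<le> pi" using that by auto
      from decay[OF h this] Re_kappa_real_le[OF h] x show ?thesis
        by (auto simp: quad_coeff_def intro!: mult_left_mono)
    qed
    also have "\<dots> = A * exp (- (c * x) * \<theta>^2)"
      unfolding A_def by (simp add: algebra_simps flip: exp_add)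
    finally show ?thesis .
  qed
  have contF: "continuous_on UNIV F"
    unfolding F_def by (intro continuous_intros continuous_on_compose2[OF cont]) auto
  have intF: "set_integrable lborel {-pi..pi} F"
    by (rule borel_integrable_atLeastAtMost') (rule continuous_on_subset[OF contF], simp)
  have gF: "\<bar>g n x\<bar> \<le> 1 / (2 * pi) * (LBINT \<theta>:{-pi..pi}. norm (F \<theta>))"
  proof -
    have "\<bar>g n x\<bar> = norm (complex_of_real (g n x))" by simp
    also have "\<dots> = 1 / (2 * pi) * norm (CLBINT \<theta>:{-pi..pi}. F \<theta>)"
      unfolding inversion[OF x h] F_def by simp
    also have "\<dots> \<le> 1 / (2 * pi) * (LBINT \<theta>:{-pi..pi}. norm (F \<theta>))"
      using set_integral_norm_bound[OF intF] by (intro mult_left_mono) auto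
    finally show ?thesis .
  qed
  have nF: "set_integrable lborel {-pi..pi} (\<lambda>\<theta>. norm (F \<theta>))"
    using intF by (rule set_integrable_norm)
  have cx: "c * x > 0" using pos x by simp
  have iG: "integrable lborel (\<lambda>\<theta>. A * exp (- (c * x) * \<theta>^2))"
    using integrable_gaussian[OF cx] by simp
  have "(LBINT \<theta>:{-pi..pi}. norm (F \<theta>)) \<le> (LBINT \<theta>:{-pi..pi}. A)"
  proof (rule set_integral_mono[OF nF])
    show "set_integrable lborel {-pi..pi} (\<lambda>x. A)"
      by (intro borel_integrable_atLeastAtMost') auto
    show "norm (F \<theta>) \<le> A" if "\<theta> \<in> {-pi..pi}" for \<theta>
    proof -
      have "A * exp (- (c * x) * \<theta>^2) \<le> A * 1"
        using cx by (intro mult_left_mono) (auto simp: A_def mult_nonneg_nonneg)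
      then show ?thesis using F_bd[OF that] by linarith
    qed
  qed
  also have "\<dots> = 2 * pi * A" by (simp add: set_lebesgue_integral_def)
  finally show "\<bar>g n x\<bar> \<le> exp (x * (\<mu> * h + quad_coeff * h^2) - n * h)"
  proof -
    assume "(LBINT \<theta>:{-pi..pi}. norm (F \<theta>)) \<le> 2 * pi * A"
    then have "1 / (2 * pi) * (LBINT \<theta>:{-pi..pi}. norm (F \<theta>)) \<le> 1 / (2 * pi) * (2 * pi * A)"
      by (intro mult_left_mono) auto
    with gF show ?thesis unfolding A_def by simp
  qed
  have "(LBINT \<theta>:{-pi..pi}. norm (F \<theta>)) \<le> (LBINT \<theta>:UNIV. A * exp (- (c * x) * \<theta>^2))"
    unfolding set_lebesgue_integral_def
  proof (rule integral_mono)
    show "integrable lborel (\<lambda>\<theta>. indicat_real {- pi..pi} \<theta> *\<^sub>R cmod (F \<theta>))"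
      using nF by (simp add: set_integrable_def)
    show "integrable lborel (\<lambda>\<theta>. indicat_real UNIV \<theta> *\<^sub>R (A * exp (- (c * x) * \<theta>^2)))"
      using iG by simp
    fix \<theta> :: real
    show "indicat_real {- pi..pi} \<theta> *\<^sub>R cmod (F \<theta>) \<le> indicat_real UNIV \<theta> *\<^sub>R (A * exp (- (c * x) * \<theta>^2))"
      using F_bd[of \<theta>] by (auto simp: indicator_def A_def)
  qed
  also have "\<dots> = A * sqrt (pi / (c * x))"
    using integral_gaussian[OF cx] by (simp add: set_lebesgue_integral_def)
  finally have "1 / (2 * pi) * (LBINT \<theta>:{-pi..pi}. norm (F \<theta>)) \<le> 1 / (2 * pi) * (A * sqrt (pi / (c * x)))"
    by (intro mult_left_mono) auto
  with gF have "\<bar>g n x\<bar> \<le> 1 / (2 * pi) * (A * sqrt (pi / (c * x)))"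
    by linarith
  also have "\<dots> = A / sqrt (c * x) * (sqrt pi / (2 * pi))"
    by (simp add: real_sqrt_divide)
  also have "\<dots> \<le> A / sqrt (c * x) * 1"
  proof (rule mult_left_mono)
    have "sqrt pi \<le> 2 * pi" using pi_gt3 by (intro real_le_lsqrt) (auto simp: power2_eq_square)
    then show "sqrt pi / (2 * pi) \<le> 1" using pi_gt_zero by simp
  qed (use cx in \<open>auto simp: A_def\<close>)
  finally show "\<bar>g n x\<bar> \<le> exp (x * (\<mu> * h + quad_coeff * h^2) - n * h) / (sqrt (c * x))"
    unfolding A_def by simp
qed


text \<open>On the unshifted contour put \<theta> = u / sqrt x. Then \<open>decay\<close> provides
  the majorant \<open>exp (- c * u^2)\<close>, \<open>taylor\<close> the pointwise limit, and
  \<open>fourier_gaussian\<close> the value of the limit integral.\<close>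

lemma local_limit_pos:
  assumes x: "filterlim x at_top sequentially" "\<And>k. x k > 0"
    and z: "(\<lambda>k. (\<mu> * x k - real (n k)) / sqrt (x k)) \<longlonglongrightarrow> z"
  shows "(\<lambda>k. sqrt (x k) * g (n k) (x k)) \<longlonglongrightarrow> exp (- (z^2 / (2 * v))) / sqrt (2 * pi * v)"
proof -
  define F where "F = (\<lambda>k u. indicat_real {-pi..pi} (u / sqrt (x k)) *\<^sub>R
     exp (of_real (x k) * \<kappa> (\<i> * of_real (u / sqrt (x k))) - of_nat (n k) * (\<i> * of_real (u / sqrt (x k)))))"
  have sq: "sqrt (x k) > 0" for k using x(2) by simp
  have F: "complex_of_real (sqrt (x k) * g (n k) (x k)) = (1 / (2 * pi)) *\<^sub>R (CLBINT u. F k u)" for k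
  proof -
    have "complex_of_real (g (n k) (x k)) = (1 / (2 * pi)) *\<^sub>R (CLBINT \<theta>:{-pi..pi}.
          exp (of_real (x k) * \<kappa> (\<i> * of_real \<theta>) - of_nat (n k) * (\<i> * of_real \<theta>)))"
      using inversion[OF x(2), of 0 "n k" k] pos by simp
    also have "(CLBINT \<theta>:{-pi..pi}.
          exp (of_real (x k) * \<kappa> (\<i> * of_real \<theta>) - of_nat (n k) * (\<i> * of_real \<theta>))) =
          (1 / sqrt (x k)) *\<^sub>R (CLBINT u. F k u)"
      unfolding set_lebesgue_integral_def F_def
      by (subst lborel_integral_real_affine[where c = "1 / sqrt (x k)" and t = 0])
         (use x(2)[of k] in \<open>auto simp: less_imp_le\<close>)
    finally show ?thesis using sq[of k] by (simp add: scaleR_conv_of_real)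
  qed
  have lim: "(\<lambda>k. CLBINT u. F k u) \<longlonglongrightarrow> (CLBINT u. exp (\<i> * of_real (u * z) - of_real (v * u^2 / 2)))"
  proof (rule integral_dominated_convergence[where w = "\<lambda>u. exp (- c * u^2)"])
    show "integrable lborel (\<lambda>u. exp (- c * u^2))" using integrable_gaussian pos by blast
    show "F k \<in> borel_measurable lborel" for k
    proof -
      have "continuous_on UNIV (\<lambda>u. exp (of_real (x k) * \<kappa> (\<i> * of_real (u / sqrt (x k)))
              - of_nat (n k) * (\<i> * complex_of_real (u / sqrt (x k)))))"
        using sq[of k] by (intro continuous_intros continuous_on_compose2[OF cont]) auto
      note borel_measurable_continuous_onI[OF this, measurable]
      show ?thesis unfolding F_def by measurable
    qed
    show "AE u in lborel. norm (F k u) \<le> exp (- c * u^2)" for k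
    proof (rule AE_I2)
      fix u :: real
      show "norm (F k u) \<le> exp (- c * u^2)"
      proof (cases "\<bar>u / sqrt (x k)\<bar> \<le> pi")
        case True
        have "norm (F k u) \<le> exp (x k * Re (\<kappa> (\<i> * of_real (u / sqrt (x k)))))"
          by (auto simp: F_def indicator_def)
        also have "\<dots> \<le> exp (x k * (- c * (u / sqrt (x k))^2))"
        proof -
          have "Re (\<kappa> (\<i> * of_real (u / sqrt (x k)))) \<le> - c * (u / sqrt (x k))^2"
            using decay[of 0, OF _ True] pos by (simp add: kappa_0)
          then show ?thesis using x(2)[of k] by (subst exp_le_cancel_iff) (intro mult_left_mono, auto)
        qed
        also have "x k * (- c * (u / sqrt (x k))^2) = - c * u^2"
          using x(2)[of k] by (simp add: power_divide)
        finally show ?thesis .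
      next
        case False
        then have "u / sqrt (x k) \<notin> {-pi..pi}" by auto
        then have "F k u = 0" by (simp add: F_def indicator_def)
        then show ?thesis by simp
      qed
    qed
    show "AE u in lborel. (\<lambda>k. F k u) \<longlonglongrightarrow> exp (\<i> * of_real (u * z) - of_real (v * u^2 / 2))"
    proof (rule AE_I2)
      fix u :: real
      define w where "w = (\<lambda>k. u / sqrt (x k))"
      have sqrt_top: "filterlim (\<lambda>k. sqrt (x k)) at_top sequentially"
        by (rule filterlim_compose[OF sqrt_at_top x(1)])
      have w0: "w \<longlonglongrightarrow> 0"
        unfolding w_def by (rule real_tendsto_divide_at_top[OF tendsto_const sqrt_top])
      have xw: "x k * w k ^ 2 = u^2" for k
        using x(2)[of k] by (simp add: w_def power_divide)
      \<comment> \<open>The remainder is of third order in \<open>w\<close>; since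
        \<open>x * w^2 = u^2\<close>, multiplying it by \<open>x\<close> still leaves a factor
        \<bar>w\<bar> that tends to 0.\<close>
      define R where "R = (\<lambda>k. \<kappa> (\<i> * of_real (w k)) - of_real \<mu> * (\<i> * of_real (w k)) - of_real v * (\<i> * of_real (w k))^2 / 2)"
      have R: "(\<lambda>k. of_real (x k) * R k) \<longlonglongrightarrow> 0"
      proof (rule Lim_null_comparison)
        have "eventually (\<lambda>k. \<bar>w k\<bar> < \<delta>) sequentially"
          using order_tendstoD(2)[OF tendsto_rabs[OF w0], of \<delta>] pos by simp
        then show "eventually (\<lambda>k. norm (of_real (x k) * R k) \<le> C * u^2 * \<bar>w k\<bar>) sequentially"
        proof eventually_elim
          case (elim k)
          have "norm (R k) \<le> C * \<bar>w k\<bar> ^ 3"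
            using taylor[of "\<i> * of_real (w k)"] elim by (simp add: R_def norm_mult)
          then have "norm (of_real (x k) * R k) \<le> x k * (C * \<bar>w k\<bar> ^ 3)"
            using x(2)[of k] by (simp add: norm_mult)
          also have "\<dots> = C * (x k * \<bar>w k\<bar>^2) * \<bar>w k\<bar>" by (simp add: power2_eq_square power3_eq_cube)
          also have "\<dots> = C * u^2 * \<bar>w k\<bar>" using xw by simp
          finally show ?case .
        qed
        show "(\<lambda>k. C * u^2 * \<bar>w k\<bar>) \<longlonglongrightarrow> 0"
          using tendsto_mult_left[OF tendsto_rabs[OF w0], of "C * u^2"] by simp
      qed
      \<comment> \<open>The linear term of \<kappa> joins \<open>n\<close> to form the standardised
        deviation, whose limit is \<open>z\<close>; the quadratic term is the Gaussian
        exponent.\<close>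
      have ex: "of_real (x k) * \<kappa> (\<i> * of_real (w k)) - of_nat (n k) * (\<i> * of_real (w k)) =
         \<i> * of_real (u * ((\<mu> * x k - real (n k)) / sqrt (x k))) - of_real (v * u^2 / 2) + of_real (x k) * R k" for k
      proof -
        have 1: "of_real (x k) * (of_real v * (\<i> * of_real (w k))^2 / 2) = - complex_of_real (v * (x k * w k ^ 2) / 2)"
          by (simp add: power_mult_distrib)
        have 2: "\<kappa> (\<i> * of_real (w k)) = R k + of_real \<mu> * (\<i> * of_real (w k)) + of_real v * (\<i> * of_real (w k))^2 / 2"
          by (simp add: R_def)
        have 3: "\<i> * of_real (u * ((\<mu> * x k - real (n k)) / sqrt (x k))) =
            of_real (x k) * (of_real \<mu> * (\<i> * of_real (w k))) - of_nat (n k) * (\<i> * complex_of_real (w k))"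
          by (simp add: w_def algebra_simps diff_divide_distrib)
        show ?thesis unfolding 2 3 distrib_left 1 xw by simp
      qed
      have "(\<lambda>k. exp (of_real (x k) * \<kappa> (\<i> * of_real (w k)) - of_nat (n k) * (\<i> * of_real (w k))))
         \<longlonglongrightarrow> exp (\<i> * of_real (u * z) - of_real (v * u^2 / 2) + 0)"
        unfolding ex by (intro tendsto_intros z R)
      then have lim1: "(\<lambda>k. exp (of_real (x k) * \<kappa> (\<i> * of_real (w k)) - of_nat (n k) * (\<i> * of_real (w k))))
         \<longlonglongrightarrow> exp (\<i> * of_real (u * z) - of_real (v * u^2 / 2))" by simp
      have "eventually (\<lambda>k. \<bar>w k\<bar> < pi) sequentially"
        using order_tendstoD(2)[OF tendsto_rabs[OF w0], of pi] by simp
      then have "eventually (\<lambda>k. exp (of_real (x k) * \<kappa> (\<i> * of_real (w k)) - of_nat (n k) * (\<i> * of_real (w k))) = F k u) sequentially"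
      proof eventually_elim
        case (elim k)
        then have "\<bar>u / sqrt (x k)\<bar> < pi" by (simp only: w_def)
        then have "u / sqrt (x k) \<in> {-pi..pi}" unfolding abs_less_iff by auto
        then show ?case by (simp add: F_def w_def indicator_def)
      qed
      from Lim_transform_eventually[OF lim1 this]
      show "(\<lambda>k. F k u) \<longlonglongrightarrow> exp (\<i> * of_real (u * z) - of_real (v * u^2 / 2))" .
    qed
  qed (measurable)
  have "(\<lambda>k. complex_of_real (sqrt (x k) * g (n k) (x k))) \<longlonglongrightarrow>
     (1 / (2 * pi)) *\<^sub>R complex_of_real (sqrt (2 * pi / v) * exp (- (z^2 / (2 * v))))"
    unfolding F fourier_gaussian[OF pos(2), symmetric] by (intro tendsto_intros lim)
  also have "(1 / (2 * pi)) *\<^sub>R complex_of_real (sqrt (2 * pi / v) * exp (- (z^2 / (2 * v)))) =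
     complex_of_real (exp (- (z^2 / (2 * v))) / sqrt (2 * pi * v))"
  proof -
    have "sqrt (2 * pi / v) / (2 * pi) = 1 / sqrt (2 * pi * v)"
      using pos by (simp add: real_sqrt_divide real_sqrt_mult field_simps)
    then show ?thesis by (simp add: scaleR_conv_of_real field_simps flip: of_real_mult of_real_divide)
  qed
  finally show ?thesis by (simp only: tendsto_of_real_iff)
qed

text \<open>Only the tail matters, so replacing \<open>x\<close> by its maximum with 1 removes the
  demand for positivity at every index.\<close>

lemma local_limit:
  assumes x: "filterlim x at_top sequentially"
    and z: "(\<lambda>k. (\<mu> * x k - real (n k)) / sqrt (x k)) \<longlonglongrightarrow> z"
  shows "(\<lambda>k. sqrt (x k) * g (n k) (x k)) \<longlonglongrightarrow> exp (- (z^2 / (2 * v))) / sqrt (2 * pi * v)"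
proof -
  define x' where "x' = (\<lambda>k. max 1 (x k))"
  have ev: "eventually (\<lambda>k. x' k = x k) sequentially"
    using filterlim_at_top_dense[THEN iffD1, OF x, rule_format, of 1]
    by eventually_elim (simp add: x'_def)
  have "(\<lambda>k. sqrt (x' k) * g (n k) (x' k)) \<longlonglongrightarrow> exp (- (z^2 / (2 * v))) / sqrt (2 * pi * v)"
  proof (rule local_limit_pos)
    show "filterlim x' at_top sequentially"
      by (rule filterlim_cong[THEN iffD2, OF refl refl ev x])
    show "(\<lambda>k. (\<mu> * x' k - real (n k)) / sqrt (x' k)) \<longlonglongrightarrow> z"
      by (rule Lim_transform_eventually[OF z]) (use ev in eventually_elim, simp)
  qed (simp add: x'_def)
  then show ?thesis
    by (rule Lim_transform_eventually) (use ev in eventually_elim, simp)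
qed

text \<open>From here on the shift \<open>1 / sqrt m\<close> is admissible and at most 1, and its
  quadratic cost takes at most half of the linear gain \<bar>y\<bar>.\<close>

definition large_mean where
  "large_mean m \<longleftrightarrow> m > 0 \<and> 1 / sqrt m \<le> \<delta> \<and> 1 \<le> sqrt m \<and> 2 * quad_coeff / \<mu> \<le> sqrt m"

lemma eventually_large_mean: "eventually large_mean at_top"
proof -
  have "eventually (\<lambda>m::real. m > 0) at_top" by real_asymp
  moreover have "eventually (\<lambda>m::real. 1 / sqrt m \<le> \<delta>) at_top" using pos by real_asymp
  moreover have "eventually (\<lambda>m::real. 1 \<le> sqrt m) at_top" by real_asymp
  moreover have "eventually (\<lambda>m::real. 2 * quad_coeff / \<mu> \<le> sqrt m) at_top" by real_asymp
  ultimately show ?thesis unfolding large_mean_def by eventually_elim auto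
qed

text \<open>
  Shifting the contour of integration by \<open>h\<close>, of size \<open>1 / sqrt M\<close> and with the sign opposite to \<open>y\<close>,
  gains the factor \<open>exp (- \<bar>y\<bar> / 2)\<close>.
\<close>

lemma g_bound_near_mean:
  assumes "large_mean M"
    and n: "\<bar>real n - M\<bar> \<le> 1" and x: "x = (M + y * sqrt M) / \<mu>" "x > 0"
  shows "\<bar>g n x\<bar> \<le> exp (1 + quad_coeff / \<mu>) * exp (- \<bar>y\<bar> / 2)"
    and "\<bar>g n x\<bar> \<le> exp (1 + quad_coeff / \<mu>) * exp (- \<bar>y\<bar> / 2) / sqrt (c * x)"
proof -
  have M: "M > 0" "1 / sqrt M \<le> \<delta>" "1 \<le> sqrt M" "2 * quad_coeff / \<mu> \<le> sqrt M"
    using assms(1) by (auto simp: large_mean_def)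
  define h where "h = (if y \<ge> 0 then - 1 / sqrt M else 1 / sqrt M)"
  have sM: "sqrt M > 0" using M by simp
  have h: "\<bar>h\<bar> = 1 / sqrt M" "h^2 = 1 / M" using M by (auto simp: h_def power_divide)
  have hy: "y * sqrt M * h = - \<bar>y\<bar>" using sM by (auto simp: h_def)
  have "x * (\<mu> * h + quad_coeff * h^2) - n * h = (\<mu> * x - n) * h + quad_coeff * x / M"
    by (simp add: h algebra_simps)
  also have "\<mu> * x = M + y * sqrt M" using x pos by simp
  also have "(M + y * sqrt M - n) * h = (M - n) * h - \<bar>y\<bar>"
    using hy by (simp add: algebra_simps)
  also have "(M - n) * h \<le> 1"
  proof -
    have "(M - n) * h \<le> \<bar>M - n\<bar> * \<bar>h\<bar>" by (metis abs_ge_self abs_mult)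
    also have "\<dots> \<le> 1 * 1" using n M sM by (intro mult_mono) (auto simp: h)
    finally show ?thesis by simp
  qed
  also have "quad_coeff * x / M \<le> quad_coeff / \<mu> + \<bar>y\<bar> / 2"
  proof -
    have "x \<le> (M + \<bar>y\<bar> * sqrt M) / \<mu>" unfolding x(1) using pos sM
      by (intro divide_right_mono add_left_mono mult_right_mono) auto
    then have "quad_coeff * x / M \<le> quad_coeff * ((M + \<bar>y\<bar> * sqrt M) / \<mu>) / M"
      using quad_coeff_nonneg M by (intro divide_right_mono mult_left_mono) auto
    also have "\<dots> = quad_coeff / \<mu> + \<bar>y\<bar> * (quad_coeff / \<mu> / sqrt M)"
      using M pos by (simp add: field_simps)
    also have "quad_coeff / \<mu> / sqrt M \<le> 1 / 2"
      using M(4) sM by (subst pos_divide_le_eq) (auto simp: mult.commute)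
    finally show ?thesis by (simp add: mult_left_mono)
  qed
  finally have "x * (\<mu> * h + quad_coeff * h^2) - n * h \<le> 1 + quad_coeff / \<mu> + (- \<bar>y\<bar> / 2)" by simp
  then have A: "exp (x * (\<mu> * h + quad_coeff * h^2) - n * h) \<le> exp (1 + quad_coeff / \<mu>) * exp (- \<bar>y\<bar> / 2)"
    by (simp flip: exp_add)
  have "\<bar>h\<bar> \<le> \<delta>" using M h by simp
  note gb = g_bound[OF x(2) this, of n]
  show "\<bar>g n x\<bar> \<le> exp (1 + quad_coeff / \<mu>) * exp (- \<bar>y\<bar> / 2)" using gb(1) A by linarith
  have "exp (x * (\<mu> * h + quad_coeff * h^2) - n * h) / sqrt (c * x) \<le> exp (1 + quad_coeff / \<mu>) * exp (- \<bar>y\<bar> / 2) / sqrt (c * x)"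
    using A \<open>x > 0\<close> pos by (intro divide_right_mono real_sqrt_ge_zero mult_nonneg_nonneg) auto
  then show "\<bar>g n x\<bar> \<le> exp (1 + quad_coeff / \<mu>) * exp (- \<bar>y\<bar> / 2) / sqrt (c * x)" using gb(2) by linarith
qed


text \<open>Below half the central point \<open>M / \<mu>\<close> the deviation \<bar>y\<bar> is at
  least \<open>sqrt M / 2\<close>, so every factor is exponentially small in \<open>sqrt M\<close>
  and beats any power of \<open>M\<close>. Near 0 only the power of \<open>x\<close> is singular,
  and it is integrable as \<open>s > 0\<close>; hence the bound without \<open>1 / sqrt x\<close> is
  the one used.\<close>

lemma small_x_negligible:
  fixes n :: "nat \<Rightarrow> nat \<Rightarrow> nat" and M :: "nat \<Rightarrow> real"
  assumes s: "s > 0" and p: "p > 0" and M: "filterlim M at_top sequentially"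
    and n: "\<And>k i. i < p \<Longrightarrow> \<bar>real (n k i) - M k\<bar> \<le> 1"
  defines "\<Phi> \<equiv> (\<lambda>k x. x powr (s - 1) * (\<Prod>i<p. g (n k i) x))"
  shows "eventually (\<lambda>k. set_integrable lborel {0<..<M k / (2 * \<mu>)} (\<Phi> k)) sequentially"
    and "(\<lambda>k. M k powr a * (LBINT x:{0<..<M k / (2 * \<mu>)}. \<Phi> k x)) \<longlonglongrightarrow> 0"
proof -
  define E where "E = exp (1 + quad_coeff / \<mu>)"
  have ev_good: "eventually (\<lambda>k. large_mean (M k)) sequentially"
    using eventually_large_mean M by (rule eventually_compose_filterlim)
  have [measurable]: "\<Phi> k \<in> borel_measurable borel" for k
    unfolding \<Phi>_def by measurable
  define bd where "bd = (\<lambda>m. (E * exp (- (sqrt m / 4))) ^ p)"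
  have \<Phi>_bd: "\<bar>\<Phi> k x\<bar> \<le> bd (M k) * x powr (s - 1)"
    if "large_mean (M k)" "x \<in> {0<..<M k / (2 * \<mu>)}" for k x
  proof -
    define y where "y = (\<mu> * x - M k) / sqrt (M k)"
    have sM: "sqrt (M k) > 0" "M k > 0" using that by (auto simp: large_mean_def)
    have xy: "x = (M k + y * sqrt (M k)) / \<mu>" using sM pos by (simp add: y_def)
    have "\<mu> * x \<le> M k / 2" using that pos by (auto simp: field_simps)
    then have "y \<le> (- M k / 2) / sqrt (M k)"
      unfolding y_def using sM by (intro divide_right_mono) auto
    also have "\<dots> = - (sqrt (M k) / 2)"
      using sM real_div_sqrt[of "M k"] by (simp add: field_simps)
    finally have y: "\<bar>y\<bar> \<ge> sqrt (M k) / 2" by simp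
    have "\<bar>g (n k i) x\<bar> \<le> E * exp (- (sqrt (M k) / 4))" if "i < p" for i
    proof -
      have "\<bar>g (n k i) x\<bar> \<le> E * exp (- \<bar>y\<bar> / 2)"
        unfolding E_def using \<open>large_mean (M k)\<close> \<open>x \<in> _\<close> n[OF that] xy
        by (intro g_bound_near_mean(1)[of "M k"]) (auto simp: large_mean_def)
      also have "\<dots> \<le> E * exp (- (sqrt (M k) / 4))"
        using y by (intro mult_left_mono) (auto simp: E_def)
      finally show ?thesis .
    qed
    then have "(\<Prod>i<p. \<bar>g (n k i) x\<bar>) \<le> (\<Prod>i<p. E * exp (- (sqrt (M k) / 4)))"
      by (intro prod_mono) auto
    also have "\<dots> = bd (M k)" by (simp add: bd_def)
    finally have "(\<Prod>i<p. \<bar>g (n k i) x\<bar>) \<le> bd (M k)" .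
    then have "x powr (s - 1) * (\<Prod>i<p. \<bar>g (n k i) x\<bar>) \<le> x powr (s - 1) * bd (M k)"
      by (rule mult_left_mono) simp
    then show ?thesis by (simp add: \<Phi>_def abs_mult abs_prod mult.commute)
  qed
  have pw: "set_integrable lborel {0<..<M k / (2 * \<mu>)} (\<lambda>x. x powr (s - 1))"
     "(LBINT x:{0<..<M k / (2 * \<mu>)}. x powr (s - 1)) = (M k / (2 * \<mu>)) powr s / s" if "large_mean (M k)" for k
  proof -
    have "((\<lambda>x. x powr (s - 1)) has_integral (M k / (2 * \<mu>)) powr s / s) {0..M k / (2 * \<mu>)}"
      using has_integral_powr_from_0[of "s - 1" "M k / (2 * \<mu>)"] s that pos by (simp add: large_mean_def)
    then have "((\<lambda>x. x powr (s - 1)) has_integral (M k / (2 * \<mu>)) powr s / s) {0<..<M k / (2 * \<mu>)}"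
      by (simp add: has_integral_Icc_iff_Ioo)
    from set_integral_lborel_of_has_integral[OF _ this]
    show "set_integrable lborel {0<..<M k / (2 * \<mu>)} (\<lambda>x. x powr (s - 1))"
     "(LBINT x:{0<..<M k / (2 * \<mu>)}. x powr (s - 1)) = (M k / (2 * \<mu>)) powr s / s" by auto
  qed
  have int: "set_integrable lborel {0<..<M k / (2 * \<mu>)} (\<Phi> k)" if "large_mean (M k)" for k
  proof (rule set_integrable_bound)
    show "set_integrable lborel {0<..<M k / (2 * \<mu>)} (\<lambda>x. bd (M k) * x powr (s - 1))"
      using pw(1)[OF that] by (rule set_integrable_mult_right)
    show "set_borel_measurable lborel {0<..<M k / (2 * \<mu>)} (\<Phi> k)"
      unfolding set_borel_measurable_def by measurable
    show "AE x in lborel. x \<in> {0<..<M k / (2 * \<mu>)} \<longrightarrow> norm (\<Phi> k x) \<le> norm (bd (M k) * x powr (s - 1))"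
    proof (intro AE_I2 impI)
      fix x assume "x \<in> {0<..<M k / (2 * \<mu>)}"
      from \<Phi>_bd[OF that this] show "norm (\<Phi> k x) \<le> norm (bd (M k) * x powr (s - 1))"
        unfolding real_norm_def by linarith
    qed
  qed
  show "eventually (\<lambda>k. set_integrable lborel {0<..<M k / (2 * \<mu>)} (\<Phi> k)) sequentially"
    using ev_good by eventually_elim (rule int)
  show "(\<lambda>k. M k powr a * (LBINT x:{0<..<M k / (2 * \<mu>)}. \<Phi> k x)) \<longlonglongrightarrow> 0"
  proof (rule Lim_null_comparison)
    show "eventually (\<lambda>k. norm (M k powr a * (LBINT x:{0<..<M k / (2 * \<mu>)}. \<Phi> k x)) \<le>
       E ^ p / ((2 * \<mu>) powr s * s) * (M k powr (a + s) * exp (- (real p / 4) * sqrt (M k)))) sequentially"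
      using ev_good
    proof eventually_elim
      case (elim k)
      have "\<bar>LBINT x:{0<..<M k / (2 * \<mu>)}. \<Phi> k x\<bar> \<le> (LBINT x:{0<..<M k / (2 * \<mu>)}. \<bar>\<Phi> k x\<bar>)"
        using set_integral_norm_bound[OF int[OF elim]] by simp
      also have "\<dots> \<le> (LBINT x:{0<..<M k / (2 * \<mu>)}. bd (M k) * x powr (s - 1))"
        by (intro set_integral_mono set_integrable_mult_right pw(1) elim \<Phi>_bd
              set_integrable_abs int)
      also have "\<dots> = bd (M k) * ((M k / (2 * \<mu>)) powr s / s)"
        using pw(2)[OF elim] by simp
      finally have "M k powr a * \<bar>LBINT x:{0<..<M k / (2 * \<mu>)}. \<Phi> k x\<bar> \<le>
        M k powr a * (bd (M k) * ((M k / (2 * \<mu>)) powr s / s))"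
        by (rule mult_left_mono) simp
      also have "bd (M k) = E ^ p * exp (- (real p / 4) * sqrt (M k))"
        by (simp add: bd_def power_mult_distrib exp_of_nat_mult[symmetric])
      also have "(M k / (2 * \<mu>)) powr s = M k powr s / (2 * \<mu>) powr s"
        by (rule powr_divide)
      finally show ?case by (simp add: abs_mult powr_add mult_ac)
    qed
    have "(\<lambda>k. M k powr (a + s) * exp (- (real p / 4) * sqrt (M k))) \<longlonglongrightarrow> 0"
      using p by (intro tendsto_power_mult_exp_neg_sqrt[OF M]) auto
    from tendsto_mult_left[OF this, of "E ^ p / ((2 * \<mu>) powr s * s)"]
    show "(\<lambda>k. E ^ p / ((2 * \<mu>) powr s * s) * (M k powr (a + s) * exp (- (real p / 4) * sqrt (M k)))) \<longlonglongrightarrow> 0"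
      by simp
  qed
qed

text \<open>Substituting \<open>x = (M + y * sqrt M) / \<mu>\<close> turns each factor, times
  \<open>sqrt M\<close>, into an approximate normal density and the power of \<open>x\<close> into
  \<open>(1 + y / sqrt M) powr (s - 1)\<close>. The cut keeps that base above \<open>1 / 2\<close>,
  so \<open>s < 1\<close> does no harm.\<close>

lemma large_x_limit:
  fixes s :: real and n :: "nat \<Rightarrow> nat \<Rightarrow> nat" and M :: "nat \<Rightarrow> real"
  assumes p: "p > 0" and M: "filterlim M at_top sequentially"
    and n: "\<And>k i. i < p \<Longrightarrow> \<bar>real (n k i) - M k\<bar> \<le> 1"
  defines "\<Phi> \<equiv> (\<lambda>k x. x powr (s - 1) * (\<Prod>i<p. g (n k i) x))"
  shows "eventually (\<lambda>k. set_integrable lborel {M k / (2 * \<mu>)..} (\<Phi> k)) sequentially"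
    and "(\<lambda>k. (M k / \<mu>) powr (1 - s) * sqrt (M k) ^ (p - 1) * \<mu> * (LBINT x:{M k / (2 * \<mu>)..}. \<Phi> k x)) \<longlonglongrightarrow>
            (LBINT y. normal_density 0 (sqrt (v / \<mu>)) y ^ p)"
proof -
  define E where "E = exp (1 + quad_coeff / \<mu>)"
  have ev_good: "eventually (\<lambda>k. large_mean (M k)) sequentially"
    using eventually_large_mean M by (rule eventually_compose_filterlim)
  have [measurable]: "\<Phi> k \<in> borel_measurable borel" for k
    unfolding \<Phi>_def by measurable
  \<comment> \<open>Setting \<open>F\<close> to 0 for small means makes the majorant valid for every
    \<open>k\<close>, not just eventually.\<close>
  define F where "F = (\<lambda>k y. if large_mean (M k) then indicat_real {- sqrt (M k) / 2..} y *
     (1 + y / sqrt (M k)) powr (s - 1) * (\<Prod>i<p. sqrt (M k) * g (n k i) ((M k + y * sqrt (M k)) / \<mu>)) else 0)"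
  obtain K where K: "\<And>y. (2 * (1 + \<bar>y\<bar>)) powr \<bar>s - 1\<bar> * exp (- \<bar>y\<bar> / 2) \<le> K * inverse (1 + y^2)"
    using powr_mult_exp_le_inverse_square[of "\<bar>s - 1\<bar>"] by auto
  \<comment> \<open>The root comes from \<open>sqrt M / sqrt (c * x)\<close> with
    \<open>x \<ge> M / (2 * \<mu>)\<close>.\<close>
  define A where "A = (E * sqrt (2 * \<mu> / c)) ^ p"
  have A: "A \<ge> 0" using pos by (simp add: A_def E_def)
  have F_bd: "\<bar>F k y\<bar> \<le> A * (K * inverse (1 + y^2))" for k y
  proof (cases "large_mean (M k) \<and> y \<ge> - sqrt (M k) / 2")
    case False
    have "0 \<le> (2 * (1 + \<bar>y\<bar>)) powr \<bar>s - 1\<bar> * exp (- \<bar>y\<bar> / 2)" by simp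
    then have "0 \<le> K * inverse (1 + y^2)" using K[of y] by linarith
    then show ?thesis using False A by (auto simp: F_def indicator_def)
  next
    case True
    define x where "x = (M k + y * sqrt (M k)) / \<mu>"
    have g: "large_mean (M k)" and y: "y \<ge> - sqrt (M k) / 2" using True by auto
    have sM: "sqrt (M k) \<ge> 1" "M k > 0" using g by (auto simp: large_mean_def)
    have "- (M k) / 2 = (- sqrt (M k) / 2) * sqrt (M k)" using sM by simp
    also have "\<dots> \<le> y * sqrt (M k)" using sM y by (intro mult_right_mono) auto
    finally have x: "x \<ge> M k / (2 * \<mu>)" using pos by (simp add: x_def field_simps)
    have x0: "x > 0" using x sM pos by (smt (verit) divide_pos_pos mult_pos_pos)
    have "\<bar>sqrt (M k) * g (n k i) x\<bar> \<le> E * sqrt (2 * \<mu> / c) * exp (- \<bar>y\<bar> / 2)" if "i < p" for i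
    proof -
      have "sqrt (M k) * \<bar>g (n k i) x\<bar> \<le> sqrt (M k) * (E * exp (- \<bar>y\<bar> / 2) / sqrt (c * x))"
        unfolding E_def using g n[OF that] x0 x_def sM
        by (intro mult_left_mono g_bound_near_mean(2)[of "M k"]) (auto simp: large_mean_def)
      also have "\<dots> = E * exp (- \<bar>y\<bar> / 2) * sqrt (M k / (c * x))"
        by (simp add: real_sqrt_divide)
      also have "M k / (c * x) \<le> 2 * \<mu> / c"
        using x x0 pos sM by (simp add: field_simps)
      finally show ?thesis using sM pos by (simp add: abs_mult E_def mult_ac mult_left_mono)
    qed
    then have "(\<Prod>i<p. \<bar>sqrt (M k) * g (n k i) x\<bar>) \<le> (\<Prod>i<p. E * sqrt (2 * \<mu> / c) * exp (- \<bar>y\<bar> / 2))"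
      by (intro prod_mono) auto
    also have "\<dots> = A * exp (- \<bar>y\<bar> / 2) ^ p" by (simp add: A_def power_mult_distrib)
    \<comment> \<open>One of the \<open>p\<close> decaying factors is enough for
      integrability.\<close>
    also have "\<dots> \<le> A * exp (- \<bar>y\<bar> / 2) ^ 1"
      using A p by (intro mult_left_mono power_decreasing) auto
    finally have P: "(\<Prod>i<p. \<bar>sqrt (M k) * g (n k i) x\<bar>) \<le> A * exp (- \<bar>y\<bar> / 2)" by simp
    have "y / sqrt (M k) \<ge> (- sqrt (M k) / 2) / sqrt (M k)"
      using y sM by (intro divide_right_mono) auto
    moreover have "(- sqrt (M k) / 2) / sqrt (M k) = - (1 / 2)" using sM by simp
    ultimately have lo: "1 + y / sqrt (M k) \<ge> 1 / 2" by linarith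
    have "y / sqrt (M k) \<le> \<bar>y\<bar> / sqrt (M k)" using sM by (intro divide_right_mono) auto
    also have "\<dots> \<le> \<bar>y\<bar> / 1" using sM by (intro divide_left_mono) auto
    finally have "(1 + y / sqrt (M k)) powr (s - 1) \<le> (2 * (1 + \<bar>y\<bar>)) powr \<bar>s - 1\<bar>"
      by (intro abs_powr_le lo) auto
    then have "(1 + y / sqrt (M k)) powr (s - 1) * (\<Prod>i<p. \<bar>sqrt (M k) * g (n k i) x\<bar>) \<le>
       (2 * (1 + \<bar>y\<bar>)) powr \<bar>s - 1\<bar> * (A * exp (- \<bar>y\<bar> / 2))"
      using P by (intro mult_mono) (auto intro: prod_nonneg)
    also have "\<dots> = A * ((2 * (1 + \<bar>y\<bar>)) powr \<bar>s - 1\<bar> * exp (- \<bar>y\<bar> / 2))" by simp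
    also have "\<dots> \<le> A * (K * inverse (1 + y^2))" using K A by (intro mult_left_mono) auto
    finally show ?thesis using True by (simp add: F_def indicator_def abs_mult abs_prod x_def)
  qed
  have [measurable]: "F k \<in> borel_measurable borel" for k
    unfolding F_def by measurable
  have intW: "integrable lborel (\<lambda>y. A * (K * inverse (1 + y^2)))"
    using integrable_inverse_1_plus_square_lborel by simp
  have intF: "integrable lborel (F k)" for k
  proof (rule Bochner_Integration.integrable_bound[OF intW])
    show "AE y in lborel. norm (F k y) \<le> norm (A * (K * inverse (1 + y^2)))"
      using F_bd[of k] by (intro AE_I2) (metis abs_ge_self order.trans real_norm_def)
  qed measurable
  have F_\<Phi>: "F k y = (M k / \<mu>) powr (1 - s) * sqrt (M k) ^ p *
      (indicat_real {M k / (2 * \<mu>)..} (M k / \<mu> + sqrt (M k) / \<mu> * y) * \<Phi> k (M k / \<mu> + sqrt (M k) / \<mu> * y))"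
    if g: "large_mean (M k)" for k y
  proof -
    define x where "x = M k / \<mu> + sqrt (M k) / \<mu> * y"
    have x: "x = (M k + y * sqrt (M k)) / \<mu>" by (simp add: x_def add_divide_distrib mult.commute)
    have sM: "sqrt (M k) \<ge> 1" "M k > 0" using g by (auto simp: large_mean_def)
    have mM: "M k / \<mu> > 0" using sM pos by simp
    have x2: "x = (M k / \<mu>) * (1 + y / sqrt (M k))"
    proof -
      have "y * sqrt (M k) = M k * (y / sqrt (M k))"
        using sM real_div_sqrt[of "M k"] by (simp add: field_simps)
      then show ?thesis unfolding x by (simp add: algebra_simps add_divide_distrib)
    qed
    have iff: "- sqrt (M k) / 2 \<le> y \<longleftrightarrow> M k / (2 * \<mu>) \<le> x"
    proof -
      have "M k / (2 * \<mu>) \<le> x \<longleftrightarrow> (M k / \<mu>) * (1 / 2) \<le> (M k / \<mu>) * (1 + y / sqrt (M k))"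
        by (simp add: x2 mult.commute)
      also have "\<dots> \<longleftrightarrow> 1 / 2 \<le> 1 + y / sqrt (M k)" using mM by (rule mult_le_cancel_left_pos)
      also have "\<dots> \<longleftrightarrow> - sqrt (M k) / 2 \<le> y" using sM by (auto simp: field_simps)
      finally show ?thesis by simp
    qed
    show ?thesis
    proof (cases "M k / (2 * \<mu>) \<le> x")
      case False
      then show ?thesis using iff unfolding x_def[symmetric] by (simp add: F_def indicator_def)
    next
      case True
      have "x > 0" using True sM pos by (smt (verit) divide_pos_pos mult_pos_pos)
      then have nn: "1 + y / sqrt (M k) > 0"
        using mM zero_less_mult_pos[of "M k / \<mu>" "1 + y / sqrt (M k)"] by (simp only: x2)
      have "(M k / \<mu>) powr (1 - s) * x powr (s - 1) = (1 + y / sqrt (M k)) powr (s - 1)"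
      proof -
        have "x powr (s - 1) = (M k / \<mu>) powr (s - 1) * (1 + y / sqrt (M k)) powr (s - 1)"
          unfolding x2 by (rule powr_mult)
        moreover have "(M k / \<mu>) powr (1 - s) * (M k / \<mu>) powr (s - 1) = 1"
          using mM sM pos by (simp flip: powr_add)
        ultimately show ?thesis by (simp flip: mult.assoc)
      qed
      then show ?thesis using True iff g unfolding x_def[symmetric]
        by (simp add: F_def \<Phi>_def indicator_def prod.distrib flip: x)
    qed
  qed
  have int_iff: "set_integrable lborel {M k / (2 * \<mu>)..} (\<Phi> k)"
    and int_eq: "(M k / \<mu>) powr (1 - s) * sqrt (M k) ^ (p - 1) * \<mu> * (LBINT x:{M k / (2 * \<mu>)..}. \<Phi> k x) = (LBINT y. F k y)"
    if g: "large_mean (M k)" for k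
  proof -
    have sM: "sqrt (M k) > 0" "M k > 0" using g by (auto simp: large_mean_def)
    define f where "f = (\<lambda>x. indicat_real {M k / (2 * \<mu>)..} x * \<Phi> k x)"
    define w where "w = (M k / \<mu>) powr (1 - s) * sqrt (M k) ^ p"
    have w: "w \<noteq> 0" using sM pos by (simp add: w_def)
    have Ff: "F k = (\<lambda>y. w * f (M k / \<mu> + sqrt (M k) / \<mu> * y))"
      using F_\<Phi>[OF g] by (auto simp: w_def f_def)
    have "integrable lborel (\<lambda>y. f (M k / \<mu> + sqrt (M k) / \<mu> * y))"
      using intF[of k] w unfolding Ff by simp
    then have "integrable lborel f"
      using sM pos by (subst (asm) lborel_integrable_real_affine_iff) auto
    then show "set_integrable lborel {M k / (2 * \<mu>)..} (\<Phi> k)"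
      by (simp add: set_integrable_def f_def)
    have "(LBINT x:{M k / (2 * \<mu>)..}. \<Phi> k x) = (LBINT x. f x)"
      by (simp add: set_lebesgue_integral_def f_def)
    also have "\<dots> = sqrt (M k) / \<mu> * (LBINT y. f (M k / \<mu> + sqrt (M k) / \<mu> * y))"
      using sM pos by (subst lborel_integral_real_affine[where c = "sqrt (M k) / \<mu>" and t = "M k / \<mu>"]) auto
    finally have "(M k / \<mu>) powr (1 - s) * sqrt (M k) ^ (p - 1) * \<mu> * (LBINT x:{M k / (2 * \<mu>)..}. \<Phi> k x) =
       (M k / \<mu>) powr (1 - s) * (sqrt (M k) ^ (p - 1) * sqrt (M k)) * (LBINT y. f (M k / \<mu> + sqrt (M k) / \<mu> * y))"
      using pos by simp
    also have "sqrt (M k) ^ (p - 1) * sqrt (M k) = sqrt (M k) ^ p"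
      using p by (metis power_minus_mult)
    finally show "(M k / \<mu>) powr (1 - s) * sqrt (M k) ^ (p - 1) * \<mu> * (LBINT x:{M k / (2 * \<mu>)..}. \<Phi> k x) = (LBINT y. F k y)"
      unfolding Ff by (simp add: w_def)
  qed
  show "eventually (\<lambda>k. set_integrable lborel {M k / (2 * \<mu>)..} (\<Phi> k)) sequentially"
    using ev_good by eventually_elim (rule int_iff)
  have lim: "(\<lambda>k. LBINT y. F k y) \<longlonglongrightarrow> (LBINT y. normal_density 0 (sqrt (v / \<mu>)) y ^ p)"
  proof (rule integral_dominated_convergence[OF _ _ intW])
    show "AE y in lborel. norm (F k y) \<le> A * (K * inverse (1 + y^2))" for k
      using F_bd[of k] by simp
    show "AE y in lborel. (\<lambda>k. F k y) \<longlonglongrightarrow> normal_density 0 (sqrt (v / \<mu>)) y ^ p"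
    proof (rule AE_I2)
      fix y :: real
      define x where "x = (\<lambda>k. (M k + y * sqrt (M k)) / \<mu>)"
      have x_top: "filterlim x at_top sequentially"
      proof -
        have "filterlim (\<lambda>m::real. (m + y * sqrt m) / \<mu>) at_top at_top"
          using pos by real_asymp
        then show ?thesis unfolding x_def by (rule filterlim_compose[OF _ M])
      qed
      have invsqrt: "(\<lambda>k. 1 / sqrt (M k)) \<longlonglongrightarrow> 0"
      proof -
        have "((\<lambda>m::real. 1 / sqrt m) \<longlongrightarrow> 0) at_top" by real_asymp
        then show ?thesis by (rule filterlim_compose[OF _ M])
      qed
      have ratio: "(\<lambda>k. sqrt (M k) / sqrt (x k)) \<longlonglongrightarrow> sqrt \<mu>"
      proof -
        have "((\<lambda>m::real. sqrt m / sqrt ((m + y * sqrt m) / \<mu>)) \<longlongrightarrow> inverse (inverse \<mu> powr (1 / 2))) at_top"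
          using pos by real_asymp
        also have "inverse (inverse \<mu> powr (1 / 2)) = sqrt \<mu>"
          using pos by (simp add: powr_half_sqrt real_sqrt_inverse)
        finally have "((\<lambda>m::real. sqrt m / sqrt ((m + y * sqrt m) / \<mu>)) \<longlongrightarrow> sqrt \<mu>) at_top" .
        then show ?thesis unfolding x_def by (rule filterlim_compose[OF _ M])
      qed
      have one: "(\<lambda>k. (1 + y / sqrt (M k)) powr (s - 1)) \<longlonglongrightarrow> 1"
      proof -
        have "((\<lambda>m::real. (1 + y / sqrt m) powr (s - 1)) \<longlongrightarrow> 1) at_top" by real_asymp
        then show ?thesis by (rule filterlim_compose[OF _ M])
      qed
      have ev_pos: "eventually (\<lambda>k. M k > 0 \<and> x k > 0) sequentially"
        using filterlim_at_top_dense[THEN iffD1, OF x_top, rule_format, of 0]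
          filterlim_at_top_dense[THEN iffD1, OF M, rule_format, of 0] by eventually_elim auto
      have lim_i: "(\<lambda>k. sqrt (M k) * g (n k i) (x k)) \<longlonglongrightarrow> normal_density 0 (sqrt (v / \<mu>)) y" if i: "i < p" for i
      proof -
        \<comment> \<open>Here \<open>\<mu> * x = M + y * sqrt M\<close>: the bounded difference of
          \<open>M\<close> and \<open>n\<close> vanishes against \<open>sqrt x\<close>, and
          \<open>sqrt M / sqrt x\<close> tends to \<open>sqrt \<mu>\<close>.\<close>
        have "(\<lambda>k. (\<mu> * x k - real (n k i)) / sqrt (x k)) \<longlonglongrightarrow> (y + 0) * sqrt \<mu>"
        proof -
          have "(\<lambda>k. (M k - real (n k i)) * (1 / sqrt (M k))) \<longlonglongrightarrow> 0"
          proof (rule Lim_null_comparison[OF _ invsqrt])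
            show "eventually (\<lambda>k. norm ((M k - real (n k i)) * (1 / sqrt (M k))) \<le> 1 / sqrt (M k)) sequentially"
              using ev_pos
            proof eventually_elim
              case (elim k)
              have "\<bar>M k - real (n k i)\<bar> * (1 / sqrt (M k)) \<le> 1 * (1 / sqrt (M k))"
                using n[OF i, of k] elim by (intro mult_right_mono) auto
              then show ?case using elim by (simp add: abs_mult)
            qed
          qed
          then have "(\<lambda>k. (y + (M k - real (n k i)) * (1 / sqrt (M k))) * (sqrt (M k) / sqrt (x k))) \<longlonglongrightarrow> (y + 0) * sqrt \<mu>"
            by (intro tendsto_intros ratio)
          then show ?thesis
          proof (rule Lim_transform_eventually)
            show "eventually (\<lambda>k. (y + (M k - real (n k i)) * (1 / sqrt (M k))) * (sqrt (M k) / sqrt (x k)) =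
               (\<mu> * x k - real (n k i)) / sqrt (x k)) sequentially"
              using ev_pos
            proof eventually_elim
              case (elim k)
              then have "\<mu> * x k = M k + y * sqrt (M k)" using pos by (simp add: x_def)
              then show ?case using elim by (simp add: field_simps)
            qed
          qed
        qed
        from local_limit[OF x_top this]
        have "(\<lambda>k. (sqrt (M k) / sqrt (x k)) * (sqrt (x k) * g (n k i) (x k))) \<longlonglongrightarrow>
           sqrt \<mu> * (exp (- (((y + 0) * sqrt \<mu>)^2 / (2 * v))) / sqrt (2 * pi * v))"
          by (intro tendsto_intros ratio)
        \<comment> \<open>Variance \<open>v\<close> at the point \<open>y * sqrt \<mu>\<close>
          becomes variance \<open>v / \<mu>\<close> at \<open>y\<close>.\<close>
        also have "sqrt \<mu> * (exp (- (((y + 0) * sqrt \<mu>)^2 / (2 * v))) / sqrt (2 * pi * v)) =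
            normal_density 0 (sqrt (v / \<mu>)) y"
          using pos by (simp add: normal_density_def power_mult_distrib power_divide real_sqrt_divide real_sqrt_mult)
        finally show ?thesis
          by (rule Lim_transform_eventually) (use ev_pos in eventually_elim, simp)
      qed
      have "(\<lambda>k. (1 + y / sqrt (M k)) powr (s - 1) * (\<Prod>i<p. sqrt (M k) * g (n k i) (x k))) \<longlonglongrightarrow>
         1 * (\<Prod>i<p. normal_density 0 (sqrt (v / \<mu>)) y)"
        by (intro tendsto_mult one tendsto_prod lim_i) auto
      then have "(\<lambda>k. (1 + y / sqrt (M k)) powr (s - 1) * (\<Prod>i<p. sqrt (M k) * g (n k i) (x k))) \<longlonglongrightarrow>
         normal_density 0 (sqrt (v / \<mu>)) y ^ p" by simp
      then show "(\<lambda>k. F k y) \<longlonglongrightarrow> normal_density 0 (sqrt (v / \<mu>)) y ^ p"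
      proof (rule Lim_transform_eventually)
        have "eventually (\<lambda>m::real. - sqrt m / 2 \<le> y) at_top" by real_asymp
        then have "eventually (\<lambda>k. - sqrt (M k) / 2 \<le> y) sequentially"
          using M by (rule eventually_compose_filterlim)
        then show "eventually (\<lambda>k. (1 + y / sqrt (M k)) powr (s - 1) * (\<Prod>i<p. sqrt (M k) * g (n k i) (x k)) = F k y) sequentially"
          using ev_good by eventually_elim (simp add: F_def x_def indicator_def)
      qed
    qed
  qed measurable
  show "(\<lambda>k. (M k / \<mu>) powr (1 - s) * sqrt (M k) ^ (p - 1) * \<mu> * (LBINT x:{M k / (2 * \<mu>)..}. \<Phi> k x)) \<longlonglongrightarrow>
            (LBINT y. normal_density 0 (sqrt (v / \<mu>)) y ^ p)"
    by (rule Lim_transform_eventually[OF lim]) (use ev_good in eventually_elim, rule int_eq[symmetric])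
qed

lemma integral_prod_asymptotics:
  fixes n :: "nat \<Rightarrow> nat \<Rightarrow> nat" and M :: "nat \<Rightarrow> real"
  assumes s: "s > 0" and p: "p > 0" and M: "filterlim M at_top sequentially"
    and n: "\<And>k i. i < p \<Longrightarrow> \<bar>real (n k i) - M k\<bar> \<le> 1"
  shows "(\<lambda>k. (M k / \<mu>) powr (1 - s) * sqrt (M k) ^ (p - 1) * \<mu> *
            (LBINT x:{0<..}. x powr (s - 1) * (\<Prod>i<p. g (n k i) x))) \<longlonglongrightarrow>
            (LBINT y. normal_density 0 (sqrt (v / \<mu>)) y ^ p)"
proof -
  define \<Phi> where "\<Phi> = (\<lambda>k x. x powr (s - 1) * (\<Prod>i<p. g (n k i) x))"
  define W where "W = (\<lambda>k. (M k / \<mu>) powr (1 - s) * sqrt (M k) ^ (p - 1) * \<mu>)"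
  have small: "eventually (\<lambda>k. set_integrable lborel {0<..<M k / (2 * \<mu>)} (\<Phi> k)) sequentially"
    "(\<lambda>k. M k powr a * (LBINT x:{0<..<M k / (2 * \<mu>)}. \<Phi> k x)) \<longlonglongrightarrow> 0" for a
    unfolding \<Phi>_def by (intro small_x_negligible s p M n; assumption)+
  have large: "eventually (\<lambda>k. set_integrable lborel {M k / (2 * \<mu>)..} (\<Phi> k)) sequentially"
    "(\<lambda>k. W k * (LBINT x:{M k / (2 * \<mu>)..}. \<Phi> k x)) \<longlonglongrightarrow>
            (LBINT y. normal_density 0 (sqrt (v / \<mu>)) y ^ p)"
    unfolding \<Phi>_def W_def by (intro large_x_limit p M n; assumption)+
  have ev_pos: "eventually (\<lambda>k. M k > 0) sequentially"
    using filterlim_at_top_dense[THEN iffD1, OF M, rule_format, of 0] .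
  \<comment> \<open>The exponent is the total power of \<open>M\<close> in the normalisation
    \<open>W\<close>, and \<open>\<mu> powr s\<close> is its constant.\<close>
  have "(\<lambda>k. (\<mu> powr s) * (M k powr ((1 - s) + (real p - 1) / 2) * (LBINT x:{0<..<M k / (2 * \<mu>)}. \<Phi> k x))) \<longlonglongrightarrow> \<mu> powr s * 0"
    by (intro tendsto_mult_left small(2))
  then have "(\<lambda>k. (\<mu> powr s) * (M k powr ((1 - s) + (real p - 1) / 2) * (LBINT x:{0<..<M k / (2 * \<mu>)}. \<Phi> k x))) \<longlonglongrightarrow> 0"
    by simp
  then have small': "(\<lambda>k. W k * (LBINT x:{0<..<M k / (2 * \<mu>)}. \<Phi> k x)) \<longlonglongrightarrow> 0"
  proof (rule Lim_transform_eventually)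
    show "eventually (\<lambda>k. \<mu> powr s * (M k powr ((1 - s) + (real p - 1) / 2) * (LBINT x:{0<..<M k / (2 * \<mu>)}. \<Phi> k x))
       = W k * (LBINT x:{0<..<M k / (2 * \<mu>)}. \<Phi> k x)) sequentially"
      using ev_pos
    proof eventually_elim
      case (elim k)
      have "sqrt (M k) ^ (p - 1) = M k powr ((real p - 1) / 2)"
        using elim p by (simp add: powr_half_sqrt[symmetric] powr_powr powr_realpow[symmetric] of_nat_diff)
      moreover have "(M k / \<mu>) powr (1 - s) * \<mu> = M k powr (1 - s) * \<mu> powr s"
        using elim pos by (simp add: powr_divide powr_diff)
      ultimately have "W k = \<mu> powr s * M k powr ((1 - s) + (real p - 1) / 2)"
        by (simp add: W_def powr_add mult_ac)
      then show ?case by simp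
    qed
  qed
  have "(\<lambda>k. W k * (LBINT x:{0<..<M k / (2 * \<mu>)}. \<Phi> k x) + W k * (LBINT x:{M k / (2 * \<mu>)..}. \<Phi> k x))
     \<longlonglongrightarrow> 0 + (LBINT y. normal_density 0 (sqrt (v / \<mu>)) y ^ p)"
    by (intro tendsto_add small' large(2))
  then have "(\<lambda>k. W k * (LBINT x:{0<..<M k / (2 * \<mu>)}. \<Phi> k x) + W k * (LBINT x:{M k / (2 * \<mu>)..}. \<Phi> k x))
     \<longlonglongrightarrow> (LBINT y. normal_density 0 (sqrt (v / \<mu>)) y ^ p)"
    by simp
  then have "(\<lambda>k. W k * (LBINT x:{0<..}. \<Phi> k x)) \<longlonglongrightarrow> (LBINT y. normal_density 0 (sqrt (v / \<mu>)) y ^ p)"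
  proof (rule Lim_transform_eventually)
    show "eventually (\<lambda>k. W k * (LBINT x:{0<..<M k / (2 * \<mu>)}. \<Phi> k x) + W k * (LBINT x:{M k / (2 * \<mu>)..}. \<Phi> k x) =
      W k * (LBINT x:{0<..}. \<Phi> k x)) sequentially"
      using small(1) large(1) ev_pos
    proof eventually_elim
      case (elim k)
      have "M k / (2 * \<mu>) > 0" using elim pos by simp
      then have "{0<..} = {0<..<M k / (2 * \<mu>)} \<union> {M k / (2 * \<mu>)..}" by auto
      then have "(LBINT x:{0<..}. \<Phi> k x) = (LBINT x:{0<..<M k / (2 * \<mu>)} \<union> {M k / (2 * \<mu>)..}. \<Phi> k x)"
        by (simp only:)
      also have "\<dots> = (LBINT x:{0<..<M k / (2 * \<mu>)}. \<Phi> k x) + (LBINT x:{M k / (2 * \<mu>)..}. \<Phi> k x)"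
        using elim by (intro set_integral_Un) auto
      finally show ?case by (simp add: distrib_left)
    qed
  qed
  then show ?thesis by (simp add: W_def \<Phi>_def)
qed

end

section \<open>Poisson weights and Touchard polynomials\<close>

text \<open>Jordan's inequality: concavity of the sine puts it above its chord on the first
  quadrant, and \<open>1 - cos \<theta>\<close> is twice the squared sine of half the angle.\<close>

lemma cos_le_one_minus_square:
  fixes \<theta> :: real
  assumes "\<bar>\<theta>\<bar> \<le> pi"
  shows "2 * \<theta>^2 / pi^2 \<le> 1 - cos \<theta>"
proof -
  have "convex_on {0..pi/2} (\<lambda>t. - sin t)"
  proof (rule f''_ge0_imp_convex)
    fix x :: real
    show "((\<lambda>t. - sin t) has_real_derivative - cos x) (at x)"
      by (auto intro!: derivative_eq_intros)
    show "((\<lambda>t. - cos t) has_real_derivative sin x) (at x)"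
      by (auto intro!: derivative_eq_intros)
  qed (auto intro: sin_ge_zero)
  define t where "t = \<bar>\<theta>\<bar> / 2"
  have t: "0 \<le> t" "t \<le> pi / 2" using assms by (auto simp: t_def)
  have "- sin ((1 - 2 * t / pi) *\<^sub>R 0 + (2 * t / pi) *\<^sub>R (pi / 2)) \<le>
        (1 - 2 * t / pi) * (- sin 0) + (2 * t / pi) * (- sin (pi / 2))"
    using t pi_gt_zero
    by (intro convex_onD[OF \<open>convex_on _ _\<close>]) (auto simp: field_simps)
  then have "2 * t / pi \<le> sin t" by simp
  then have "(2 * t / pi)^2 \<le> (sin t)^2" using t by (intro power_mono) auto
  moreover have "cos \<theta> = 1 - 2 * (sin t)^2"
  proof -
    have "cos \<theta> = cos (2 * t)" by (simp add: t_def)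
    then show ?thesis by (simp only: cos_double_sin)
  qed
  moreover have "(2 * t / pi)^2 = \<theta>^2 / pi^2" by (simp add: t_def power_divide)
  ultimately show ?thesis by simp
qed

lemma higher_deriv_0_eq_circle_integral:
  assumes F: "F holomorphic_on UNIV" and r: "r > 0"
  shows "(deriv ^^ n) F 0 / fact n = (1 / (2 * pi)) *\<^sub>R
     (CLBINT \<theta>:{-pi..pi}. F (of_real r * exp (\<i> * of_real \<theta>)) / (of_real r * exp (\<i> * of_real \<theta>)) ^ n)"
proof -
  define \<phi> where "\<phi> = (\<lambda>\<theta>. F (of_real r * exp (\<i> * of_real \<theta>)) / (of_real r * exp (\<i> * of_real \<theta>)) ^ n)"
  define D where "D = (deriv ^^ n) F 0 / fact n"
  have cF: "continuous_on UNIV F" using F by (rule holomorphic_on_imp_continuous_on)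
  have c\<phi>: "continuous_on UNIV \<phi>"
    unfolding \<phi>_def using r by (intro continuous_intros continuous_on_compose2[OF cF]) auto
  \<comment> \<open>The standard circle starts at angle 0; reflecting the function lets the
    parametrisation start at -\<pi> instead, as the interval of integration requires.\<close>
  have hol: "(\<lambda>w. F (- 1 * w)) holomorphic_on UNIV"
  proof -
    have "(\<lambda>w::complex. - 1 * w) holomorphic_on UNIV" by (intro holomorphic_intros)
    from holomorphic_on_compose_gen[OF this F] show ?thesis by (simp add: o_def)
  qed
  have der: "(deriv ^^ n) (\<lambda>w. F (- 1 * w)) 0 = (- 1) ^ n * (deriv ^^ n) F 0"
    using higher_deriv_compose_linear[OF F open_UNIV open_UNIV, of 0 "- 1" n] by simp
  have "((\<lambda>u. F (- 1 * u) / (u - 0) ^ Suc n) has_contour_integral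
      (2 * pi * \<i>) / fact n * ((- 1) ^ n * (deriv ^^ n) F 0)) (circlepath 0 r)"
    unfolding der[symmetric] using r
    by (intro Cauchy_has_contour_integral_higher_derivative_circlepath
          holomorphic_on_imp_continuous_on holomorphic_on_subset[OF hol]) auto
  then have "((\<lambda>t. F (- 1 * circlepath 0 r t) / (circlepath 0 r t - 0) ^ Suc n * vector_derivative (circlepath 0 r) (at t))
       has_integral (2 * pi * \<i>) / fact n * ((- 1) ^ n * (deriv ^^ n) F 0)) {0..1}"
    by (simp add: has_contour_integral)
  also have "(\<lambda>t. F (- 1 * circlepath 0 r t) / (circlepath 0 r t - 0) ^ Suc n * vector_derivative (circlepath 0 r) (at t)) =
     (\<lambda>t. (2 * pi * \<i> * (- 1) ^ n) * \<phi> (2 * pi * t - pi))"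
  proof
    fix t :: real
    define w where "w = of_real r * exp (2 * of_real pi * \<i> * of_real t)"
    have w0: "w \<noteq> 0" using r by (simp add: w_def)
    have cp: "circlepath 0 r t = w" by (simp add: circlepath w_def)
    have vd: "vector_derivative (circlepath 0 r) (at t) = 2 * pi * \<i> * w"
      by (simp add: vector_derivative_circlepath w_def)
    have "exp (\<i> * of_real (2 * pi * t - pi)) = exp (2 * of_real pi * \<i> * of_real t) * exp (- (\<i> * of_real pi))"
      by (simp add: algebra_simps flip: exp_add)
    also have "exp (- (\<i> * of_real pi)) = - 1" by (simp add: exp_minus)
    finally have mw: "of_real r * exp (\<i> * of_real (2 * pi * t - pi)) = - w" by (simp add: w_def)
    have "\<phi> (2 * pi * t - pi) = F (- w) / (- w) ^ n" unfolding \<phi>_def mw ..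
    also have "\<dots> = (- 1) ^ n * (F (- w) / w ^ n)"
      by (cases "even n") simp_all
    finally show "F (- 1 * circlepath 0 r t) / (circlepath 0 r t - 0) ^ Suc n * vector_derivative (circlepath 0 r) (at t) =
      (2 * pi * \<i> * (- 1) ^ n) * \<phi> (2 * pi * t - pi)"
      unfolding cp vd using w0 by (simp add: flip: power_mult_distrib mult.assoc)
  qed
  also have "(2 * pi * \<i>) / fact n * ((- 1) ^ n * (deriv ^^ n) F 0) = (2 * pi * \<i> * (- 1) ^ n) * D"
    by (simp add: D_def)
  finally have *: "((\<lambda>t. (2 * pi * \<i> * (- 1) ^ n) * \<phi> (2 * pi * t - pi)) has_integral (2 * pi * \<i> * (- 1) ^ n) * D) {0..1}" .
  have cancel: "inverse (2 * pi * \<i> * (- 1) ^ n) * ((2 * pi * \<i> * (- 1) ^ n) * y) = y" for y :: complex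
    by (subst mult.assoc[symmetric], subst left_inverse) auto
  have "((\<lambda>t. \<phi> (2 * pi * t - pi)) has_integral D) {0..1}"
    using has_integral_mult_right[OF *, of "inverse (2 * pi * \<i> * (- 1) ^ n)"] unfolding cancel .
  then have "D = integral {0..1} (\<lambda>t. \<phi> (2 * pi * t - pi))" by (simp add: integral_unique)
  also have "\<dots> = (CLBINT t:{0..1}. \<phi> (2 * pi * t - pi))"
    by (intro set_borel_integral_eq_integral(2)[symmetric] borel_integrable_atLeastAtMost'
          continuous_on_compose2[OF c\<phi>] continuous_intros) auto
  also have "\<dots> = (1 / (2 * pi)) *\<^sub>R (CLBINT \<theta>:{-pi..pi}. \<phi> \<theta>)"
  proof -
    have "(CLBINT \<theta>:{-pi..pi}. \<phi> \<theta>) = (2 * pi) *\<^sub>R (CLBINT t. indicat_real {-pi..pi} (- pi + 2 * pi * t) *\<^sub>R \<phi> (- pi + 2 * pi * t))"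
      unfolding set_lebesgue_integral_def
      by (subst lborel_integral_real_affine[where c = "2 * pi" and t = "- pi"]) auto
    also have "(\<lambda>t. indicat_real {-pi..pi} (- pi + 2 * pi * t) *\<^sub>R \<phi> (- pi + 2 * pi * t)) =
        (\<lambda>t. indicat_real {0..1} t *\<^sub>R \<phi> (2 * pi * t - pi))"
    proof
      fix t :: real
      have "- pi \<le> - pi + 2 * pi * t \<and> - pi + 2 * pi * t \<le> pi \<longleftrightarrow> 0 \<le> t \<and> t \<le> 1"
        using pi_ge_two by (auto simp: zero_le_mult_iff)
      moreover have "- pi + 2 * pi * t = 2 * pi * t - pi" by simp
      ultimately show "indicat_real {-pi..pi} (- pi + 2 * pi * t) *\<^sub>R \<phi> (- pi + 2 * pi * t) =
         indicat_real {0..1} t *\<^sub>R \<phi> (2 * pi * t - pi)"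
        by (simp add: indicator_def)
    qed
    finally show ?thesis by (simp add: set_lebesgue_integral_def)
  qed
  finally show ?thesis by (simp add: D_def \<phi>_def)
qed

text \<open>Cauchy's formula on the circle of radius \<open>\<rho> * exp h\<close>, with its points
  written as \<open>\<rho> * exp (h + \<i> * \<theta>)\<close>: a shift by \<open>h\<close> is a
  change of radius. In the applications \<open>k\<close> is the value of \<psi> at \<rho>, which
  makes the cumulant function vanish at 0.\<close>

lemma tilted_coefficient_inversion:
  fixes \<psi> :: "complex \<Rightarrow> complex" and a x h \<rho> k :: real
  assumes \<psi>: "\<psi> holomorphic_on UNIV" and \<rho>: "\<rho> > 0"
    and a: "complex_of_real a = (deriv ^^ n) (\<lambda>t. exp (of_real x * \<psi> t)) 0 / fact n"
  shows "complex_of_real (a * \<rho> ^ n * exp (- (x * k))) = (1 / (2 * pi)) *\<^sub>R (CLBINT \<theta>:{-pi..pi}.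
     exp (of_real x * (\<psi> (of_real \<rho> * exp (of_real h + \<i> * of_real \<theta>)) - of_real k) - of_nat n * (of_real h + \<i> * of_real \<theta>)))"
proof -
  define r where "r = \<rho> * exp h"
  have r: "r > 0" using \<rho> by (simp add: r_def)
  define K where "K = complex_of_real (\<rho> ^ n * exp (- (x * k)))"
  have re: "of_real r * exp (\<i> * of_real \<theta>) = of_real \<rho> * exp (of_real h + \<i> * complex_of_real \<theta>)" for \<theta>
    by (simp add: r_def exp_add exp_of_real)
  have eq: "K * (exp (of_real x * \<psi> (of_real r * exp (\<i> * of_real \<theta>))) / (of_real r * exp (\<i> * of_real \<theta>)) ^ n) =
     exp (of_real x * (\<psi> (of_real \<rho> * exp (of_real h + \<i> * of_real \<theta>)) - of_real k) - of_nat n * (of_real h + \<i> * complex_of_real \<theta>))" for \<theta>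
  proof -
    have K: "K = of_real \<rho> ^ n * exp (- (of_real x * of_real k))"
      by (simp add: K_def exp_of_real[symmetric])
    have "exp (of_real x * (\<psi> (of_real \<rho> * exp (of_real h + \<i> * of_real \<theta>)) - of_real k) - of_nat n * (of_real h + \<i> * complex_of_real \<theta>)) =
       exp (of_real x * \<psi> (of_real \<rho> * exp (of_real h + \<i> * of_real \<theta>))) * exp (- (of_real x * of_real k)) / exp (of_real h + \<i> * complex_of_real \<theta>) ^ n"
      by (simp only: exp_of_nat_mult[symmetric] exp_diff[symmetric] exp_add[symmetric]) (simp add: algebra_simps)
    then show ?thesis unfolding re K using \<rho> by (simp add: power_mult_distrib)
  qed
  have "complex_of_real a = (1 / (2 * pi)) *\<^sub>R
     (CLBINT \<theta>:{-pi..pi}. exp (of_real x * \<psi> (of_real r * exp (\<i> * of_real \<theta>))) / (of_real r * exp (\<i> * of_real \<theta>)) ^ n)"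
    unfolding a using r by (intro higher_deriv_0_eq_circle_integral holomorphic_intros \<psi>)
  then have "K * complex_of_real a = (1 / (2 * pi)) *\<^sub>R
     (CLBINT \<theta>:{-pi..pi}. K * (exp (of_real x * \<psi> (of_real r * exp (\<i> * of_real \<theta>))) / (of_real r * exp (\<i> * of_real \<theta>)) ^ n))"
    by (simp only: set_lebesgue_integral_def mult_scaleR_right[symmetric] integral_mult_right_zero)
  then show ?thesis unfolding eq by (simp add: K_def mult_ac)
qed

text \<open>The third derivative is bounded on the compact disc, so Taylor's estimate holds
  uniformly there.\<close>

lemma holomorphic_taylor2:
  assumes "f holomorphic_on UNIV"
  shows "\<exists>C\<ge>0. \<forall>z. norm z \<le> d \<longrightarrow> norm (f z - f 0 - deriv f 0 * z - deriv (deriv f) 0 * z^2 / 2) \<le> C * norm z ^ 3"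
proof -
  have hol: "(deriv ^^ i) f holomorphic_on UNIV" for i
    using assms by (intro holomorphic_higher_deriv) auto
  have "compact ((deriv ^^ 3) f ` cball 0 d)"
    by (intro compact_continuous_image continuous_on_subset[OF holomorphic_on_imp_continuous_on[OF hol]]) auto
  then obtain C where C: "\<And>z. z \<in> cball 0 d \<Longrightarrow> norm ((deriv ^^ 3) f z) \<le> C"
    by (metis bounded_iff compact_imp_bounded imageI)
  have "norm (f z - f 0 - deriv f 0 * z - deriv (deriv f) 0 * z^2 / 2) \<le> max 0 C * norm z ^ 3" if "norm z \<le> d" for z
  proof -
    have d: "0 \<le> d" using that norm_ge_zero[of z] by linarith
    have "norm ((deriv ^^ 0) f z - (\<Sum>i\<le>2. (deriv ^^ i) f 0 * (z - 0) ^ i / fact i)) \<le> max 0 C * norm (z - 0) ^ Suc 2 / fact 2"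
    proof (rule complex_Taylor)
      show "convex (cball (0::complex) d)" by simp
      show "((deriv ^^ i) f has_field_derivative (deriv ^^ Suc i) f x) (at x within cball 0 d)" for i x
        using holomorphic_derivI[OF hol open_UNIV, of x i] by (auto intro: has_field_derivative_at_within)
      show "norm ((deriv ^^ Suc 2) f x) \<le> max 0 C" if "x \<in> cball 0 d" for x
        using C[OF that] by (simp add: numeral_3_eq_3)
    qed (use that d in auto)
    also have "\<dots> \<le> max 0 C * norm z ^ 3" by (simp add: numeral_3_eq_3)
    finally show ?thesis by (simp add: numeral_2_eq_2 algebra_simps)
  qed
  then show ?thesis by (intro exI[of _ "max 0 C"]) auto
qed

section \<open>The Poisson family\<close>

definition poisson_mass :: "nat \<Rightarrow> real \<Rightarrow> real" where
  "poisson_mass n x = x ^ n / fact n * exp (- x)"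

lemma poisson_cumulant_family:
  "\<exists>c C. cumulant_family poisson_mass (\<lambda>z. exp z - 1) 1 1 c C 1"
proof -
  have "(\<lambda>z::complex. exp z - 1) holomorphic_on UNIV" by (intro holomorphic_intros)
  from holomorphic_taylor2[OF this, of 1] obtain C where C: "C \<ge> 0"
    "\<And>z. norm z \<le> 1 \<Longrightarrow> norm (exp z - 1 - (exp 0 - 1) - deriv (\<lambda>z::complex. exp z - 1) 0 * z - deriv (deriv (\<lambda>z::complex. exp z - 1)) 0 * z^2 / 2) \<le> C * norm z ^ 3"
    by blast
  have d1: "deriv (\<lambda>z::complex. exp z - 1) = exp"
    by (rule ext, rule DERIV_imp_deriv) (auto intro!: derivative_eq_intros)
  have d2: "deriv (exp :: complex \<Rightarrow> complex) 0 = 1"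
    by (rule DERIV_imp_deriv) (auto intro!: derivative_eq_intros)
  \<comment> \<open>The decay constant is the lower bound \<open>exp (- 1)\<close> of
    \<open>exp h\<close> times the constant of the cosine estimate.\<close>
  have "cumulant_family poisson_mass (\<lambda>z. exp z - 1) 1 1 (exp (- 1) * 2 / pi^2) C 1"
  proof
    show "poisson_mass n \<in> borel_measurable borel" for n
      unfolding poisson_mass_def by measurable
    show "continuous_on UNIV (\<lambda>z::complex. exp z - 1)" by (intro continuous_intros)
    show "norm (exp z - 1 - of_real 1 * z - of_real 1 * z^2 / 2) \<le> C * norm z ^ 3" if "norm z \<le> 1" for z :: complex
      using C(2)[OF that] by (simp add: d1 d2)
    show "complex_of_real (poisson_mass n x) = (1 / (2 * pi)) *\<^sub>R (CLBINT \<theta>:{-pi..pi}.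
          exp (of_real x * (exp (of_real h + \<i> * of_real \<theta>) - 1) - of_nat n * (of_real h + \<i> * of_real \<theta>)))" for n x h
    proof -
      have der: "(deriv ^^ n) (\<lambda>t. exp (complex_of_real x * t)) = (\<lambda>t. of_real x ^ n * exp (of_real x * t))"
      proof (induction n)
        case (Suc n)
        have "deriv (\<lambda>t. complex_of_real x ^ n * exp (of_real x * t)) t = of_real x ^ Suc n * exp (of_real x * t)" for t
          by (rule DERIV_imp_deriv) (auto intro!: derivative_eq_intros)
        then show ?case by (auto simp: Suc)
      qed simp
      have "complex_of_real (x ^ n / fact n * 1 ^ n * exp (- (x * 1))) = (1 / (2 * pi)) *\<^sub>R (CLBINT \<theta>:{-pi..pi}.
          exp (of_real x * (of_real 1 * exp (of_real h + \<i> * of_real \<theta>) - of_real 1) - of_nat n * (of_real h + \<i> * of_real \<theta>)))"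
        by (rule tilted_coefficient_inversion[where \<psi> = "\<lambda>t. t"]) (auto simp: der intro: holomorphic_intros)
      then show ?thesis by (simp add: poisson_mass_def)
    qed
    show "Re (exp (of_real h + \<i> * of_real \<theta>) - 1) \<le> Re (exp (complex_of_real h) - 1) - exp (- 1) * 2 / pi^2 * \<theta>^2"
      if h: "\<bar>h\<bar> \<le> 1" and \<theta>: "\<bar>\<theta>\<bar> \<le> pi" for h \<theta> :: real
    proof -
      have "exp (- 1) * (2 * \<theta>^2 / pi^2) \<le> exp h * (1 - cos \<theta>)"
        using h cos_le_one_minus_square[OF \<theta>] by (intro mult_mono) auto
      then show ?thesis by (simp add: Re_exp algebra_simps)
    qed
  qed (use C in auto)
  then show ?thesis by blast
qed

text \<open>The coefficient of \<open>t ^ n\<close> in \<open>exp (x * (1 - exp (- t)))\<close>,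
  tilted to radius \<open>L\<close>. The signs arise because this is the generating function
  \<open>exp (y * (exp u - 1))\<close> of the Touchard polynomials at \<open>y = - x\<close>,
  \<open>u = - t\<close>.\<close>

definition touchard_mass :: "real \<Rightarrow> nat \<Rightarrow> real \<Rightarrow> real" where
  "touchard_mass L n x = (- 1) ^ n * poly (touchard n) (- x) / fact n * L ^ n * exp (- (x * (1 - exp (- L))))"

lemma poly_map_poly_of_real:
  "poly (map_poly of_real p) (of_real x :: 'a :: {real_algebra_1, comm_ring_1}) = of_real (poly p x)"
  by (induction p) (simp_all add: map_poly_pCons)

text \<open>With \<open>y = - x * exp (- t)\<close>, both \<open>y\<close> and the exponential
  factor differentiate to \<open>- y\<close> times themselves; a polynomial factor \<open>q\<close>
  in \<open>y\<close> thus turns into \<open>- y * (q + q')\<close>, the recurrence of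
  \<open>touchard\<close>.\<close>

lemma higher_deriv_touchard:
  fixes x :: complex
  shows "(deriv ^^ n) (\<lambda>t. exp (x * (1 - exp (- t)))) =
     (\<lambda>t. (- 1) ^ n * poly (map_poly of_real (touchard n)) (- x * exp (- t)) * exp (x * (1 - exp (- t))))"
proof (induction n)
  case (Suc n)
  define q where "q = map_poly complex_of_real (touchard n)"
  have q': "map_poly complex_of_real (touchard (Suc n)) = pCons 0 (q + pderiv q)"
    by (intro poly_eqI) (simp add: q_def coeff_map_poly coeff_pCons coeff_pderiv split: nat.split)
  have "deriv (\<lambda>t. (- 1) ^ n * poly q (- x * exp (- t)) * exp (x * (1 - exp (- t)))) t =
     (- 1) ^ Suc n * poly (pCons 0 (q + pderiv q)) (- x * exp (- t)) * exp (x * (1 - exp (- t)))" for t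
    by (rule DERIV_imp_deriv)
       (auto intro!: derivative_eq_intros poly_DERIV[THEN DERIV_chain2] simp: algebra_simps)
  then show ?case by (auto simp: Suc q' simp flip: q_def simp del: touchard.simps)
qed (simp add: map_poly_1')

text \<open>With \<open>a = r * (1 - cos \<theta>)\<close> and after division by
  \<open>exp (- r)\<close>, it suffices that
  \<open>1 + a / 5 \<le> exp a * cos (r * sin \<theta>)\<close>. To first order the right side is
  \<open>1 + a * (1 - r)\<close>, so \<open>r\<close> must stay below 1; up to \<open>3 / 4\<close>
  the bounds \<open>1 + a\<close> and one minus half the square suffice for the two factors.\<close>

lemma cumulant_decay_exp:
  fixes r \<theta> :: real
  assumes r: "0 < r" "r \<le> 3 / 4" and \<theta>: "\<bar>\<theta>\<bar> \<le> pi"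
  shows "exp (- r) + exp (- r) * r / 5 * (2 * \<theta>^2 / pi^2) \<le> exp (- (r * cos \<theta>)) * cos (r * sin \<theta>)"
proof -
  define a where "a = r * (1 - cos \<theta>)"
  have a: "0 \<le> a" using r by (simp add: a_def)
  have "(sin \<theta>)^2 = (1 - cos \<theta>) * (1 + cos \<theta>)"
    unfolding sin_squared_eq by (simp add: power2_eq_square algebra_simps)
  then have "(r * sin \<theta>)^2 = r^2 * ((1 - cos \<theta>) * (1 + cos \<theta>))"
    by (simp add: power_mult_distrib)
  also have "\<dots> = a * (2 * r - a)" by (simp add: a_def power2_eq_square algebra_simps)
  finally have b2: "(r * sin \<theta>)^2 / 2 = a * r - a^2 / 2" by (simp add: power2_eq_square algebra_simps)
  have "\<bar>r * sin \<theta>\<bar> \<le> 3 / 4 * 1" unfolding abs_mult using r by (intro mult_mono) auto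
  then have "(r * sin \<theta>)^2 \<le> 1" by (simp add: abs_square_le_1)
  \<comment> \<open>Lower bounds may be multiplied only if they are non-negative.\<close>
  then have B0: "0 \<le> 1 - (a * r - a^2 / 2)" using b2 by linarith
  have "1 - (r * sin \<theta>)^2 / 2 \<le> cos (r * sin \<theta>)"
  proof -
    have "cos (r * sin \<theta>) = 1 - 2 * (sin (r * sin \<theta> / 2))^2"
      using cos_double_sin[of "r * sin \<theta> / 2"] by simp
    moreover have "(sin (r * sin \<theta> / 2))^2 \<le> (r * sin \<theta> / 2)^2"
      using abs_sin_x_le_abs_x by (rule abs_le_square_iff[THEN iffD1])
    ultimately show ?thesis by (simp add: power_divide)
  qed
  then have c: "1 - (a * r - a^2 / 2) \<le> cos (r * sin \<theta>)" using b2 by simp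
  \<comment> \<open>This is the product of the two lower bounds minus \<open>1 + a / 5\<close>. The
    quadratic in \<open>a\<close> has minimum \<open>4 / 5 - r - (1 / 2 - r)^2 / 2\<close>, which at
    \<open>r = 3 / 4\<close> is still positive, but below \<open>1 / 50\<close>.\<close>
  have "0 \<le> a * ((4 / 5 - r) + a * (1 / 2 - r) + a^2 / 2)"
  proof (rule mult_nonneg_nonneg[OF a])
    have eq: "(4 / 5 - r) + a * (1 / 2 - r) + a^2 / 2 = (a + (1 / 2 - r))^2 / 2 + (4 / 5 - r - (1 / 2 - r)^2 / 2)"
      by (simp add: power2_eq_square field_simps)
    have "(1 / 2 - r)^2 = 1 / 4 - r + r * r" by (simp add: power2_eq_square field_simps)
    moreover have "r * r \<le> 3 / 4 * r" using r by (intro mult_right_mono) auto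
    ultimately have "0 \<le> 4 / 5 - r - (1 / 2 - r)^2 / 2" using r by linarith
    moreover have "0 \<le> (a + (1 / 2 - r))^2 / 2" by simp
    ultimately show "0 \<le> (4 / 5 - r) + a * (1 / 2 - r) + a^2 / 2" unfolding eq by (rule add_nonneg_nonneg[rotated])
  qed
  then have "1 + a / 5 \<le> (1 + a) * (1 - (a * r - a^2 / 2))"
    by (simp add: power2_eq_square field_simps)
  also have "\<dots> \<le> exp a * cos (r * sin \<theta>)"
    using a B0 c exp_ge_add_one_self[of a] by (intro mult_mono) auto
  finally have "exp (- r) * (1 + a / 5) \<le> exp (- r) * (exp a * cos (r * sin \<theta>))"
    by (rule mult_left_mono) simp
  also have "\<dots> = exp (- r + a) * cos (r * sin \<theta>)" by (simp only: exp_add mult.assoc)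
  also have "- r + a = - (r * cos \<theta>)" by (simp add: a_def algebra_simps)
  finally have main: "exp (- r) * (1 + a / 5) \<le> exp (- (r * cos \<theta>)) * cos (r * sin \<theta>)" .
  have "exp (- r) * r / 5 * (2 * \<theta>^2 / pi^2) \<le> exp (- r) * r / 5 * (1 - cos \<theta>)"
    using r cos_le_one_minus_square[OF \<theta>] by (intro mult_left_mono) auto
  also have "\<dots> = exp (- r) * (a / 5)" by (simp add: a_def)
  finally show ?thesis using main unfolding distrib_left mult_1_right by linarith
qed

lemma touchard_cumulant_family:
  assumes L: "0 < L" "L \<le> 7 / 10"
  shows "\<exists>c C. cumulant_family (touchard_mass L) (\<lambda>z. exp (- of_real L) - exp (- (of_real L * exp z)))
     (L * exp (- L)) (L * exp (- L) * (1 - L)) c C (1 / 20)"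
proof -
  define \<kappa> where "\<kappa> = (\<lambda>z. exp (- of_real L) - exp (- (of_real L * exp z)) :: complex)"
  \<comment> \<open>On the admissible circles the radius lies between
    \<open>L * exp (- (1 / 20))\<close> and 1, so this bounds the coefficient in
    \<open>cumulant_decay_exp\<close> from below.\<close>
  define c where "c = exp (- 1) * (L * exp (- (1 / 20))) / 5 * (2 / pi^2)"
  have "\<kappa> holomorphic_on UNIV" unfolding \<kappa>_def by (intro holomorphic_intros)
  from holomorphic_taylor2[OF this, of "1 / 20"] obtain C where C: "C \<ge> 0"
    "\<And>z. norm z \<le> 1 / 20 \<Longrightarrow> norm (\<kappa> z - \<kappa> 0 - deriv \<kappa> 0 * z - deriv (deriv \<kappa>) 0 * z^2 / 2) \<le> C * norm z ^ 3"
    by blast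
  have d1: "deriv \<kappa> = (\<lambda>z. of_real L * exp z * exp (- (of_real L * exp z)))"
    unfolding \<kappa>_def by (rule ext, rule DERIV_imp_deriv) (auto intro!: derivative_eq_intros)
  have d2: "deriv (\<lambda>z. of_real L * exp z * exp (- (of_real L * exp z))) 0 = complex_of_real (L * exp (- L) * (1 - L))"
    by (rule DERIV_imp_deriv) (auto intro!: derivative_eq_intros simp: algebra_simps exp_of_real[symmetric])
  have "cumulant_family (touchard_mass L) \<kappa> (L * exp (- L)) (L * exp (- L) * (1 - L)) c C (1 / 20)"
  proof
    show "touchard_mass L n \<in> borel_measurable borel" for n
      unfolding touchard_mass_def
      by (intro borel_measurable_continuous_onI continuous_intros) auto
    show "continuous_on UNIV \<kappa>" unfolding \<kappa>_def by (intro continuous_intros)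
    show "norm (\<kappa> z - of_real (L * exp (- L)) * z - of_real (L * exp (- L) * (1 - L)) * z^2 / 2) \<le> C * norm z ^ 3"
      if "norm z \<le> 1 / 20" for z
    proof -
      have "\<kappa> 0 = 0" by (simp add: \<kappa>_def)
      moreover have "deriv \<kappa> 0 = of_real (L * exp (- L))" by (simp add: d1 exp_of_real[symmetric])
      moreover have "deriv (deriv \<kappa>) 0 = of_real (L * exp (- L) * (1 - L))" unfolding d1 by (rule d2)
      ultimately show ?thesis using C(2)[OF that] by simp
    qed
    show "complex_of_real (touchard_mass L n x) = (1 / (2 * pi)) *\<^sub>R (CLBINT \<theta>:{-pi..pi}.
          exp (of_real x * \<kappa> (of_real h + \<i> * of_real \<theta>) - of_nat n * (of_real h + \<i> * of_real \<theta>)))" for n x h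
    proof -
      have "complex_of_real (((- 1) ^ n * poly (touchard n) (- x) / fact n) * L ^ n * exp (- (x * (1 - exp (- L))))) =
         (1 / (2 * pi)) *\<^sub>R (CLBINT \<theta>:{-pi..pi}.
          exp (of_real x * ((1 - exp (- (of_real L * exp (of_real h + \<i> * of_real \<theta>)))) - of_real (1 - exp (- L)))
            - of_nat n * (of_real h + \<i> * of_real \<theta>)))"
      proof (rule tilted_coefficient_inversion[where \<psi> = "\<lambda>t. 1 - exp (- t)"])
        have "poly (map_poly complex_of_real (touchard n)) (- of_real x) = of_real (poly (touchard n) (- x))"
          using poly_map_poly_of_real[of "touchard n" "- x"] by simp
        then show "complex_of_real ((- 1) ^ n * poly (touchard n) (- x) / fact n) =
            (deriv ^^ n) (\<lambda>t. exp (of_real x * (1 - exp (- t)))) 0 / fact n"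
          by (simp add: higher_deriv_touchard)
      qed (use L in \<open>auto intro!: holomorphic_intros\<close>)
      then show ?thesis by (simp add: touchard_mass_def \<kappa>_def exp_of_real[symmetric])
    qed
    show "Re (\<kappa> (of_real h + \<i> * of_real \<theta>)) \<le> Re (\<kappa> (of_real h)) - c * \<theta>^2"
      if h: "\<bar>h\<bar> \<le> 1 / 20" and \<theta>: "\<bar>\<theta>\<bar> \<le> pi" for h \<theta>
    proof -
      define r where "r = L * exp h"
      have "exp h \<le> exp (1 / 20)" using h by simp
      \<comment> \<open>The factor \<open>15 / 14\<close> carries the bound \<open>7 / 10\<close>
        for \<open>L\<close> exactly to the radius \<open>3 / 4\<close>; this dictates the shift
        range \<open>1 / 20\<close>.\<close>
      also have "\<dots> \<le> 15 / 14"
      proof -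
        have "1 + - (1 / 20) \<le> exp (- (1 / 20 :: real))" by (rule exp_ge_add_one_self)
        then have "inverse (exp (- (1 / 20 :: real))) \<le> inverse (19 / 20)"
          by (intro le_imp_inverse_le) auto
        then show ?thesis by (simp add: exp_minus)
      qed
      finally have "r \<le> 7 / 10 * (15 / 14)" unfolding r_def using L by (intro mult_mono) auto
      then have r: "0 < r" "r \<le> 3 / 4" using L by (auto simp: r_def)
      have "c * \<theta>^2 = exp (- 1) * (L * exp (- (1 / 20))) / 5 * (2 * \<theta>^2 / pi^2)"
        by (simp add: c_def)
      also have "\<dots> \<le> exp (- r) * r / 5 * (2 * \<theta>^2 / pi^2)"
        using r L h by (intro mult_right_mono divide_right_mono mult_mono) (auto simp: r_def)
      finally have "exp (- r) + c * \<theta>^2 \<le> exp (- (r * cos \<theta>)) * cos (r * sin \<theta>)"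
        using cumulant_decay_exp[OF r \<theta>] by linarith
      moreover have "Re (\<kappa> (of_real h + \<i> * of_real \<theta>)) = exp (- L) - exp (- (r * cos \<theta>)) * cos (r * sin \<theta>)"
        by (simp add: \<kappa>_def r_def Re_exp Im_exp mult.assoc)
      moreover have "Re (\<kappa> (of_real h)) = exp (- L) - exp (- r)"
        by (simp add: \<kappa>_def r_def Re_exp Im_exp)
      ultimately show ?thesis by simp
    qed
    show "c > 0" using L by (simp add: c_def)
  qed (use L C in auto)
  then show ?thesis unfolding \<kappa>_def by blast
qed

section \<open>Gamma moments and the chromatic polynomial at negative arguments\<close>

lemma Gamma_moment:
  fixes s :: real
  assumes "s > 0"
  shows "set_integrable lborel {0<..} (\<lambda>x. x powr (s - 1) * exp (- x) * x ^ k)"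
    and "(LBINT x:{0<..}. x powr (s - 1) * exp (- x) * x ^ k) = Gamma (s + real k)"
proof -
  have "((\<lambda>t. t powr (s + real k - 1) / exp t) has_integral Gamma (s + real k)) {0..}"
    using Gamma_integral_real[of "s + real k"] assms by simp
  then have "((\<lambda>t. if t \<in> {0<..} then t powr (s + real k - 1) / exp t else 0) has_integral Gamma (s + real k)) {0..}"
    by (rule has_integral_spike[of "{0}", rotated 2]) auto
  then have "((\<lambda>t. t powr (s + real k - 1) / exp t) has_integral Gamma (s + real k)) {0<..}"
    by (subst (asm) has_integral_restrict) auto
  moreover have "t powr (s + real k - 1) / exp t = t powr (s - 1) * exp (- t) * t ^ k" if "t \<in> {0<..}" for t
  proof -
    have "t powr (s + real k - 1) = t powr ((s - 1) + real k)" by (simp add: algebra_simps)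
    also have "\<dots> = t powr (s - 1) * t ^ k" using that by (simp add: powr_add powr_realpow)
    finally show ?thesis by (simp add: exp_minus divide_inverse mult_ac)
  qed
  ultimately have "((\<lambda>t. t powr (s - 1) * exp (- t) * t ^ k) has_integral Gamma (s + real k)) {0<..}"
    by (subst has_integral_cong[symmetric]) auto
  from set_integral_lborel_of_has_integral[OF _ this]
  show "set_integrable lborel {0<..} (\<lambda>x. x powr (s - 1) * exp (- x) * x ^ k)"
    "(LBINT x:{0<..}. x powr (s - 1) * exp (- x) * x ^ k) = Gamma (s + real k)" by auto
qed

lemma umbral_ffact_minus_eq_integral:
  fixes s :: real
  assumes s: "s > 0"
  shows "Gamma s * umbral (ffact (- s)) P = (LBINT x:{0<..}. x powr (s - 1) * exp (- x) * poly P (- x))"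
proof -
  have ff: "ffact (- s) k = (- 1) ^ k * pochhammer s k" for k
    by (induction k) (simp_all add: ffact_Suc pochhammer_Suc algebra_simps)
  have "s \<notin> \<int>\<^sub>\<le>\<^sub>0" using s by (auto elim!: nonpos_Ints_cases)
  then have poch: "Gamma s * pochhammer s k = Gamma (s + real k)" for k
    using Gamma_real_pos[OF s] by (simp add: pochhammer_Gamma)
  have "(LBINT x:{0<..}. x powr (s - 1) * exp (- x) * poly P (- x)) =
        (LBINT x:{0<..}. \<Sum>k\<le>degree P. (coeff P k * (- 1) ^ k) * (x powr (s - 1) * exp (- x) * x ^ k))"
  proof (rule set_lebesgue_integral_cong)
    have "x powr (s - 1) * exp (- x) * poly P (- x) =
      (\<Sum>k\<le>degree P. (coeff P k * (- 1) ^ k) * (x powr (s - 1) * exp (- x) * x ^ k))" for x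
      unfolding poly_altdef power_minus[of x] sum_distrib_left by (simp only: mult_ac)
    then show "\<forall>x. x \<in> {0<..} \<longrightarrow> x powr (s - 1) * exp (- x) * poly P (- x) =
      (\<Sum>k\<le>degree P. (coeff P k * (- 1) ^ k) * (x powr (s - 1) * exp (- x) * x ^ k))"
      by blast
  qed simp
  also have "\<dots> = (\<Sum>k\<le>degree P. (coeff P k * (- 1) ^ k) * Gamma (s + real k))"
  proof -
    have "(LBINT x:{0<..}. \<Sum>k\<le>degree P. (coeff P k * (- 1) ^ k) * (x powr (s - 1) * exp (- x) * x ^ k)) =
      (\<Sum>k\<le>degree P. LBINT x:{0<..}. (coeff P k * (- 1) ^ k) * (x powr (s - 1) * exp (- x) * x ^ k))"
      unfolding set_lebesgue_integral_def scaleR_sum_right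
    proof (rule Bochner_Integration.integral_sum)
      fix k
      show "integrable lborel (\<lambda>x. indicat_real {0<..} x *\<^sub>R ((coeff P k * (- 1) ^ k) * (x powr (s - 1) * exp (- x) * x ^ k)))"
        using set_integrable_mult_right[OF Gamma_moment(1)[OF s]] unfolding set_integrable_def .
    qed
    then show ?thesis using Gamma_moment(2)[OF s] by simp
  qed
  also have "\<dots> = Gamma s * umbral (ffact (- s)) P"
    by (simp add: umbral_def sum_distrib_left ff mult_ac flip: poch)
  finally show ?thesis ..
qed

section \<open>Asymptotics for Turan graphs\<close>

text \<open>Scaling isolates the dependence on \<sigma>; the remaining integral is common to both
  families and cancels in their quotient.\<close>

lemma integral_normal_density_power:
  assumes "\<sigma> > 0" "p > 0"
  shows "(LBINT y. normal_density 0 \<sigma> y ^ p) = \<sigma> * (1 / \<sigma>) ^ p * (LBINT y. std_normal_density y ^ p)"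
proof -
  have "normal_density 0 \<sigma> (\<sigma> * y) = 1 / \<sigma> * std_normal_density y" for y
    using assms by (simp add: normal_density_def power_mult_distrib real_sqrt_mult)
  then show ?thesis
    using assms
    by (subst lborel_integral_real_affine[where c = \<sigma> and t = 0]) (simp_all add: power_divide)
qed

lemma integral_std_normal_density_power_pos:
  assumes "p > 0"
  shows "(LBINT y. std_normal_density y ^ p) > 0"
proof -
  have "std_normal_density y ^ p = (1 / sqrt (2 * pi)) ^ p * exp (- (real p / 2) * y^2)" for y
    by (simp add: normal_density_def power_mult_distrib exp_of_nat_mult[symmetric] power_divide)
  then have "(LBINT y. std_normal_density y ^ p) = (1 / sqrt (2 * pi)) ^ p * sqrt (pi / (real p / 2))"
    using integral_gaussian[of "real p / 2"] assms by simp
  then show ?thesis using assms by simp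
qed

text \<open>The product collapses to a single Gamma integrand with rate \<open>p\<close>. The value
  is \<open>1 / p\<close> times the probability that \<open>N\<close> balls thrown uniformly into
  \<open>p\<close> boxes have occupancies \<open>n i\<close>.\<close>

lemma integral_prod_poisson_mass:
  assumes p: "p > 0" and N: "(\<Sum>i<p. n i) = N"
  shows "(LBINT x:{0<..}. \<Prod>i<p. poisson_mass (n i) x) = fact N / (real p ^ (N + 1) * (\<Prod>i<p. fact (n i)))"
proof -
  define P where "P = (\<Prod>i<p. fact (n i) :: real)"
  have "(\<Prod>i<p. poisson_mass (n i) x) = x ^ N * exp (- (real p * x)) / P" for x
  proof -
    have "(\<Prod>i<p. poisson_mass (n i) x) = (\<Prod>i<p. x ^ n i) * exp (- x) ^ p / P"
      by (simp add: poisson_mass_def prod.distrib prod_dividef P_def)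
    also have "(\<Prod>i<p. x ^ n i) = x ^ N" by (simp add: N power_sum[symmetric])
    also have "exp (- x) ^ p = exp (- (real p * x))" by (simp add: exp_of_nat_mult[symmetric])
    finally show ?thesis .
  qed
  then have "(LBINT x:{0<..}. \<Prod>i<p. poisson_mass (n i) x) = (LBINT x. indicat_real {0<..} x * (x ^ N * exp (- (real p * x)) / P))"
    by (simp add: set_lebesgue_integral_def)
  also have "\<dots> = 1 / real p * (LBINT x. indicat_real {0<..} (x / p) * ((x / p) ^ N * exp (- x) / P))"
    using p by (subst lborel_integral_real_affine[where c = "1 / real p" and t = 0]) auto
  also have "(\<lambda>x. indicat_real {0<..} (x / p) * ((x / p) ^ N * exp (- x) / P)) =
      (\<lambda>x. (1 / (real p ^ N * P)) * (indicat_real {0<..} x * (x powr (1 - 1) * exp (- x) * x ^ N)))"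
    using p by (auto simp: fun_eq_iff indicator_def power_divide zero_less_divide_iff)
  also have "(LBINT x. (1 / (real p ^ N * P)) * (indicat_real {0<..} x * (x powr (1 - 1) * exp (- x) * x ^ N))) =
     1 / (real p ^ N * P) * fact N"
    using Gamma_moment(2)[of 1 N] by (simp add: set_lebesgue_integral_def Gamma_fact)
  finally show ?thesis by (simp add: P_def)
qed

text \<open>Summing the pairwise inequality over \<open>j\<close> compares \<open>p * n i\<close>
  with \<open>N\<close> in both directions, up to \<open>p\<close>.\<close>

lemma balanced_part_sizes:
  fixes n :: "nat \<Rightarrow> nat"
  assumes "p > 0" "(\<Sum>i<p. n i) = N" "\<And>i j. i < p \<Longrightarrow> j < p \<Longrightarrow> n i \<le> n j + 1" "i < p"
  shows "\<bar>real (n i) - real N / real p\<bar> \<le> 1"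
proof -
  have "(\<Sum>j<p. n i) \<le> (\<Sum>j<p. n j + 1)" by (rule sum_mono) (use assms in auto)
  moreover have "(\<Sum>j<p. n j) \<le> (\<Sum>j<p. n i + 1)" by (rule sum_mono) (use assms in auto)
  ultimately have "p * n i \<le> N + p" "N \<le> p * n i + p"
    using assms(2) by (simp_all add: sum.distrib sum_Suc)
  then have "real (p * n i) \<le> real (N + p)" "real N \<le> real (p * n i + p)" by (simp_all only: of_nat_le_iff)
  then have "real p * real (n i) \<le> real N + real p" "real N \<le> real p * real (n i) + real p" by simp_all
  then show ?thesis using assms(1) by (auto simp: abs_le_iff field_simps)
qed

text \<open>Both integrals follow the same limit theorem with the same \<open>M = N / p\<close>. In
  the quotient \<open>sqrt M ^ (p - 1)\<close> and the Gaussian integral \<open>J\<close> drop out;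
  the location of the mass and the variance \<open>1 - L\<close> remain.\<close>

lemma multipartite_integral_ratio:
  fixes p :: nat and s L :: real and n :: "nat \<Rightarrow> nat \<Rightarrow> nat"
  assumes p: "p \<ge> 2" and s: "s > 0" and L: "L = ln (real p / (real p - 1))"
    and n: "\<And>N i. i < p \<Longrightarrow> \<bar>real (n N i) - real N / real p\<bar> \<le> 1"
  shows "(\<lambda>N. (LBINT x:{0<..}. x powr (s - 1) * (\<Prod>i<p. touchard_mass L (n N i) x)) /
             (LBINT x:{0<..}. \<Prod>i<p. poisson_mass (n N i) x) *
             (((real p - 1) * L) powr s * (1 - L) powr ((real p - 1) / 2) / (real p * real N powr (s - 1)))) \<longlonglongrightarrow> 1"
proof -
  have L0: "0 < L" using p by (simp add: L)
  have L1: "L \<le> 7 / 10"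
  proof -
    have "real p / (real p - 1) \<le> 2" using p by (simp add: field_simps)
    then have "L \<le> ln 2" unfolding L using p by (subst ln_le_cancel_iff) auto
    then show ?thesis using ln2_le_25_over_36 by simp
  qed
  have eL: "exp (- L) = (real p - 1) / real p"
    using p by (simp add: L exp_minus)
  define \<mu> where "\<mu> = L * exp (- L)"
  define v where "v = L * exp (- L) * (1 - L)"
  define J where "J = (LBINT y. std_normal_density y ^ p)"
  define DL where "DL = (\<lambda>N. LBINT x:{0<..}. x powr (s - 1) * (\<Prod>i<p. touchard_mass L (n N i) x))"
  define DP where "DP = (\<lambda>N. LBINT x:{0<..}. \<Prod>i<p. poisson_mass (n N i) x)"
  define M where "M = (\<lambda>N. real N / real p)"
  have J: "J > 0" unfolding J_def using p by (intro integral_std_normal_density_power_pos) auto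
  have p0: "p > 0" using p by simp
  have \<mu>: "\<mu> > 0" using L0 by (simp add: \<mu>_def)
  have M: "filterlim M at_top sequentially"
    unfolding M_def using p0 by real_asymp
  have vm: "v / \<mu> = 1 - L" using L0 by (simp add: v_def \<mu>_def)
  obtain cL CL where "cumulant_family (touchard_mass L) (\<lambda>z. exp (- of_real L) - exp (- (of_real L * exp z))) \<mu> v cL CL (1 / 20)"
    using touchard_cumulant_family[OF L0 L1] unfolding \<mu>_def v_def by blast
  from cumulant_family.integral_prod_asymptotics[OF this s p0 M, of n]
  have limL: "(\<lambda>N. (M N / \<mu>) powr (1 - s) * sqrt (M N) ^ (p - 1) * \<mu> * DL N) \<longlonglongrightarrow> (LBINT y. normal_density 0 (sqrt (1 - L)) y ^ p)"
    unfolding DL_def vm using n by (simp add: M_def)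
  have "(LBINT y. normal_density 0 (sqrt (1 - L)) y ^ p) = sqrt (1 - L) * (1 / sqrt (1 - L)) ^ p * J"
    unfolding J_def using L1 p0 by (intro integral_normal_density_power) auto
  also have "sqrt (1 - L) * (1 / sqrt (1 - L)) ^ p = 1 / (1 - L) powr ((real p - 1) / 2)"
  proof -
    have "sqrt (1 - L) * (1 / sqrt (1 - L)) ^ p = 1 / sqrt (1 - L) ^ (p - 1)"
      using L1 p0 by (cases p) (auto simp: power_divide)
    also have "sqrt (1 - L) ^ (p - 1) = (1 - L) powr ((real p - 1) / 2)"
      using L1 p0 by (simp add: powr_half_sqrt[symmetric] powr_powr powr_realpow[symmetric] of_nat_diff)
    finally show ?thesis .
  qed
  finally have J': "(LBINT y. normal_density 0 (sqrt (1 - L)) y ^ p) = 1 / (1 - L) powr ((real p - 1) / 2) * J" .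
  obtain cP CP where "cumulant_family poisson_mass (\<lambda>z. exp z - 1) 1 1 cP CP 1"
    using poisson_cumulant_family by blast
  \<comment> \<open>At exponent \<open>s = 1\<close> the power weight disappears, which leaves the
    integral with a closed form.\<close>
  from cumulant_family.integral_prod_asymptotics[OF this zero_less_one p0 M, of n]
  have limP0: "(\<lambda>N. (M N / 1) powr (1 - 1) * sqrt (M N) ^ (p - 1) * 1 *
      (LBINT x:{0<..}. x powr (1 - 1) * (\<Prod>i<p. poisson_mass (n N i) x))) \<longlonglongrightarrow> (LBINT y. normal_density 0 (sqrt (1 / 1)) y ^ p)"
    using n by (simp add: M_def)
  \<comment> \<open>At \<open>N = 0\<close> the normalisation would contain \<open>0 powr 0\<close>,
    which is 0, so it equals 1 for positive \<open>N\<close> only.\<close>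
  have evN: "eventually (\<lambda>N. N > 0) sequentially" by (rule eventually_gt_at_top)
  have limP: "(\<lambda>N. sqrt (M N) ^ (p - 1) * DP N) \<longlonglongrightarrow> J"
  proof (rule Lim_transform_eventually)
    show "(\<lambda>N. (M N / 1) powr (1 - 1) * sqrt (M N) ^ (p - 1) * 1 *
      (LBINT x:{0<..}. x powr (1 - 1) * (\<Prod>i<p. poisson_mass (n N i) x))) \<longlonglongrightarrow> J"
      using limP0 by (simp add: J_def)
    have DP: "(LBINT x:{0<..}. x powr (1 - 1) * (\<Prod>i<p. poisson_mass (n N i) x)) = DP N" for N
      unfolding DP_def by (rule set_lebesgue_integral_cong) auto
    show "eventually (\<lambda>N. (M N / 1) powr (1 - 1) * sqrt (M N) ^ (p - 1) * 1 *
      (LBINT x:{0<..}. x powr (1 - 1) * (\<Prod>i<p. poisson_mass (n N i) x)) = sqrt (M N) ^ (p - 1) * DP N) sequentially"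
      unfolding DP using evN by eventually_elim (use p0 in \<open>simp add: M_def\<close>)
  qed
  have "(\<lambda>N. ((M N / \<mu>) powr (1 - s) * sqrt (M N) ^ (p - 1) * \<mu> * DL N) / (sqrt (M N) ^ (p - 1) * DP N) * (1 - L) powr ((real p - 1) / 2))
     \<longlonglongrightarrow> (1 / (1 - L) powr ((real p - 1) / 2) * J) / J * (1 - L) powr ((real p - 1) / 2)"
    using J by (intro tendsto_mult tendsto_const tendsto_divide[OF limL[unfolded J'] limP]) simp
  also have "(1 / (1 - L) powr ((real p - 1) / 2) * J) / J * (1 - L) powr ((real p - 1) / 2) = 1"
    using J L1 by simp
  finally have "(\<lambda>N. ((M N / \<mu>) powr (1 - s) * sqrt (M N) ^ (p - 1) * \<mu> * DL N) / (sqrt (M N) ^ (p - 1) * DP N) * (1 - L) powr ((real p - 1) / 2)) \<longlonglongrightarrow> 1" .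
  then show ?thesis
  proof (rule Lim_transform_eventually)
    show "eventually (\<lambda>N. ((M N / \<mu>) powr (1 - s) * sqrt (M N) ^ (p - 1) * \<mu> * DL N) / (sqrt (M N) ^ (p - 1) * DP N) * (1 - L) powr ((real p - 1) / 2) =
      (LBINT x:{0<..}. x powr (s - 1) * (\<Prod>i<p. touchard_mass L (n N i) x)) /
             (LBINT x:{0<..}. \<Prod>i<p. poisson_mass (n N i) x) *
             (((real p - 1) * L) powr s * (1 - L) powr ((real p - 1) / 2) / (real p * real N powr (s - 1)))) sequentially"
      using evN
    proof eventually_elim
      case (elim N)
      \<comment> \<open>Because \<open>p * exp (- L) = p - 1\<close>; this is how
        \<open>p - 1\<close> enters the result.\<close>
      have q: "(real p - 1) * L = real p * \<mu>" using p0 by (simp add: \<mu>_def eL)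
      have W: "(M N / \<mu>) powr (1 - s) * \<mu> = ((real p - 1) * L) powr s / (real p * real N powr (s - 1))"
      proof -
        have "(M N / \<mu>) powr (1 - s) = real N powr (1 - s) / (real p * \<mu>) powr (1 - s)"
          unfolding M_def by (simp add: powr_divide[symmetric])
        also have "real N powr (1 - s) = 1 / real N powr (s - 1)"
          using powr_minus_divide[of "real N" "s - 1"] by simp
        also have "(real p * \<mu>) powr (1 - s) = real p * \<mu> / (real p * \<mu>) powr s"
          using p0 \<mu> by (simp add: powr_diff)
        finally show ?thesis unfolding q using \<mu> by simp
      qed
      have "sqrt (M N) ^ (p - 1) \<noteq> 0" using elim p0 by (simp add: M_def)
      then have "((M N / \<mu>) powr (1 - s) * sqrt (M N) ^ (p - 1) * \<mu> * DL N) / (sqrt (M N) ^ (p - 1) * DP N) * (1 - L) powr ((real p - 1) / 2)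
         = DL N / DP N * (((M N / \<mu>) powr (1 - s) * \<mu>) * (1 - L) powr ((real p - 1) / 2))"
        by simp
      also have "\<dots> = DL N / DP N * (((real p - 1) * L) powr s * (1 - L) powr ((real p - 1) / 2) / (real p * real N powr (s - 1)))"
        unfolding W by simp
      finally show ?case by (simp only: DL_def DP_def)
    qed
  qed
qed

lemma turan_graph_parts:
  assumes "is_turan_graph N p G" "p > 0"
  obtains n where "(\<Sum>i<p. n i) = N" "\<And>i. i < p \<Longrightarrow> \<bar>real (n i) - real N / real p\<bar> \<le> 1"
    "\<And>x. poly (chromatic_poly G) x = umbral (ffact x) (\<Prod>i<p. touchard (n i))"
proof -
  obtain c where fin: "finite (verts G)" and N: "card (verts G) = N" and c: "c ` verts G \<subseteq> {..<p}"
    and E: "edges G = {{u, v} | u v. u \<in> verts G \<and> v \<in> verts G \<and> c u \<noteq> c v}"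
    and bal: "\<And>i j. i < p \<Longrightarrow> j < p \<Longrightarrow> card {v \<in> verts G. c v = i} \<le> card {v \<in> verts G. c v = j} + 1"
    using assms(1) unfolding is_turan_graph_def by auto
  define n where "n = (\<lambda>i. card {v \<in> verts G. c v = i})"
  have "(\<Sum>i<p. n i) = N"
  proof -
    have "(\<Sum>i<p. \<Sum>v\<in>{v \<in> verts G. c v = i}. 1 :: nat) = (\<Sum>v\<in>verts G. 1)"
      by (rule sum.group[OF fin _ c]) simp
    then show ?thesis by (simp add: n_def N)
  qed
  moreover from this have "\<bar>real (n i) - real N / real p\<bar> \<le> 1" if "i < p" for i
    using balanced_part_sizes[OF assms(2), of n N i] bal that by (simp add: n_def)
  moreover have "poly (chromatic_poly G) x = umbral (ffact x) (\<Prod>i<p. touchard (n i))" for x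
    unfolding n_def by (rule poly_chromatic_poly_multipartite[OF fin c E])
  ultimately show ?thesis by (rule that)
qed

text \<open>Signs and powers of \<open>L\<close> collect to total degree \<open>N\<close>. The
  product of factorials stays: it occurs in the Poisson integral as well and is never
  estimated.\<close>

lemma chromatic_integral_representation:
  assumes s: "s > 0" and p: "p \<ge> 2" and L: "L = ln (real p / (real p - 1))" and N: "(\<Sum>i<p. n i) = N"
  shows "(- 1) ^ N * umbral (ffact (- s)) (\<Prod>i<p. touchard (n i)) =
     (\<Prod>i<p. fact (n i)) / (Gamma s * L ^ N) * (LBINT x:{0<..}. x powr (s - 1) * (\<Prod>i<p. touchard_mass L (n i) x))"
proof -
  define P where "P = (\<Prod>i<p. fact (n i) :: real)"
  have L0: "0 < L" using p by (simp add: L)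
  have eL: "exp (- L) = (real p - 1) / real p" using p by (simp add: L exp_minus)
  have P0: "P > 0" unfolding P_def by (intro prod_pos) auto
  have "(\<Prod>i<p. touchard_mass L (n i) x) = (- 1) ^ N * L ^ N / P * (exp (- x) * poly (\<Prod>i<p. touchard (n i)) (- x))" for x
  proof -
    have "(\<Prod>i<p. touchard_mass L (n i) x) =
       (\<Prod>i<p. (- 1) ^ n i) * (\<Prod>i<p. poly (touchard (n i)) (- x)) / P * (\<Prod>i<p. L ^ n i) * exp (- (x * (1 - exp (- L)))) ^ p"
      by (simp add: touchard_mass_def prod.distrib prod_dividef P_def)
    also have "exp (- (x * (1 - exp (- L)))) ^ p = exp (real p * (- (x * (1 - exp (- L)))))"
      by (simp only: exp_of_nat_mult)
    also have "real p * (- (x * (1 - exp (- L)))) = - x" using p by (simp add: eL field_simps)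
    finally show ?thesis by (simp add: N power_sum[symmetric] poly_prod)
  qed
  then have "(LBINT x:{0<..}. x powr (s - 1) * (\<Prod>i<p. touchard_mass L (n i) x)) =
     (LBINT x:{0<..}. (- 1) ^ N * L ^ N / P * (x powr (s - 1) * exp (- x) * poly (\<Prod>i<p. touchard (n i)) (- x)))"
    by (simp add: mult_ac)
  also have "\<dots> = (- 1) ^ N * L ^ N / P * (Gamma s * umbral (ffact (- s)) (\<Prod>i<p. touchard (n i)))"
    unfolding umbral_ffact_minus_eq_integral[OF s]
    by (simp only: set_lebesgue_integral_def mult_scaleR_right[symmetric] integral_mult_right_zero)
  finally show ?thesis using L0 P0 Gamma_real_pos[OF s] by (simp add: P_def[symmetric])
qed

theorem theorem4:
  fixes p :: nat and s :: real and G :: "nat \<Rightarrow> 'a graph"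
  assumes "p \<ge> 2" and "s > 0"
    and "\<And>N. is_turan_graph N p (G N)"
  defines "L \<equiv> ln (real p / (real p - 1))"
    and "H \<equiv> (\<lambda>N. (-1) ^ N * poly (chromatic_poly (G N)) (- s))"
  shows "(\<forall>N\<ge>1. H N = s * tutte_poly (G N) (1 + s) 0) \<and>
    H \<sim>[at_top] (\<lambda>N. fact N * real N powr (s - 1) /
      (Gamma s * (real p - 1) powr s * (1 - L) powr ((real p - 1) / 2)
        * real p ^ N * L powr (real N + s))) \<and>
    (\<lambda>N. tutte_poly (G N) (1 + s) 0) \<sim>[at_top] (\<lambda>N. fact N * real N powr (s - 1) /
      (Gamma (s + 1) * (real p - 1) powr s * (1 - L) powr ((real p - 1) / 2)
        * real p ^ N * L powr (real N + s)))"
proof -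
  have p0: "p > 0" using assms(1) by simp
  have L0: "0 < L" using assms(1) by (simp add: L_def)
  have L1: "L < 1"
  proof -
    have "real p / (real p - 1) \<le> 2" using assms(1) by (simp add: field_simps)
    then have "L \<le> ln 2" unfolding L_def using assms(1) by (subst ln_le_cancel_iff) auto
    then show ?thesis using ln2_le_25_over_36 by simp
  qed
  have tutte: "H N = s * tutte_poly (G N) (1 + s) 0" if "N \<ge> 1" for N
  proof -
    have G: "finite (verts (G N))" "card (verts (G N)) = N"
      using assms(3)[of N] unfolding is_turan_graph_def by auto
    have E: "\<exists>u\<in>verts (G N). \<exists>v\<in>verts (G N). e = {u, v}" if "e \<in> edges (G N)" for e
    proof -
      obtain c where "edges (G N) = {{u, v} | u v. u \<in> verts (G N) \<and> v \<in> verts (G N) \<and> (c u :: nat) \<noteq> c v}"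
        using assms(3)[of N] unfolding is_turan_graph_def by auto
      then show ?thesis using that by blast
    qed
    have "num_components (verts (G N)) (edges (G N)) = 1"
      using turan_graph_num_components[OF assms(3) assms(1) that] .
    moreover have "verts (G N) \<noteq> {}" using G(2) that by auto
    ultimately show ?thesis
      unfolding H_def using chromatic_poly_eq_tutte_poly[of "G N" s] G E by simp
  qed
  define R where "R = (\<lambda>N. fact N * real N powr (s - 1) /
      (Gamma s * (real p - 1) powr s * (1 - L) powr ((real p - 1) / 2)
        * real p ^ N * L powr (real N + s)))"
  have "\<exists>n. (\<Sum>i<p. n i) = N \<and> (\<forall>i<p. \<bar>real (n i) - real N / real p\<bar> \<le> 1) \<and>
    (\<forall>x. poly (chromatic_poly (G N)) x = umbral (ffact x) (\<Prod>i<p. touchard (n i)))" for N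
    using turan_graph_parts[OF assms(3) p0] by metis
  then obtain n where n: "\<And>N. (\<Sum>i<p. n N i) = N"
    "\<And>N i. i < p \<Longrightarrow> \<bar>real (n N i) - real N / real p\<bar> \<le> 1"
    "\<And>N x. poly (chromatic_poly (G N)) x = umbral (ffact x) (\<Prod>i<p. touchard (n N i))"
    by metis
  have "(\<lambda>N. H N / R N) \<longlonglongrightarrow> 1"
  proof (rule Lim_transform_eventually)
    show "(\<lambda>N. (LBINT x:{0<..}. x powr (s - 1) * (\<Prod>i<p. touchard_mass L (n N i) x)) /
             (LBINT x:{0<..}. \<Prod>i<p. poisson_mass (n N i) x) *
             (((real p - 1) * L) powr s * (1 - L) powr ((real p - 1) / 2) / (real p * real N powr (s - 1)))) \<longlonglongrightarrow> 1"
      by (rule multipartite_integral_ratio[OF assms(1,2)]) (use n(2) in \<open>auto simp: L_def\<close>)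
    show "eventually (\<lambda>N. (LBINT x:{0<..}. x powr (s - 1) * (\<Prod>i<p. touchard_mass L (n N i) x)) /
             (LBINT x:{0<..}. \<Prod>i<p. poisson_mass (n N i) x) *
             (((real p - 1) * L) powr s * (1 - L) powr ((real p - 1) / 2) / (real p * real N powr (s - 1))) = H N / R N) sequentially"
      \<comment> \<open>At \<open>N = 0\<close> the factor \<open>N powr (s - 1)\<close> is 0 and
        could not be cancelled.\<close>
      using eventually_gt_at_top[of 0]
    proof eventually_elim
      case (elim N)
      define D where "D = (LBINT x:{0<..}. x powr (s - 1) * (\<Prod>i<p. touchard_mass L (n N i) x))"
      define P where "P = (\<Prod>i<p. fact (n N i) :: real)"
      have P0: "P > 0" unfolding P_def by (intro prod_pos) auto
      have 1: "H N = P / (Gamma s * L ^ N) * D"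
        unfolding H_def n(3) P_def D_def
        by (rule chromatic_integral_representation[OF assms(2,1) _ n(1)]) (simp add: L_def)
      have 2: "(LBINT x:{0<..}. \<Prod>i<p. poisson_mass (n N i) x) = fact N / (real p ^ (N + 1) * P)"
        unfolding P_def by (rule integral_prod_poisson_mass[OF p0 n(1)])
      have 3: "((real p - 1) * L) powr s = (real p - 1) powr s * L powr s"
        by (rule powr_mult)
      have 4: "L powr (real N + s) = L ^ N * L powr s"
        using L0 by (simp add: powr_add powr_realpow)
      have nz: "P \<noteq> 0" "L \<noteq> 0" "Gamma s \<noteq> 0" "(real p - 1) powr s \<noteq> 0" "L powr s \<noteq> 0"
        "(1 - L) powr ((real p - 1) / 2) \<noteq> 0" "real N powr (s - 1) \<noteq> 0" "real p \<noteq> 0"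
        using elim p0 P0 L0 L1 Gamma_real_pos[OF assms(2)] assms(1) by auto
      \<comment> \<open>Both sides carry \<open>P\<close>, from the chromatic polynomial and from
        the Poisson integral. Abstracting the real powers to \<open>a\<close>, \<open>b\<close>,
        \<open>e\<close>, \<open>w\<close> leaves an identity of rational functions; the spare
        factor \<open>p\<close> cancels the one in \<open>p ^ (N + 1)\<close>.\<close>
      have "D / (fact N / (real p ^ (N + 1) * P)) * (a * b * e / (real p * w)) =
         P / (Gamma s * L ^ N) * D / (fact N * w / (Gamma s * a * e * real p ^ N * (L ^ N * b)))"
        if "a \<noteq> 0" "b \<noteq> 0" "e \<noteq> 0" "w \<noteq> 0" for a b e w :: real
        using that nz(1-3,8) by (simp add: field_simps)
      from this[OF nz(4-7)] show ?case
        unfolding D_def[symmetric] R_def 1 2 3 4 .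
    qed
  qed
  then have HR: "H \<sim>[at_top] R"
    by (intro asymp_equivI') simp
  have "(\<lambda>N. H N / s) \<sim>[at_top] (\<lambda>N. R N / s)"
    using HR by (intro asymp_equiv_intros)
  moreover have "eventually (\<lambda>N. H N / s = tutte_poly (G N) (1 + s) 0) at_top"
    using eventually_ge_at_top[of 1] by eventually_elim (use tutte assms(2) in simp)
  \<comment> \<open>Dividing by \<open>s\<close> turns \<open>Gamma s\<close> into
    \<open>Gamma (s + 1)\<close>.\<close>
  moreover have "R N / s = fact N * real N powr (s - 1) /
      (Gamma (s + 1) * (real p - 1) powr s * (1 - L) powr ((real p - 1) / 2)
        * real p ^ N * L powr (real N + s))" for N
    using assms(2) by (simp add: R_def Gamma_plus1 nonpos_Ints_def mult_ac)
  ultimately have "(\<lambda>N. tutte_poly (G N) (1 + s) 0) \<sim>[at_top] (\<lambda>N. fact N * real N powr (s - 1) /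
      (Gamma (s + 1) * (real p - 1) powr s * (1 - L) powr ((real p - 1) / 2)
        * real p ^ N * L powr (real N + s)))"
    by (subst (asm) asymp_equiv_cong) auto
  then show ?thesis using tutte HR unfolding R_def by blast
qed

end
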